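(* Let $\alpha\in(0,1)$ and let $L_t=\inf\{s>0:\sigma_s>t\}$, $t\ge0$, be the inverse of an $\alpha$-stable subordinator $\sigma$. Let $X$ be a $2$-polynomial process, independent of $\sigma$, with one-dimensional state space $S\subseteq\mathbb{R}$, extended generator $\mathcal{G}$, and $2$-limiting distribution $\mu$. Suppose that $\mathcal{G}|_{\mathcal{P}_2}$ is zero-stable, and let $0$ and $-\beta<0$ be the eigenvalues of $\mathcal{G}|_{\mathcal{P}_1}$. Then, for $s,t\ge0$, $$\mathrm{corr}_\mu(X_{L_{t+s}},X_{L_t})=\hat F_{s,t}(\beta)=\frac{\alpha\beta(t+s)^\alpha}{\Gamma(1+\alpha)}\int_0^{\frac{t}{t+s}}\frac{E_\alpha\big(-\beta(t+s)^\alpha(1-z)^\alpha\big)}{z^{1-\alpha}}\,dz+E_\alpha\big(-\beta(t+s)^\alpha\big),$$ where $\hat F_{s,t}(\lambda)=\mathbb{E}[e^{-\lambda(L_{t+s}-L_t)}]$.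
   Context: $S\subseteq\mathbb{R}$ is closed with nonempty interior. $\mathcal{P}_k$ is the space of (restrictions to $S$ of) real polynomials of degree at most $k$. $X=(X_t)_{t\ge0}$ is an $S$-valued time-homogeneous càdlàg Markov process (without killing or explosion); $\mathbb{P}_x,\mathbb{E}_x$ refer to $X_0=x$ and $\mathbb{E}_\mu$ to $X_0\sim\mu$. Its extended generator $\mathcal{G}$ has as domain the Borel functions $u:S\to\mathbb{R}$ for which there is a function $\mathcal{G}u$ such that $u(X_t)-u(x)-\int_0^t\mathcal{G}u(X_s)\,ds$, $t\ge0$, is a $\mathbb{P}_x$-local martingale for every $x\in S$. $X$ is $m$-polynomial if for all $k\in\{1,\dots,m\}$, $u\in\mathcal{P}_k$, $x\in S$ and $t\ge0$: $\mathbb{E}_x[|u(X_t)|]<\infty$, and $\mathcal{G}(\mathcal{P}_k)\subseteq\mathcal{P}_k$. $\mathcal{G}|_{\mathcal{P}_k}$ is identified with its matrix in a basis of $\mathcal{P}_k$. A square real matrix is zero-stable if the maximum of the real parts of its eigenvalues is $0$, $0$ is the only eigenvalue with real part $0$, and $0$ is a simple eigenvalue. A probability measure $\mu$ on $S$ is $k$-limiting for $X$ if $\lim_{t\to\infty}\mathbb{E}_x[u(X_t)]=\int_Su(y)\,\mu(dy)$ for all $u\in\mathcal{P}_k$ and $x\in S$. For a process $Z$ with underlying initial distribution $\mu$ for $X$, $$\mathrm{corr}_\mu(Z_t,Z_s)=\frac{\mathbb{E}_\mu[Z_tZ_s]-\mathbb{E}_\mu[Z_t]\mathbb{E}_\mu[Z_s]}{\sqrt{(\mathbb{E}_\mu[Z_t^2]-\mathbb{E}_\mu[Z_t]^2)(\mathbb{E}_\mu[Z_s^2]-\mathbb{E}_\mu[Z_s]^2)}},$$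 which is understood to be considered only when the denominator is nonzero (i.e. $\mu$ has nonzero variance). The $\alpha$-stable subordinator is the non-decreasing Lévy process with $\mathbb{E}[e^{-\lambda\sigma_s}]=e^{-s\lambda^\alpha}$, $s,\lambda>0$; $E_\alpha(z)=\sum_{k=0}^\infty\frac{z^k}{\Gamma(\alpha k+1)}$ is the Mittag-Leffler function. For $s=t=0$ the integral term is read as $0$. *)

theory Defs
  imports "HOL-Probability.Probability" "Jordan_Normal_Form.Spectral_Radius"
begin

text \<open>
  Time is modelled by the type \<^typ>\<open>real\<close>; only indices \<open>t \<ge> 0\<close> matter. A filtration
  \<open>(F t)\<close>, \<open>t \<ge> 0\<close>, fits the library locale \<^locale>\<open>filtration\<close> by putting \<open>F t = F 0\<close> for
  \<open>t < 0\<close>. Functions \<open>S \<rightarrow> \<real>\<close> are elements of \<open>extensional S\<close>, so that two of them are equal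
  iff they agree on \<open>S\<close>.
\<close>

section \<open>Processes\<close>

definition cadlag :: "(real \<Rightarrow> real) \<Rightarrow> bool" where
  "cadlag f \<longleftrightarrow> (\<forall>t\<ge>0. (f \<longlongrightarrow> f t) (at_right t)) \<and> (\<forall>t>0. \<exists>l. (f \<longlongrightarrow> l) (at_left t))"

definition martingale :: "'a measure \<Rightarrow> (real \<Rightarrow> 'a measure) \<Rightarrow> (real \<Rightarrow> 'a \<Rightarrow> real) \<Rightarrow> bool" where
  "martingale M F Y \<longleftrightarrow>
     (\<forall>t\<ge>0. Y t \<in> borel_measurable (F t) \<and> integrable M (Y t)) \<and>
     (\<forall>s\<ge>0. \<forall>t\<ge>s. AE \<omega> in M. real_cond_exp M (F s) (Y t) \<omega> = Y s \<omega>)"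

text \<open>
  Real-valued localizing times are no restriction: replace \<open>T n\<close> by \<open>min (T n) n\<close>.
\<close>

definition local_martingale ::
    "'a measure \<Rightarrow> (real \<Rightarrow> 'a measure) \<Rightarrow> (real \<Rightarrow> 'a \<Rightarrow> real) \<Rightarrow> bool" where
  "local_martingale M F Y \<longleftrightarrow>
     (\<forall>t\<ge>0. Y t \<in> borel_measurable (F t)) \<and>
     (AE \<omega> in M. cadlag (\<lambda>t. Y t \<omega>)) \<and>
     (\<exists>T :: nat \<Rightarrow> 'a \<Rightarrow> real.
        (\<forall>n. stopping_time F (T n) \<and> (\<forall>\<omega>\<in>space M. 0 \<le> T n \<omega>)) \<and>
        (AE \<omega> in M. incseq (\<lambda>n. T n \<omega>) \<and> filterlim (\<lambda>n. T n \<omega>) at_top sequentially) \<and>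
        (\<forall>n. martingale M F (\<lambda>t \<omega>. Y (min t (T n \<omega>)) \<omega>)))"

text \<open>
  \<open>P x\<close> is the law \<open>\<P>\<^sub>x\<close> on the measurable space underlying \<open>M\<close>; the measure carried by \<open>M\<close>
  itself plays no role. That \<open>X\<close> is \<open>S\<close>-valued is part of the assumption \<open>adapted\<close>.
\<close>

locale markov_process = filtration "space M" F
  for M :: "'a measure" and F :: "real \<Rightarrow> 'a measure" +
  fixes S :: "real set"
    and P :: "real \<Rightarrow> 'a measure"
    and X :: "real \<Rightarrow> 'a \<Rightarrow> real"
  assumes subalg: "\<And>t. sets (F t) \<subseteq> sets M"
    and adapted: "\<And>t. t \<ge> 0 \<Longrightarrow> X t \<in> F t \<rightarrow>\<^sub>M restrict_space borel S"
    and cadlag_paths: "\<And>\<omega>. \<omega> \<in> space M \<Longrightarrow> cadlag (\<lambda>t. X t \<omega>)"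
    and kernel: "P \<in> restrict_space borel S \<rightarrow>\<^sub>M prob_algebra M"
    and initial: "\<And>x. x \<in> S \<Longrightarrow> AE \<omega> in P x. X 0 \<omega> = x"
    and markov: "\<And>x s t f. x \<in> S \<Longrightarrow> s \<ge> 0 \<Longrightarrow> t \<ge> 0 \<Longrightarrow>
        f \<in> borel_measurable borel \<Longrightarrow> bounded (range f) \<Longrightarrow>
        AE \<omega> in P x. real_cond_exp (P x) (F s) (\<lambda>\<omega>'. f (X (s + t) \<omega>')) \<omega>
                       = (\<integral>\<omega>'. f (X t \<omega>') \<partial>P (X s \<omega>))"

text \<open>The law \<open>\<P>\<^sub>\<mu> = \<integral> \<P>\<^sub>x \<mu>(dx)\<close>, under which \<open>X\<close> has initial distribution \<open>\<mu>\<close>.\<close>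

definition initial_law :: "(real \<Rightarrow> 'a measure) \<Rightarrow> real measure \<Rightarrow> 'a measure" where
  "initial_law P \<mu> = \<mu> \<bind> P"

definition independent_processes ::
    "'a measure \<Rightarrow> (real \<Rightarrow> 'a \<Rightarrow> real) \<Rightarrow> (real \<Rightarrow> 'a \<Rightarrow> real) \<Rightarrow> bool" where
  "independent_processes M Y Z \<longleftrightarrow>
     prob_space.indep_var M
       (\<Pi>\<^sub>M t\<in>{0..}. borel) (\<lambda>\<omega>. \<lambda>t\<in>{0..}. Y t \<omega>)
       (\<Pi>\<^sub>M t\<in>{0..}. borel) (\<lambda>\<omega>. \<lambda>t\<in>{0..}. Z t \<omega>)"

definition correlation :: "'a measure \<Rightarrow> ('a \<Rightarrow> real) \<Rightarrow> ('a \<Rightarrow> real) \<Rightarrow> real" where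
  "correlation M Y Z =
     ((\<integral>\<omega>. Y \<omega> * Z \<omega> \<partial>M) - (\<integral>\<omega>. Y \<omega> \<partial>M) * (\<integral>\<omega>. Z \<omega> \<partial>M)) /
     sqrt (((\<integral>\<omega>. (Y \<omega>)\<^sup>2 \<partial>M) - (\<integral>\<omega>. Y \<omega> \<partial>M)\<^sup>2) * ((\<integral>\<omega>. (Z \<omega>)\<^sup>2 \<partial>M) - (\<integral>\<omega>. Z \<omega> \<partial>M)\<^sup>2))"

section \<open>Extended generator and polynomial processes\<close>

definition polys :: "real set \<Rightarrow> nat \<Rightarrow> (real \<Rightarrow> real) set" where
  "polys S k = {restrict (poly p) S | p. degree p \<le> k}"

definition generates ::
    "real set \<Rightarrow> (real \<Rightarrow> 'a measure) \<Rightarrow> (real \<Rightarrow> 'a measure) \<Rightarrow> (real \<Rightarrow> 'a \<Rightarrow> real) \<Rightarrow>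
     (real \<Rightarrow> real) \<Rightarrow> (real \<Rightarrow> real) \<Rightarrow> bool" where
  "generates S F P X u g \<longleftrightarrow>
     u \<in> extensional S \<and> u \<in> borel_measurable (restrict_space borel S) \<and>
     g \<in> extensional S \<and> g \<in> borel_measurable (restrict_space borel S) \<and>
     (\<forall>x\<in>S. (AE \<omega> in P x. \<forall>t\<ge>0. set_integrable lborel {0..t} (\<lambda>s. g (X s \<omega>))) \<and>
        local_martingale (P x) F
          (\<lambda>t \<omega>. u (X t \<omega>) - u x - (LINT s:{0..t}|lborel. g (X s \<omega>))))"

definition generator_domain ::
    "real set \<Rightarrow> (real \<Rightarrow> 'a measure) \<Rightarrow> (real \<Rightarrow> 'a measure) \<Rightarrow> (real \<Rightarrow> 'a \<Rightarrow> real) \<Rightarrow>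
     (real \<Rightarrow> real) set" where
  "generator_domain S F P X = {u. \<exists>g. generates S F P X u g}"

text \<open>
  \<open>\<G> u\<close> is in general only determined up to a set of potential zero; \<open>\<G>\<close> is any operator
  selecting one version for every \<open>u\<close> in the domain.
\<close>

definition extended_generator ::
    "real set \<Rightarrow> (real \<Rightarrow> 'a measure) \<Rightarrow> (real \<Rightarrow> 'a measure) \<Rightarrow> (real \<Rightarrow> 'a \<Rightarrow> real) \<Rightarrow>
     ((real \<Rightarrow> real) \<Rightarrow> (real \<Rightarrow> real)) \<Rightarrow> bool" where
  "extended_generator S F P X \<G> \<longleftrightarrow>
     (\<forall>u\<in>generator_domain S F P X. generates S F P X u (\<G> u))"

definition polynomial_process ::
    "nat \<Rightarrow> real set \<Rightarrow> (real \<Rightarrow> 'a measure) \<Rightarrow> (real \<Rightarrow> 'a measure) \<Rightarrow>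
     (real \<Rightarrow> 'a \<Rightarrow> real) \<Rightarrow> ((real \<Rightarrow> real) \<Rightarrow> (real \<Rightarrow> real)) \<Rightarrow> bool" where
  "polynomial_process m S F P X \<G> \<longleftrightarrow>
     (\<forall>k\<in>{1..m}. \<forall>u\<in>polys S k.
        (\<forall>x\<in>S. \<forall>t\<ge>0. integrable (P x) (\<lambda>\<omega>. u (X t \<omega>))) \<and>
        u \<in> generator_domain S F P X \<and> \<G> u \<in> polys S k)"

definition limiting ::
    "nat \<Rightarrow> real set \<Rightarrow> (real \<Rightarrow> 'a measure) \<Rightarrow> (real \<Rightarrow> 'a \<Rightarrow> real) \<Rightarrow> real measure \<Rightarrow> bool" where
  "limiting k S P X \<mu> \<longleftrightarrow>
     prob_space \<mu> \<and> sets \<mu> = sets (restrict_space borel S) \<and>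
     (\<forall>u\<in>polys S k. integrable \<mu> u \<and>
        (\<forall>x\<in>S. ((\<lambda>t. \<integral>\<omega>. u (X t \<omega>) \<partial>P x) \<longlongrightarrow> (\<integral>y. u y \<partial>\<mu>)) at_top))"

text \<open>\<open>A\<close> is the matrix of \<open>\<G>\<close> restricted to \<open>polys S k\<close> in the basis \<open>B 0, \<dots>, B k\<close>.\<close>

definition polys_basis :: "real set \<Rightarrow> nat \<Rightarrow> (nat \<Rightarrow> real \<Rightarrow> real) \<Rightarrow> bool" where
  "polys_basis S k B \<longleftrightarrow>
     (\<forall>i\<le>k. B i \<in> polys S k) \<and>
     (\<forall>u\<in>polys S k. \<exists>c. \<forall>x\<in>S. u x = (\<Sum>i\<le>k. c i * B i x)) \<and>
     (\<forall>c. (\<forall>x\<in>S. (\<Sum>i\<le>k. c i * B i x) = 0) \<longrightarrow> (\<forall>i\<le>k. c i = 0))"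

definition generator_matrix ::
    "real set \<Rightarrow> ((real \<Rightarrow> real) \<Rightarrow> (real \<Rightarrow> real)) \<Rightarrow> nat \<Rightarrow> (nat \<Rightarrow> real \<Rightarrow> real) \<Rightarrow>
     real mat \<Rightarrow> bool" where
  "generator_matrix S \<G> k B A \<longleftrightarrow>
     polys_basis S k B \<and> A \<in> carrier_mat (Suc k) (Suc k) \<and>
     (\<forall>j\<le>k. \<forall>x\<in>S. \<G> (B j) x = (\<Sum>i\<le>k. A $$ (i, j) * B i x))"

definition complex_spectrum :: "real mat \<Rightarrow> complex set" where
  "complex_spectrum A = spectrum (map_mat complex_of_real A)"

definition zero_stable :: "real mat \<Rightarrow> bool" where
  "zero_stable A \<longleftrightarrow>
     square_mat A \<and>
     Max (Re ` complex_spectrum A) = 0 \<and>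
     (\<forall>z\<in>complex_spectrum A. Re z = 0 \<longrightarrow> z = 0) \<and>
     order 0 (char_poly (map_mat complex_of_real A)) = 1"

section \<open>Stable subordinators and their inverses\<close>

text \<open>
  Stochastic continuity is not listed because it follows from \<open>Z 0 = 0\<close>, stationarity of
  the increments and right-continuity of the paths.
\<close>

definition levy_process :: "'a measure \<Rightarrow> (real \<Rightarrow> 'a \<Rightarrow> real) \<Rightarrow> bool" where
  "levy_process M Z \<longleftrightarrow>
     (\<forall>t\<ge>0. Z t \<in> borel_measurable M) \<and>
     (AE \<omega> in M. Z 0 \<omega> = 0) \<and>
     (\<forall>\<omega>\<in>space M. cadlag (\<lambda>t. Z t \<omega>)) \<and>
     (\<forall>s\<ge>0. \<forall>t\<ge>s. distr M borel (\<lambda>\<omega>. Z t \<omega> - Z s \<omega>) = distr M borel (Z (t - s))) \<and>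
     (\<forall>(n::nat) (\<tau> :: nat \<Rightarrow> real). 0 \<le> \<tau> 0 \<and> incseq \<tau> \<longrightarrow>
        prob_space.indep_vars M (\<lambda>_. borel) (\<lambda>i \<omega>. Z (\<tau> (Suc i)) \<omega> - Z (\<tau> i) \<omega>) {..<n})"

definition stable_subordinator :: "'a measure \<Rightarrow> real \<Rightarrow> (real \<Rightarrow> 'a \<Rightarrow> real) \<Rightarrow> bool" where
  "stable_subordinator M \<alpha> \<sigma> \<longleftrightarrow>
     levy_process M \<sigma> \<and>
     (\<forall>\<omega>\<in>space M. mono_on {0..} (\<lambda>t. \<sigma> t \<omega>)) \<and>
     (\<forall>s>0. \<forall>\<theta>>0. (\<integral>\<omega>. exp (- \<theta> * \<sigma> s \<omega>) \<partial>M) = exp (- s * \<theta> powr \<alpha>))"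

text \<open>
  The set below is empty only on the null event that the path of \<open>\<sigma>\<close> is bounded by \<open>t\<close>;
  the value 0 there replaces the unspecified \<^term>\<open>Inf {} :: real\<close>, which might be negative.
\<close>

definition inverse_process :: "(real \<Rightarrow> 'a \<Rightarrow> real) \<Rightarrow> real \<Rightarrow> 'a \<Rightarrow> real" where
  "inverse_process \<sigma> t \<omega> =
     (if {s. s > 0 \<and> \<sigma> s \<omega> > t} = {} then 0 else Inf {s. s > 0 \<and> \<sigma> s \<omega> > t})"

definition increment_laplace ::
    "'a measure \<Rightarrow> (real \<Rightarrow> 'a \<Rightarrow> real) \<Rightarrow> real \<Rightarrow> real \<Rightarrow> real \<Rightarrow> real" where
  "increment_laplace M L s t \<theta> = (\<integral>\<omega>. exp (- \<theta> * (L (t + s) \<omega> - L t \<omega>)) \<partial>M)"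

definition mittag_leffler :: "real \<Rightarrow> real \<Rightarrow> real" where
  "mittag_leffler \<alpha> z = (\<Sum>k. z ^ k / Gamma (\<alpha> * real k + 1))"

end

theory Submission
  imports Defs
begin

text \<open>
  Write m and V for the mean and the variance of the limiting law \<mu>. The eigenvalue -\<beta>
  of the generator on polynomials of degree at most one has an eigenfunction, and the limiting
  law identifies its zero as m. Hence the mean of X t under P x is m + exp (- \<beta> * t) * (x
  - m) (mean_reversion). In degree two, the means of the basis functions satisfy a linear
  system, which shows that the mean of a quadratic polynomial at time t is again a quadratic
  polynomial of the starting point (mean_polynomial). Letting s tend to infinity in the
  semigroup property for times s and t, the first two moments are seen to be invariant when the
  process starts from \<mu> (mean_invariant). With the conditional form of mean reversion
  (cond_exp_X), the autocovariance is V * exp (- \<beta> * \<bar>a - b\<bar>) (product_moment),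
  and averaging over the independent times L (t + s) and L t gives the first equation
  (correlation_time_change).

  Since the generator is defined by local martingales only, the main work is to justify these
  means, that is, to prove Dynkin's formula for quadratic polynomials. The generator maps the
  weight 1 + y^2 to at most C * (1 + y^2), and Fatou's lemma yields that its mean grows at most
  exponentially (trans_exp_bound). By discretization the same bound holds at stopping times
  (stopped_wt_le). This is enough uniform integrability for polynomials of degree one, and so
  for mean reversion. Mean reversion in turn shows that the weight cannot drop much in the mean
  over a bounded time interval (trans_wt_lower). Therefore the weight at a stopping time before
  t is dominated in the mean by the weight at time t (stopped_wt_le_terminal), which gives the
  uniform integrability in degree two.

  For the second equation, let e b be the Laplace transform of L b at l. For a \<le> b, the
  function exp (- l * (L b - r)) of r is integrated from 0 to L a. Up to a single value of r,
  the condition r < L a means that \<sigma> r \<le> a, and restarting \<sigma> at time r turns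
  the mean of exp (- l * (L b - L a)) into e b plus l times the integral of e (b - y) over y in
  [0, a] with respect to the potential measure of \<sigma>
  (laplace_inverse_increment_potential). The potential measure has the Laplace transform
  \<theta> powr (- \<alpha>), hence the density y powr (\<alpha> - 1) / Gamma \<alpha>
  (potential_density). The case a = b is a fractional integral equation for e with the solution
  e b = E (- l * b powr \<alpha>), where E is the Mittag-Leffler function
  (frac_equation_mittag_leffler), and the substitution y = b * z in the general case gives the
  stated formula (laplace_inverse_increment).
\<close>

section \<open>Joint measurability and boundedness of cadlag paths\<close>

text \<open>
  Evaluating Z at the next grid point of mesh 1/(n+1) strictly to the right of the time only
  involves countably many of the variables Z_t; right-continuity lets the mesh tend to zero.
\<close>

lemma right_continuous_joint_measurable:
  fixes Z :: "real \<Rightarrow> 'a \<Rightarrow> real"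
  assumes Z: "\<And>t. Z t \<in> borel_measurable N"
    and rc: "\<And>\<omega> t. \<omega> \<in> space N \<Longrightarrow> ((\<lambda>s. Z s \<omega>) \<longlongrightarrow> Z t \<omega>) (at_right t)"
  shows "(\<lambda>(t, \<omega>). Z t \<omega>) \<in> borel_measurable (borel \<Otimes>\<^sub>M N)"
proof -
  \<comment> \<open>the first multiple of 1 / Suc n that is strictly larger than t, so that
      the limit is taken from the right\<close>
  define d where "d n t = (real_of_int \<lfloor>real (Suc n) * t\<rfloor> + 1) / real (Suc n)" for n and t :: real
  have d_gt: "t < d n t" for n t
  proof -
    have "real (Suc n) * t < real_of_int \<lfloor>real (Suc n) * t\<rfloor> + 1" by linarith
    then show ?thesis by (simp add: d_def pos_less_divide_eq mult.commute)
  qed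
  have d_le: "d n t \<le> t + inverse (real (Suc n))" for n t
  proof -
    have "d n t \<le> (real (Suc n) * t + 1) / real (Suc n)"
      unfolding d_def by (intro divide_right_mono) auto
    also have "\<dots> = t + inverse (real (Suc n))" by (simp add: add_divide_distrib inverse_eq_divide)
    finally show ?thesis .
  qed
  have lim: "(\<lambda>n. d n t) \<longlonglongrightarrow> t" for t
  proof (rule real_tendsto_sandwich[where f = "\<lambda>_. t" and h = "\<lambda>n. t + inverse (real (Suc n))"])
    show "(\<lambda>n. t + inverse (real (Suc n))) \<longlonglongrightarrow> t"
      using tendsto_add[OF tendsto_const[of t] LIMSEQ_inverse_real_of_nat] by simp
    show "\<forall>\<^sub>F n in sequentially. t \<le> d n t" by (intro always_eventually allI less_imp_le d_gt)
    show "\<forall>\<^sub>F n in sequentially. d n t \<le> t + inverse (real (Suc n))" by (intro always_eventually allI d_le)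
  qed simp
  have "(\<lambda>p. Z (fst p) (snd p)) \<in> borel_measurable ((borel :: real measure) \<Otimes>\<^sub>M N)"
  proof (rule borel_measurable_LIMSEQ_real)
    fix p assume p: "p \<in> space ((borel :: real measure) \<Otimes>\<^sub>M N)"
    have "filterlim (\<lambda>n. d n (fst p)) (at_right (fst p)) sequentially"
      unfolding filterlim_at using lim d_gt by (auto simp: less_imp_neq[symmetric])
    then show "(\<lambda>n. Z (d n (fst p)) (snd p)) \<longlonglongrightarrow> Z (fst p) (snd p)"
      using p by (intro filterlim_compose[OF rc]) (auto simp: space_pair_measure)
  next
    fix n
    have Z': "(\<lambda>p. Z c (snd p)) \<in> borel_measurable ((borel :: real measure) \<Otimes>\<^sub>M N)" for c
      by (rule measurable_compose[OF measurable_snd Z])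
    show "(\<lambda>p. Z (d n (fst p)) (snd p)) \<in> borel_measurable ((borel :: real measure) \<Otimes>\<^sub>M N)"
      unfolding d_def
      by (rule measurable_compose_countable
          [where f = "\<lambda>i p. Z ((real_of_int i + 1) / real (Suc n)) (snd p)"
            and g = "\<lambda>p. \<lfloor>real (Suc n) * fst p\<rfloor>"]) (rule Z', measurable)
  qed
  then show ?thesis by (simp add: case_prod_beta')
qed

text \<open>
  Paths indexed by times t \<ge> 0 are extended by their initial value to negative times; this
  keeps right-continuity on the whole line.
\<close>

lemma cadlag_right_continuous:
  assumes "cadlag f"
  shows "((\<lambda>s. f (max 0 s)) \<longlongrightarrow> f (max 0 t)) (at_right t)"
proof (cases "0 \<le> t")
  case True
  then have "(f \<longlongrightarrow> f t) (at_right t)" using assms by (simp add: cadlag_def)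
  moreover have "eventually (\<lambda>s. f s = f (max 0 s)) (at_right t)"
    using True by (auto simp: eventually_at_filter)
  ultimately show ?thesis using True by (auto intro: Lim_transform_eventually)
next
  case False
  then have "eventually (\<lambda>s. f 0 = f (max 0 s)) (at_right t)"
    using eventually_at_right_real[of t 0] by (auto elim!: eventually_mono)
  with False show ?thesis by (auto intro: Lim_transform_eventually tendsto_const)
qed

lemma cadlag_joint_measurable:
  fixes Z :: "real \<Rightarrow> 'a \<Rightarrow> real"
  assumes "\<And>t. t \<ge> 0 \<Longrightarrow> Z t \<in> borel_measurable N"
    and "\<And>\<omega>. \<omega> \<in> space N \<Longrightarrow> cadlag (\<lambda>t. Z t \<omega>)"
  shows "(\<lambda>(t, \<omega>). Z (max 0 t) \<omega>) \<in> borel_measurable (borel \<Otimes>\<^sub>M N)"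
proof (rule right_continuous_joint_measurable)
  show "Z (max 0 t) \<in> borel_measurable N" for t by (rule assms(1)) simp
  show "((\<lambda>s. Z (max 0 s) \<omega>) \<longlongrightarrow> Z (max 0 t) \<omega>) (at_right t)" if "\<omega> \<in> space N" for \<omega> t
    by (rule cadlag_right_continuous[OF assms(2)[OF that]])
qed

text \<open>
  The one-sided limits bound the path near every point, and finitely many such neighbourhoods
  cover the compact interval. Right-continuity alone would not suffice.
\<close>

lemma cadlag_bounded:
  assumes f: "cadlag f"
  obtains K where "\<And>s. 0 \<le> s \<Longrightarrow> s \<le> t \<Longrightarrow> \<bar>f s\<bar> \<le> K"
proof -
  have local: "\<exists>K e. 0 < e \<and> (\<forall>s. 0 \<le> s \<and> \<bar>s - x\<bar> < e \<longrightarrow> \<bar>f s\<bar> \<le> K)" if x: "0 \<le> x" for x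
  proof -
    have "(f \<longlongrightarrow> f x) (at_right x)" using f x by (simp add: cadlag_def)
    then have "eventually (\<lambda>s. dist (f s) (f x) < 1) (at_right x)" by (rule tendstoD) simp
    then obtain b where b: "b > x" "\<And>s. x < s \<Longrightarrow> s < b \<Longrightarrow> dist (f s) (f x) < 1"
      by (auto simp: eventually_at_right_field)
    obtain l a where a: "a < x" "\<And>s. 0 \<le> s \<Longrightarrow> a < s \<Longrightarrow> s < x \<Longrightarrow> dist (f s) l < 1"
    proof (cases "x = 0")
      case True
      then show ?thesis by (intro that[of "- 1" 0]) auto
    next
      case False
      with x have "0 < x" by simp
      with f obtain l where "(f \<longlongrightarrow> l) (at_left x)" by (auto simp: cadlag_def)
      then have "eventually (\<lambda>s. dist (f s) l < 1) (at_left x)" by (rule tendstoD) simp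
      then obtain a where "a < x" "\<And>s. a < s \<Longrightarrow> s < x \<Longrightarrow> dist (f s) l < 1"
        by (auto simp: eventually_at_left_field)
      then show ?thesis by (intro that[of a l]) auto
    qed
    have "\<bar>f s\<bar> \<le> \<bar>f x\<bar> + \<bar>l\<bar> + 1" if "0 \<le> s" "\<bar>s - x\<bar> < min (b - x) (x - a)" for s
    proof -
      consider "s = x" | "x < s" "s < b" | "a < s" "s < x" using \<open>\<bar>s - x\<bar> < _\<close> by linarith
      then show ?thesis
        using a(2)[of s] b(2)[of s] that(1) by cases (auto simp: dist_real_def)
    qed
    moreover have "0 < min (b - x) (x - a)" using a b by simp
    ultimately show ?thesis by blast
  qed
  then obtain K e where Ke: "\<And>x. 0 \<le> x \<Longrightarrow> 0 < e x"
      "\<And>x s. 0 \<le> x \<Longrightarrow> 0 \<le> s \<Longrightarrow> \<bar>s - x\<bar> < e x \<Longrightarrow> \<bar>f s\<bar> \<le> K x"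
    by metis
  have "{0..t} \<subseteq> (\<Union>x\<in>{0..t}. ball x (e x))"
    using Ke(1) by auto
  then obtain D where D: "D \<subseteq> {0..t}" "finite D" "{0..t} \<subseteq> (\<Union>x\<in>D. ball x (e x))"
    by (rule compactE_image[OF compact_Icc, rotated]) auto
  show ?thesis
  proof (rule that)
    fix s assume s: "0 \<le> s" "s \<le> t"
    then have "s \<in> {0..t}" by simp
    with D(3) have "s \<in> (\<Union>x\<in>D. ball x (e x))" by blast
    then obtain x where x: "x \<in> D" "\<bar>s - x\<bar> < e x"
      by (auto simp: dist_real_def abs_minus_commute)
    then have "\<bar>f s\<bar> \<le> K x" using D(1) s by (intro Ke(2)) auto
    also have "\<dots> \<le> \<bar>K x\<bar>" by simp
    also have "\<dots> \<le> (\<Sum>x\<in>D. \<bar>K x\<bar>)" by (rule member_le_sum) (use x D in auto)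
    finally show "\<bar>f s\<bar> \<le> (\<Sum>x\<in>D. \<bar>K x\<bar>)" .
  qed
qed

section \<open>The Markov property for nonnegative functions\<close>

context markov_process
begin

lemma prob_space_P: "x \<in> S \<Longrightarrow> prob_space (P x)"
  and sets_P: "x \<in> S \<Longrightarrow> sets (P x) = sets M"
  using measurable_space[OF kernel, of x] by (auto simp: space_prob_algebra space_restrict_space)

lemma space_P: "x \<in> S \<Longrightarrow> space (P x) = space M"
  by (rule sets_eq_imp_space_eq) (rule sets_P)

lemma measurable_P_cong: "x \<in> S \<Longrightarrow> measurable (P x) N = measurable M N"
  by (rule measurable_cong_sets) (simp_all add: sets_P)

lemma subalgebra_P: "x \<in> S \<Longrightarrow> subalgebra (P x) (F s)"
  using subalg by (auto simp: subalgebra_def space_F space_P sets_P)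

lemma cond_exp_P: "x \<in> S \<Longrightarrow> sigma_finite_subalgebra (P x) (F s)"
  by (intro finite_measure_subalgebra_is_sigma_finite finite_measure_subalgebra.intro
      finite_measure_subalgebra_axioms.intro subalgebra_P prob_space.finite_measure prob_space_P)

lemma sets_F_M: "A \<in> sets (F t) \<Longrightarrow> A \<in> sets M"
  using subalg by auto

lemma measurable_F_M: "f \<in> measurable (F t) N \<Longrightarrow> f \<in> measurable M N"
  by (rule measurable_from_subalg[of M "F t"]) (use subalg space_F in \<open>auto simp: subalgebra_def\<close>)

lemma X_in_S: "t \<ge> 0 \<Longrightarrow> \<omega> \<in> space M \<Longrightarrow> X t \<omega> \<in> S"
  using measurable_space[OF adapted, of t \<omega>] by (simp add: space_F space_restrict_space)

lemma X_measurable_F: "t \<ge> 0 \<Longrightarrow> X t \<in> borel_measurable (F t)"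
  using adapted[of t] by (simp add: measurable_restrict_space2_iff)

lemma X_measurable: "t \<ge> 0 \<Longrightarrow> X t \<in> borel_measurable M"
  by (rule measurable_F_M[OF X_measurable_F])

text \<open>
  Frozen at its initial value for negative times, the process is jointly measurable in time and
  path without a side condition on the time, which makes the lemma X0_measurable usable as an
  unconditional measurability rule.
\<close>

definition X0 :: "real \<Rightarrow> 'a \<Rightarrow> real" where "X0 t \<omega> = X (max 0 t) \<omega>"

lemma X0_eq [simp]: "t \<ge> 0 \<Longrightarrow> X0 t \<omega> = X t \<omega>" by (simp add: X0_def)

lemma X0_measurable [measurable (raw)]:
  assumes "f \<in> borel_measurable N" "g \<in> measurable N M"
  shows "(\<lambda>x. X0 (f x) (g x)) \<in> borel_measurable N"
proof -
  have "(\<lambda>p. X0 (fst p) (snd p)) \<in> borel_measurable (borel \<Otimes>\<^sub>M M)"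
    using cadlag_joint_measurable[of X M, OF X_measurable cadlag_paths]
    by (simp add: case_prod_beta' X0_def)
  from measurable_compose[OF measurable_Pair[OF assms] this] show ?thesis by simp
qed

definition transition :: "real \<Rightarrow> (real \<Rightarrow> ennreal) \<Rightarrow> real \<Rightarrow> ennreal" where
  "transition t f x = (\<integral>\<^sup>+\<omega>. f (X0 t \<omega>) \<partial>P x)"

lemma trans_measurable [measurable]:
  assumes [measurable]: "f \<in> borel_measurable borel"
  shows "transition t f \<in> borel_measurable (restrict_space borel S)"
proof -
  have "(\<lambda>x. integral\<^sup>N (P x) ((\<lambda>_ \<omega>. f (X0 t \<omega>)) x)) \<in> borel_measurable (restrict_space borel S)"
    by (rule nn_integral_measurable_subprob_algebra2[where N = M]) (auto intro: measurable_prob_algebraD[OF kernel])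
  then show ?thesis unfolding transition_def[abs_def] by simp
qed

lemma trans_X_measurable [measurable]:
  assumes "f \<in> borel_measurable borel" and s: "s \<ge> 0"
  shows "(\<lambda>\<omega>. transition t f (X s \<omega>)) \<in> borel_measurable (F s)"
  by (rule measurable_compose[OF adapted[OF s] trans_measurable[OF assms(1)]])

text \<open>
  The Markov property is given for bounded f. Tested against events of the past it extends to
  all nonnegative measurable f, in particular to unbounded polynomials, by monotone limits of
  simple functions.
\<close>

lemma markov_nn:
  assumes x: "x \<in> S" and s: "s \<ge> 0" and t: "t \<ge> 0" and A: "A \<in> sets (F s)"
    and f: "f \<in> borel_measurable borel"
  shows "(\<integral>\<^sup>+\<omega>. f (X (s + t) \<omega>) * indicator A \<omega> \<partial>P x)
    = (\<integral>\<^sup>+\<omega>. transition t f (X s \<omega>) * indicator A \<omega> \<partial>P x)"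
proof -
  have A_M [measurable]: "A \<in> sets (P x)" using sets_F_M[OF A] by (simp add: sets_P x)
  interpret Px: prob_space "P x" by (rule prob_space_P[OF x])
  interpret sigma_finite_subalgebra "P x" "F s" by (rule cond_exp_P[OF x])
  have X_m [measurable]: "X r \<in> borel_measurable (P x)" if "r \<ge> 0" for r
    using X_measurable[OF that] by (simp add: measurable_P_cong x)
  show ?thesis
    using f
  proof (induction rule: borel_measurable_induct)
    case (cong f g)
    then have "f = g" by auto
    with cong show ?case by simp
  next
    case (set B)
    then have [measurable]: "B \<in> sets borel" .
    define b where "b = (indicator B :: real \<Rightarrow> real)"
    have b: "b \<in> borel_measurable borel" "bounded (range b)"
      unfolding b_def by (auto simp: bounded_iff intro!: exI[of _ 1] split: split_indicator)
    have [measurable]: "b \<in> borel_measurable borel" by fact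
    have int: "integrable (P x) (\<lambda>\<omega>. b (X (s + t) \<omega>))"
      by (rule Px.integrable_const_bound[where B = 1]) (use s t in \<open>auto simp: b_def\<close>)
    \<comment> \<open>for an indicator the kernel transition t is the bounded expectation in
        the Markov property\<close>
    have tr: "transition t (indicator B) (X s \<omega>) = ennreal (\<integral>\<omega>'. b (X t \<omega>') \<partial>P (X s \<omega>))" if "\<omega> \<in> space M" for \<omega>
    proof -
      have y: "X s \<omega> \<in> S" by (rule X_in_S[OF s that])
      interpret Py: prob_space "P (X s \<omega>)" by (rule prob_space_P[OF y])
      have [measurable]: "X t \<in> borel_measurable (P (X s \<omega>))"
        using X_measurable[OF t] by (simp add: measurable_P_cong y)
      have "integrable (P (X s \<omega>)) (\<lambda>\<omega>. b (X t \<omega>))"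
        by (rule Py.integrable_const_bound[where B = 1]) (auto simp: b_def)
      then have "ennreal (\<integral>\<omega>'. b (X t \<omega>') \<partial>P (X s \<omega>)) = (\<integral>\<^sup>+\<omega>'. ennreal (b (X t \<omega>')) \<partial>P (X s \<omega>))"
        by (intro nn_integral_eq_integral[symmetric]) (auto simp: b_def)
      then show ?thesis using t by (simp add: transition_def b_def ennreal_indicator)
    qed
    have "(\<integral>\<^sup>+\<omega>. indicator B (X (s + t) \<omega>) * indicator A \<omega> \<partial>P x)
        = (\<integral>\<^sup>+\<omega>. ennreal (indicator A \<omega> * b (X (s + t) \<omega>)) \<partial>P x)"
      by (intro nn_integral_cong) (auto simp: b_def split: split_indicator)
    also have "\<dots> = ennreal (\<integral>\<omega>. indicator A \<omega> * b (X (s + t) \<omega>) \<partial>P x)"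
      using integrable_mult_indicator[OF A_M int]
      by (intro nn_integral_eq_integral) (auto simp: b_def)
    also have "(\<integral>\<omega>. indicator A \<omega> * b (X (s + t) \<omega>) \<partial>P x)
        = (\<integral>\<omega>. indicator A \<omega> * real_cond_exp (P x) (F s) (\<lambda>\<omega>. b (X (s + t) \<omega>)) \<omega> \<partial>P x)"
      using real_cond_exp_intA[OF int A] by (simp add: set_lebesgue_integral_def)
    also have "ennreal \<dots> = (\<integral>\<^sup>+\<omega>. ennreal (indicator A \<omega> * real_cond_exp (P x) (F s) (\<lambda>\<omega>. b (X (s + t) \<omega>)) \<omega>) \<partial>P x)"
    proof (rule nn_integral_eq_integral[symmetric])
      show "integrable (P x) (\<lambda>\<omega>. indicator A \<omega> * real_cond_exp (P x) (F s) (\<lambda>\<omega>. b (X (s + t) \<omega>)) \<omega>)"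
        using integrable_mult_indicator[OF A_M real_cond_exp_int(1)[OF int]] by simp
      have "AE \<omega> in P x. 0 \<le> real_cond_exp (P x) (F s) (\<lambda>\<omega>. b (X (s + t) \<omega>)) \<omega>"
        by (rule real_cond_exp_pos) (use int in \<open>auto simp: b_def\<close>)
      then show "AE \<omega> in P x. 0 \<le> indicator A \<omega> * real_cond_exp (P x) (F s) (\<lambda>\<omega>. b (X (s + t) \<omega>)) \<omega>"
        by eventually_elim simp
    qed
    also have "\<dots> = (\<integral>\<^sup>+\<omega>. transition t (indicator B) (X s \<omega>) * indicator A \<omega> \<partial>P x)"
      using markov[OF x s t b] AE_space
      by (intro nn_integral_cong_AE, eventually_elim)
         (auto simp: tr space_P x split: split_indicator)
    finally show ?case .
  next
    case (mult u c)
    note [measurable] = mult(2)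
    have [measurable]: "(\<lambda>\<omega>. transition t u (X s \<omega>)) \<in> borel_measurable (P x)"
      using measurable_F_M[OF trans_X_measurable[OF mult(2) s]] by (simp add: measurable_P_cong x)
    have tr: "transition t (\<lambda>y. c * u y) (X s \<omega>) = c * transition t u (X s \<omega>)" if "\<omega> \<in> space M" for \<omega>
      unfolding transition_def using X_in_S[OF s that] by (intro nn_integral_cmult) (simp add: measurable_P_cong)
    have "(\<integral>\<^sup>+\<omega>. c * u (X (s + t) \<omega>) * indicator A \<omega> \<partial>P x) = c * (\<integral>\<^sup>+\<omega>. u (X (s + t) \<omega>) * indicator A \<omega> \<partial>P x)"
      using s t by (subst nn_integral_cmult[symmetric]) (auto simp: mult.assoc)
    also have "\<dots> = c * (\<integral>\<^sup>+\<omega>. transition t u (X s \<omega>) * indicator A \<omega> \<partial>P x)" using mult by simp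
    also have "\<dots> = (\<integral>\<^sup>+\<omega>. transition t (\<lambda>y. c * u y) (X s \<omega>) * indicator A \<omega> \<partial>P x)"
      by (subst nn_integral_cmult[symmetric]) (auto simp: tr space_P x mult.assoc intro!: nn_integral_cong)
    finally show ?case .
  next
    case (add u v)
    note [measurable] = add(1) add(3)
    have [measurable]: "(\<lambda>\<omega>. transition t u (X s \<omega>)) \<in> borel_measurable (P x)" "(\<lambda>\<omega>. transition t v (X s \<omega>)) \<in> borel_measurable (P x)"
      using measurable_F_M[OF trans_X_measurable[OF _ s]] add by (simp_all add: measurable_P_cong x)
    have tr: "transition t (\<lambda>y. v y + u y) (X s \<omega>) = transition t v (X s \<omega>) + transition t u (X s \<omega>)" if "\<omega> \<in> space M" for \<omega>
      unfolding transition_def using X_in_S[OF s that] by (intro nn_integral_add) (simp_all add: measurable_P_cong)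
    have "(\<integral>\<^sup>+\<omega>. (v (X (s + t) \<omega>) + u (X (s + t) \<omega>)) * indicator A \<omega> \<partial>P x)
        = (\<integral>\<^sup>+\<omega>. v (X (s + t) \<omega>) * indicator A \<omega> \<partial>P x) + (\<integral>\<^sup>+\<omega>. u (X (s + t) \<omega>) * indicator A \<omega> \<partial>P x)"
      using s t by (subst nn_integral_add[symmetric]) (auto simp: distrib_right)
    also have "\<dots> = (\<integral>\<^sup>+\<omega>. transition t v (X s \<omega>) * indicator A \<omega> \<partial>P x) + (\<integral>\<^sup>+\<omega>. transition t u (X s \<omega>) * indicator A \<omega> \<partial>P x)"
      using add by simp
    also have "\<dots> = (\<integral>\<^sup>+\<omega>. transition t (\<lambda>y. v y + u y) (X s \<omega>) * indicator A \<omega> \<partial>P x)"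
      by (subst nn_integral_add[symmetric]) (auto simp: tr space_P x distrib_right intro!: nn_integral_cong)
    finally show ?case .
  next
    case (seq U)
    note [measurable] = seq(1)
    have [measurable]: "(\<lambda>\<omega>. transition t (U i) (X s \<omega>)) \<in> borel_measurable (P x)" for i
      using measurable_F_M[OF trans_X_measurable[OF _ s]] seq by (simp add: measurable_P_cong x)
    have inc: "incseq (\<lambda>i. U i y)" for y using seq by (auto simp: incseq_def le_fun_def)
    have SUP_ind: "(SUP i. g i :: ennreal) * indicator A \<omega> = (SUP i. g i * indicator A \<omega>)" for g :: "nat \<Rightarrow> ennreal" and \<omega>
      by (simp add: SUP_mult_right_ennreal)
    have tr: "transition t (\<lambda>y. SUP i. U i y) (X s \<omega>) = (SUP i. transition t (U i) (X s \<omega>))" if "\<omega> \<in> space M" for \<omega>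
      unfolding transition_def using X_in_S[OF s that] inc
      by (intro nn_integral_monotone_convergence_SUP) (auto simp: measurable_P_cong incseq_def le_fun_def)
    have inc_tr: "incseq (\<lambda>i. transition t (U i) y)" for y
      unfolding transition_def using inc by (auto simp: incseq_def intro!: nn_integral_mono)
    have "(\<integral>\<^sup>+\<omega>. (SUP i. U i (X (s + t) \<omega>)) * indicator A \<omega> \<partial>P x)
        = (SUP i. \<integral>\<^sup>+\<omega>. U i (X (s + t) \<omega>) * indicator A \<omega> \<partial>P x)"
      unfolding SUP_ind using s t inc
      by (intro nn_integral_monotone_convergence_SUP) (auto simp: incseq_def le_fun_def intro!: mult_right_mono)
    also have "\<dots> = (SUP i. \<integral>\<^sup>+\<omega>. transition t (U i) (X s \<omega>) * indicator A \<omega> \<partial>P x)" using seq by simp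
    also have "\<dots> = (\<integral>\<^sup>+\<omega>. (SUP i. transition t (U i) (X s \<omega>)) * indicator A \<omega> \<partial>P x)"
      unfolding SUP_ind using inc_tr
      by (intro nn_integral_monotone_convergence_SUP[symmetric]) (auto simp: incseq_def le_fun_def intro!: mult_right_mono)
    also have "\<dots> = (\<integral>\<^sup>+\<omega>. transition t (\<lambda>y. SUP i. U i y) (X s \<omega>) * indicator A \<omega> \<partial>P x)"
      by (intro nn_integral_cong) (simp add: tr space_P x)
    finally show ?case unfolding Sup_fun_def by (simp add: image_image)
  qed
qed

end

section \<open>Local martingales and exponential moment bounds\<close>

lemma poly_measurable [measurable (raw)]:
  fixes p :: "real poly"
  assumes "f \<in> borel_measurable N"
  shows "(\<lambda>x. poly p (f x)) \<in> borel_measurable N"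
  by (rule measurable_compose[OF assms])
     (intro borel_measurable_continuous_onI continuous_intros)

lemma set_integrable_bounded:
  fixes f :: "real \<Rightarrow> real"
  assumes "f \<in> borel_measurable borel" "\<And>s. a \<le> s \<Longrightarrow> s \<le> b \<Longrightarrow> \<bar>f s\<bar> \<le> K"
  shows "set_integrable lborel {a..b} f"
  unfolding set_integrable_def
  by (rule integrableI_bounded_set_indicator[where B = K])
     (use assms in \<open>auto simp: emeasure_bounded_finite simp flip: infinity_ennreal_def\<close>)

lemma set_integrable_bounded_mult:
  fixes f h :: "real \<Rightarrow> real"
  assumes [measurable]: "f \<in> borel_measurable borel" "h \<in> borel_measurable borel"
    and "\<And>s. a \<le> s \<Longrightarrow> s \<le> b \<Longrightarrow> \<bar>f s\<bar> \<le> K" "\<And>s. a \<le> s \<Longrightarrow> s \<le> b \<Longrightarrow> \<bar>h s\<bar> \<le> K'"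
  shows "set_integrable lborel {a..b} (\<lambda>s. f s * h s)"
proof (rule set_integrable_bounded)
  fix s assume "a \<le> s" "s \<le> b"
  with assms(3,4)[of s] show "\<bar>f s * h s\<bar> \<le> K * K'"
    unfolding abs_mult by (intro mult_mono) auto
qed measurable

lemma integral_exp_Icc:
  fixes C a b :: real
  assumes "C \<ge> 0" "a \<le> b"
  shows "(LINT s:{a..b}|lborel. C * exp (- C * s)) = exp (- C * a) - exp (- C * b)"
proof -
  have "(\<integral>s. (C * exp (- C * s)) * indicator {a..b} s \<partial>lborel) = - exp (- C * b) - (- exp (- C * a))"
    by (rule integral_FTC_Icc_nonneg) (use assms in \<open>auto intro!: derivative_eq_intros\<close>)
  moreover have "(LINT s:{a..b}|lborel. C * exp (- C * s)) = (\<integral>s. (C * exp (- C * s)) * indicator {a..b} s \<partial>lborel)"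
    unfolding set_lebesgue_integral_def by (intro Bochner_Integration.integral_cong) auto
  ultimately show ?thesis by linarith
qed

text \<open>
  Fubini on the triangle 0 \<le> r \<le> s \<le> \<tau>: this is the integration by parts of exp
  (- C * s) against the running integral of f.
\<close>

lemma exp_weighted_integral:
  fixes f :: "real \<Rightarrow> real"
  assumes f [measurable]: "f \<in> borel_measurable borel" and C: "C \<ge> 0"
    and K: "\<And>s. 0 \<le> s \<Longrightarrow> s \<le> \<tau> \<Longrightarrow> \<bar>f s\<bar> \<le> K"
  shows "(LINT s:{0..\<tau>}|lborel. C * exp (- C * s) * (LINT r:{0..s}|lborel. f r))
    = (LINT r:{0..\<tau>}|lborel. f r * (exp (- C * r) - exp (- C * \<tau>)))"
proof -
  define h where "h s r = (if 0 \<le> r \<and> r \<le> s \<and> s \<le> \<tau> then C * exp (- C * s) * f r else 0)" for s r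
  have h_meas: "case_prod h \<in> borel_measurable (lborel \<Otimes>\<^sub>M lborel)" unfolding h_def by measurable
  have "integrable (lborel \<Otimes>\<^sub>M lborel) (\<lambda>p. indicator ({0..\<tau>} \<times> {0..\<tau>}) p *\<^sub>R (case_prod h p))"
  proof (rule integrableI_bounded_set_indicator[where B = "C * K"])
    show "emeasure (lborel \<Otimes>\<^sub>M lborel) ({0..\<tau>} \<times> {0..\<tau>}) < \<infinity>"
      using emeasure_bounded_finite[of "{0..\<tau>}"]
      by (subst lborel.emeasure_pair_measure_Times) (auto simp: ennreal_mult_less_top)
    have "\<bar>h s r\<bar> \<le> C * K" if "0 \<le> s" "0 \<le> r" "s \<le> \<tau>" "r \<le> \<tau>" for s r
    proof -
      have "0 \<le> K" using K[of r] that by linarith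
      moreover have "exp (- C * s) * \<bar>f r\<bar> \<le> 1 * K"
        using K[of r] that C by (intro mult_mono) auto
      ultimately show ?thesis using C
        by (auto simp: h_def abs_mult mult.assoc intro!: mult_left_mono)
    qed
    then show "AE p in lborel \<Otimes>\<^sub>M lborel. p \<in> {0..\<tau>} \<times> {0..\<tau>} \<longrightarrow> norm (case_prod h p) \<le> C * K"
      by (intro AE_I2) auto
  qed (use h_meas in auto)
  then have int: "integrable (lborel \<Otimes>\<^sub>M lborel) (case_prod h)"
    by (rule Bochner_Integration.integrable_cong[THEN iffD1, rotated 2]) (auto simp: h_def split: split_indicator if_splits)
  have "(LINT s:{0..\<tau>}|lborel. C * exp (- C * s) * (LINT r:{0..s}|lborel. f r)) = (\<integral>s. (\<integral>r. h s r \<partial>lborel) \<partial>lborel)"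
    unfolding set_lebesgue_integral_def
  proof (rule Bochner_Integration.integral_cong)
    fix s :: real
    show "indicator {0..\<tau>} s *\<^sub>R (C * exp (- C * s) * (\<integral>r. indicator {0..s} r *\<^sub>R f r \<partial>lborel)) = (\<integral>r. h s r \<partial>lborel)"
    proof (cases "s \<in> {0..\<tau>}")
      case True
      then have "(\<integral>r. h s r \<partial>lborel) = (\<integral>r. C * exp (- C * s) * (indicator {0..s} r *\<^sub>R f r) \<partial>lborel)"
        by (intro Bochner_Integration.integral_cong) (auto simp: h_def split: split_indicator)
      with True show ?thesis by simp
    next
      case False
      then have "h s r = 0" for r by (auto simp: h_def)
      with False show ?thesis by simp
    qed
  qed simp
  also have "\<dots> = (\<integral>r. (\<integral>s. h s r \<partial>lborel) \<partial>lborel)"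
    by (rule lborel_pair.Fubini_integral[OF int, symmetric])
  also have "\<dots> = (LINT r:{0..\<tau>}|lborel. f r * (exp (- C * r) - exp (- C * \<tau>)))"
    unfolding set_lebesgue_integral_def
  proof (rule Bochner_Integration.integral_cong)
    fix r :: real
    show "(\<integral>s. h s r \<partial>lborel) = indicator {0..\<tau>} r *\<^sub>R (f r * (exp (- C * r) - exp (- C * \<tau>)))"
    proof (cases "r \<in> {0..\<tau>}")
      case True
      then have "(\<integral>s. h s r \<partial>lborel) = (\<integral>s. f r * (indicator {r..\<tau>} s *\<^sub>R (C * exp (- C * s))) \<partial>lborel)"
        by (intro Bochner_Integration.integral_cong) (auto simp: h_def split: split_indicator)
      also have "\<dots> = f r * (LINT s:{r..\<tau>}|lborel. C * exp (- C * s))"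
        unfolding set_lebesgue_integral_def by (rule integral_mult_right_zero)
      finally show ?thesis using True integral_exp_Icc[OF C, of r \<tau>] by simp
    next
      case False
      then have "h s r = 0" for s by (auto simp: h_def)
      with False show ?thesis by simp
    qed
  qed simp
  finally show ?thesis .
qed

lemma martingale_indicator:
  assumes sub: "\<And>s. sigma_finite_subalgebra M (F s)" and mart: "martingale M F Y"
    and s: "0 \<le> s" "s \<le> t" and A: "A \<in> sets (F s)"
  shows "(\<integral>\<omega>. indicator A \<omega> * Y s \<omega> \<partial>M) = (\<integral>\<omega>. indicator A \<omega> * Y t \<omega> \<partial>M)"
proof -
  interpret sigma_finite_subalgebra M "F s" by (rule sub)
  have int: "integrable M (Y t)" "integrable M (Y s)"
    and AE: "AE \<omega> in M. real_cond_exp M (F s) (Y t) \<omega> = Y s \<omega>"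
    using mart s by (auto simp: martingale_def)
  note [measurable] = borel_measurable_integrable[OF int(1)] borel_measurable_integrable[OF int(2)]
  have [measurable]: "A \<in> sets M" using A subalg by (auto simp: subalgebra_def)
  have "(\<integral>\<omega>. indicator A \<omega> * Y t \<omega> \<partial>M) = (\<integral>\<omega>. indicator A \<omega> * real_cond_exp M (F s) (Y t) \<omega> \<partial>M)"
    using real_cond_exp_intA[OF int(1) A] by (simp add: set_lebesgue_integral_def)
  also have "\<dots> = (\<integral>\<omega>. indicator A \<omega> * Y s \<omega> \<partial>M)"
    by (rule integral_cong_AE) (use AE in \<open>auto elim!: eventually_mono\<close>)
  finally show ?thesis ..
qed

text \<open>
  The absolute value is tested with the sign of Y s, which is known at time s.
\<close>

lemma martingale_abs_mono:
  assumes sub: "\<And>s. sigma_finite_subalgebra M (F s)" and mart: "martingale M F Y"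
    and s: "0 \<le> s" "s \<le> t"
  shows "(\<integral>\<omega>. \<bar>Y s \<omega>\<bar> \<partial>M) \<le> (\<integral>\<omega>. \<bar>Y t \<omega>\<bar> \<partial>M)"
proof -
  interpret sigma_finite_subalgebra M "F s" by (rule sub)
  have ints: "integrable M (Y t)" "integrable M (Y s)" and meas: "Y s \<in> borel_measurable (F s)"
    using mart s by (auto simp: martingale_def)
  define A where "A = {\<omega> \<in> space (F s). 0 \<le> Y s \<omega>}"
  define B where "B = {\<omega> \<in> space (F s). Y s \<omega> < 0}"
  have sets: "A \<in> sets (F s)" "B \<in> sets (F s)" unfolding A_def B_def using meas by measurable
  then have setsM: "A \<in> sets M" "B \<in> sets M" using subalg by (auto simp: subalgebra_def)
  have int: "integrable M (\<lambda>\<omega>. indicator D \<omega> * Y r \<omega>)" if "D \<in> {A, B}" "r \<in> {s, t}" for D r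
    using that integrable_mult_indicator[of D M "Y r"] setsM ints by auto
  have "(\<integral>\<omega>. \<bar>Y s \<omega>\<bar> \<partial>M) = (\<integral>\<omega>. indicator A \<omega> * Y s \<omega> - indicator B \<omega> * Y s \<omega> \<partial>M)"
    by (intro Bochner_Integration.integral_cong)
       (use subalg in \<open>auto simp: A_def B_def subalgebra_def split: split_indicator\<close>)
  also have "\<dots> = (\<integral>\<omega>. indicator A \<omega> * Y t \<omega> - indicator B \<omega> * Y t \<omega> \<partial>M)"
    using int martingale_indicator[OF sub mart s sets(1)] martingale_indicator[OF sub mart s sets(2)]
    by (simp add: Bochner_Integration.integral_diff)
  also have "\<dots> \<le> (\<integral>\<omega>. \<bar>Y t \<omega>\<bar> \<partial>M)"
    using int ints by (intro integral_mono) (auto simp: A_def B_def split: split_indicator)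
  finally show ?thesis .
qed

lemma martingale_cong:
  assumes mart: "martingale M F Y" and sub: "\<And>s. sigma_finite_subalgebra M (F s)"
    and eq: "\<And>t \<omega>. 0 \<le> t \<Longrightarrow> \<omega> \<in> space M \<Longrightarrow> Y t \<omega> = Z t \<omega>"
  shows "martingale M F Z"
  unfolding martingale_def
proof (intro conjI allI impI)
  have space: "space (F t) = space M" for t
    using sigma_finite_subalgebra.subalg[OF sub, of t] by (simp add: subalgebra_def)
  fix t :: real assume t: "0 \<le> t"
  show "Z t \<in> borel_measurable (F t)"
    using mart t measurable_cong[of "F t" "Y t" "Z t" borel] eq[OF t] space by (simp add: martingale_def)
  show "integrable M (Z t)"
    using mart t Bochner_Integration.integrable_cong[of M M "Y t" "Z t"] eq[OF t] by (simp add: martingale_def)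
next
  fix s t :: real assume s: "0 \<le> s" "s \<le> t"
  interpret sigma_finite_subalgebra M "F s" by (rule sub)
  have t: "0 \<le> t" using s by simp
  have m: "Y t \<in> borel_measurable M"
    using mart t by (intro borel_measurable_integrable) (auto simp: martingale_def)
  then have mZ: "Z t \<in> borel_measurable M"
    using measurable_cong[of M "Y t" "Z t" borel] eq[OF t] by simp
  have "AE \<omega> in M. real_cond_exp M (F s) (Y t) \<omega> = real_cond_exp M (F s) (Z t) \<omega>"
    by (rule real_cond_exp_cong) (use eq t m mZ in auto)
  moreover have "AE \<omega> in M. real_cond_exp M (F s) (Y t) \<omega> = Y s \<omega>"
    using mart s by (auto simp: martingale_def)
  ultimately show "AE \<omega> in M. real_cond_exp M (F s) (Z t) \<omega> = Z s \<omega>"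
    using AE_space by eventually_elim (use eq[OF s(1)] in auto)
qed

context markov_process
begin

lemma X0_in_S: "\<omega> \<in> space M \<Longrightarrow> X0 s \<omega> \<in> S"
  unfolding X0_def by (rule X_in_S) auto

lemma path_poly_bounded:
  assumes "\<omega> \<in> space M"
  obtains K where "\<And>s. s \<le> t \<Longrightarrow> \<bar>poly p (X0 s \<omega>)\<bar> \<le> K"
proof -
  obtain B where B: "\<And>s. 0 \<le> s \<Longrightarrow> s \<le> max 0 t \<Longrightarrow> \<bar>X s \<omega>\<bar> \<le> B"
    using cadlag_bounded[OF cadlag_paths[OF assms]] by metis
  have "compact (poly p ` {- B..B})"
    by (intro compact_continuous_image continuous_intros) auto
  then obtain K where "\<forall>y\<in>{- B..B}. \<bar>poly p y\<bar> \<le> K"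
    by (auto dest!: compact_imp_bounded simp: bounded_iff)
  then have K: "\<And>y. y \<in> {- B..B} \<Longrightarrow> \<bar>poly p y\<bar> \<le> K" by blast
  show ?thesis
  proof (rule that)
    fix s assume "s \<le> t"
    then have "\<bar>X0 s \<omega>\<bar> \<le> B" unfolding X0_def by (intro B) auto
    then show "\<bar>poly p (X0 s \<omega>)\<bar> \<le> K" by (intro K) auto
  qed
qed

text \<open>
  The process that is a local martingale under P x when q is the image of p under the generator.
\<close>

definition dynkin :: "real poly \<Rightarrow> real poly \<Rightarrow> real \<Rightarrow> real \<Rightarrow> 'a \<Rightarrow> real" where
  "dynkin p q x s \<omega> = poly p (X0 s \<omega>) - poly p x - (LINT r:{0..s}|lborel. poly q (X0 r \<omega>))"

lemma dynkin_measurable [measurable (raw)]: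
  assumes [measurable]: "f \<in> borel_measurable N" "g \<in> measurable N M"
  shows "(\<lambda>y. dynkin p q x (f y) (g y)) \<in> borel_measurable N"
proof -
  have "(\<lambda>y. \<integral>r. (if 0 \<le> r \<and> r \<le> f y then poly q (X0 r (g y)) else 0) \<partial>lborel) \<in> borel_measurable N"
    by measurable
  moreover have "(LINT r:{0..s}|lborel. poly q (X0 r \<omega>)) = (\<integral>r. (if 0 \<le> r \<and> r \<le> s then poly q (X0 r \<omega>) else 0) \<partial>lborel)" for s \<omega>
    unfolding set_lebesgue_integral_def
    by (intro Bochner_Integration.integral_cong) (auto split: split_indicator)
  ultimately have [measurable]: "(\<lambda>y. LINT r:{0..f y}|lborel. poly q (X0 r (g y))) \<in> borel_measurable N" by simp
  show ?thesis unfolding dynkin_def by measurable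
qed

text \<open>
  Besides passing from functions on S to polynomials, this records that the stopped processes
  have mean zero: they start at zero because X starts at x almost surely.
\<close>

lemma generates_localized:
  assumes x: "x \<in> S" and gen: "generates S F P X (restrict (poly p) S) (restrict (poly q) S)"
  obtains T :: "nat \<Rightarrow> 'a \<Rightarrow> real" where
    "\<And>n. stopping_time F (T n)" "\<And>n \<omega>. \<omega> \<in> space M \<Longrightarrow> 0 \<le> T n \<omega>"
    "\<And>n. T n \<in> borel_measurable M"
    "AE \<omega> in P x. filterlim (\<lambda>n. T n \<omega>) at_top sequentially"
    "\<And>n. martingale (P x) F (\<lambda>t \<omega>. dynkin p q x (min t (T n \<omega>)) \<omega>)"
    "\<And>n t. 0 \<le> t \<Longrightarrow> (\<integral>\<omega>. dynkin p q x (min t (T n \<omega>)) \<omega> \<partial>P x) = 0"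
proof -
  define Y where "Y t \<omega> = restrict (poly p) S (X t \<omega>) - restrict (poly p) S x
      - (LINT s:{0..t}|lborel. restrict (poly q) S (X s \<omega>))" for t \<omega>
  have Y_eq: "Y t \<omega> = dynkin p q x t \<omega>" if "0 \<le> t" "\<omega> \<in> space M" for t \<omega>
  proof -
    have "(LINT s:{0..t}|lborel. restrict (poly q) S (X s \<omega>)) = (LINT s:{0..t}|lborel. poly q (X0 s \<omega>))"
      by (rule set_lebesgue_integral_cong) (use that X_in_S in auto)
    then show ?thesis using that x X_in_S[of t \<omega>] by (simp add: Y_def dynkin_def)
  qed
  have "local_martingale (P x) F Y" using gen x unfolding generates_def Y_def by blast
  then obtain T :: "nat \<Rightarrow> 'a \<Rightarrow> real" where T: "\<And>n. stopping_time F (T n)"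
      "\<And>n \<omega>. \<omega> \<in> space (P x) \<Longrightarrow> 0 \<le> T n \<omega>"
      "AE \<omega> in P x. incseq (\<lambda>n. T n \<omega>) \<and> filterlim (\<lambda>n. T n \<omega>) at_top sequentially"
      "\<And>n. martingale (P x) F (\<lambda>t \<omega>. Y (min t (T n \<omega>)) \<omega>)"
    unfolding local_martingale_def by blast
  have sub: "sigma_finite_subalgebra (P x) (F s)" for s by (rule cond_exp_P[OF x])
  have T0: "0 \<le> T n \<omega>" if "\<omega> \<in> space M" for n \<omega> using T(2) that by (simp add: space_P x)
  have mart: "martingale (P x) F (\<lambda>t \<omega>. dynkin p q x (min t (T n \<omega>)) \<omega>)" for n
    by (rule martingale_cong[OF T(4) sub]) (use T0 in \<open>auto intro!: Y_eq simp: space_P x\<close>)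
  have mean: "(\<integral>\<omega>. dynkin p q x (min t (T n \<omega>)) \<omega> \<partial>P x) = 0" if t: "0 \<le> t" for n t
  proof -
    have sp: "space M \<in> sets (F 0)" using sets.top[of "F 0"] by (simp add: space_F)
    have "(\<integral>\<omega>. dynkin p q x (min t (T n \<omega>)) \<omega> \<partial>P x)
        = (\<integral>\<omega>. indicator (space M) \<omega> * dynkin p q x (min t (T n \<omega>)) \<omega> \<partial>P x)"
      by (intro Bochner_Integration.integral_cong) (auto simp: space_P x)
    also have "\<dots> = (\<integral>\<omega>. indicator (space M) \<omega> * dynkin p q x (min 0 (T n \<omega>)) \<omega> \<partial>P x)"
      using martingale_indicator[OF sub mart _ t sp] by simp
    also have "\<dots> = (\<integral>\<omega>. 0 \<partial>P x)"
    proof (rule integral_cong_AE)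
      have "integrable (P x) (\<lambda>\<omega>. dynkin p q x (min 0 (T n \<omega>)) \<omega>)"
        using mart[of n] by (auto simp: martingale_def)
      then have [measurable]: "(\<lambda>\<omega>. dynkin p q x (min 0 (T n \<omega>)) \<omega>) \<in> borel_measurable (P x)" by auto
      have [measurable]: "space M \<in> sets (P x)" by (simp add: sets_P x)
      show "(\<lambda>\<omega>. indicator (space M) \<omega> * dynkin p q x (min 0 (T n \<omega>)) \<omega>) \<in> borel_measurable (P x)" by measurable
      have null: "(LINT r:{0..0::real}|lborel. f r) = (0::real)" for f
        unfolding set_lebesgue_integral_def
        by (rule integral_eq_zero_AE) (use AE_lborel_singleton[of "0::real"] in \<open>auto elim!: eventually_mono\<close>)
      show "AE \<omega> in P x. indicator (space M) \<omega> * dynkin p q x (min 0 (T n \<omega>)) \<omega> = 0"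
        using initial[OF x] AE_space
      proof eventually_elim
        case (elim \<omega>)
        then have "min 0 (T n \<omega>) = 0" using T0[of \<omega> n] by (simp add: space_P x)
        with elim show ?case by (simp add: dynkin_def null[simplified])
      qed
    qed simp
    finally show ?thesis by simp
  qed
  show ?thesis
  proof (rule that[of T])
    show "T n \<in> borel_measurable M" for n
      by (rule measurable_stopping_time[OF T(1)]) (use subalg space_F in auto)
    show "AE \<omega> in P x. filterlim (\<lambda>n. T n \<omega>) at_top sequentially" using T(3) by eventually_elim auto
  qed (use T T0 mart mean in auto)
qed

end

lemma running_integral_measurable:
  fixes f :: "real \<Rightarrow> real"
  assumes [measurable]: "f \<in> borel_measurable borel"
  shows "(\<lambda>s. LINT r:{0..s}|lborel. f r) \<in> borel_measurable borel"
proof -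
  have "(LINT r:{0..s}|lborel. f r) = (\<integral>r. (if 0 \<le> r \<and> r \<le> s then f r else 0) \<partial>lborel)" for s
    unfolding set_lebesgue_integral_def
    by (intro Bochner_Integration.integral_cong) (auto split: split_indicator)
  then show ?thesis by simp
qed

lemma running_integral_bounded:
  fixes f :: "real \<Rightarrow> real"
  assumes [measurable]: "f \<in> borel_measurable borel"
    and K: "\<And>s. 0 \<le> s \<Longrightarrow> s \<le> t \<Longrightarrow> \<bar>f s\<bar> \<le> K" and s: "0 \<le> s" "s \<le> t"
  shows "\<bar>LINT r:{0..s}|lborel. f r\<bar> \<le> K * t"
proof -
  have "0 \<le> K" using K[of s] s by linarith
  have "\<bar>LINT r:{0..s}|lborel. f r\<bar> \<le> (LINT r:{0..s}|lborel. \<bar>f r\<bar>)"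
    using integral_abs_bound[of lborel "\<lambda>r. indicator {0..s} r *\<^sub>R f r"]
    by (simp add: set_lebesgue_integral_def abs_mult)
  also have "\<dots> \<le> (LINT r:{0..s}|lborel. K)"
    by (rule set_integral_mono) (use s K \<open>0 \<le> K\<close> in \<open>auto intro!: set_integrable_bounded[where K = K] K\<close>)
  also have "\<dots> = K * s" using s by (simp add: set_lebesgue_integral_def)
  also have "\<dots> \<le> K * t" using s \<open>0 \<le> K\<close> by (intro mult_left_mono) auto
  finally show ?thesis .
qed

text \<open>
  When N 0 = 0, the right-hand side is c plus the integral of exp (- C * s) against dN, after an
  integration by parts that makes it meaningful for every path. The difference of the two sides
  is the integral of exp (- C * s) * (g s - C * u s), which has the right sign. The form with N
  s - N \<tau> is chosen because the increments of a stopped martingale have mean zero.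
\<close>

lemma exp_path_inequality:
  fixes u g :: "real \<Rightarrow> real" and c :: real
  assumes u [measurable]: "u \<in> borel_measurable borel" and g [measurable]: "g \<in> borel_measurable borel"
    and C: "C \<ge> 0" and \<tau>: "0 \<le> \<tau>"
    and K: "\<And>s. 0 \<le> s \<Longrightarrow> s \<le> \<tau> \<Longrightarrow> \<bar>u s\<bar> \<le> K" "\<And>s. 0 \<le> s \<Longrightarrow> s \<le> \<tau> \<Longrightarrow> \<bar>g s\<bar> \<le> K"
    and le: "\<And>s. 0 \<le> s \<Longrightarrow> s \<le> \<tau> \<Longrightarrow> g s \<le> C * u s"
    and N: "\<And>s. N s = u s - c - (LINT r:{0..s}|lborel. g r)"
  shows "exp (- C * \<tau>) * u \<tau> \<le> c + N \<tau> + (LINT s:{0..\<tau>}|lborel. C * exp (- C * s) * (N s - N \<tau>))"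
proof -
  define I where "I s = (LINT r:{0..s}|lborel. g r)" for s
  have [measurable]: "I \<in> borel_measurable borel"
    unfolding I_def by (rule running_integral_measurable[OF g])
  have I_bd: "\<bar>I s\<bar> \<le> K * \<tau>" if "0 \<le> s" "s \<le> \<tau>" for s
    unfolding I_def by (rule running_integral_bounded[OF g K(2) that])
  have e: "\<bar>exp (- C * s)\<bar> \<le> 1" "\<bar>C * exp (- C * s)\<bar> \<le> C" if "0 \<le> s" for s
    using that C by (auto simp: abs_mult mult_le_cancel_left2)
  have K0: "0 \<le> K" using K(1)[of 0] \<tau> by linarith
  have "set_integrable lborel {0..\<tau>} (\<lambda>s. C * exp (- C * s) * u s)"
    by (rule set_integrable_bounded_mult[OF _ u e(2) K(1)]) measurable
  moreover have "set_integrable lborel {0..\<tau>} (\<lambda>s. C * exp (- C * s))"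
    by (rule set_integrable_bounded[OF _ e(2)]) measurable
  moreover have "set_integrable lborel {0..\<tau>} (\<lambda>s. C * exp (- C * s) * I s)"
    by (rule set_integrable_bounded_mult[OF _ _ e(2) I_bd]) measurable
  moreover have "set_integrable lborel {0..\<tau>} (\<lambda>s. exp (- C * s) * g s)"
    by (rule set_integrable_bounded_mult[OF _ g e(1) K(2)]) measurable
  moreover have "set_integrable lborel {0..\<tau>} g" by (rule set_integrable_bounded[OF g K(2)])
  ultimately have int: "set_integrable lborel {0..\<tau>} (\<lambda>s. C * exp (- C * s) * u s)"
      "set_integrable lborel {0..\<tau>} (\<lambda>s. C * exp (- C * s))"
      "set_integrable lborel {0..\<tau>} (\<lambda>s. C * exp (- C * s) * I s)"
      "set_integrable lborel {0..\<tau>} (\<lambda>s. exp (- C * s) * g s)"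
      "set_integrable lborel {0..\<tau>} g" .
  have "(LINT s:{0..\<tau>}|lborel. C * exp (- C * s) * I s)
      = (LINT r:{0..\<tau>}|lborel. g r * (exp (- C * r) - exp (- C * \<tau>)))"
    unfolding I_def by (rule exp_weighted_integral[OF g C K(2)])
  also have "\<dots> = (LINT r:{0..\<tau>}|lborel. exp (- C * r) * g r - exp (- C * \<tau>) * g r)"
    by (simp add: algebra_simps)
  also have "\<dots> = (LINT r:{0..\<tau>}|lborel. exp (- C * r) * g r) - exp (- C * \<tau>) * I \<tau>"
    using int by (subst set_integral_diff(2)) (auto simp: I_def)
  finally have II: "(LINT s:{0..\<tau>}|lborel. C * exp (- C * s) * I s)
      = (LINT r:{0..\<tau>}|lborel. exp (- C * r) * g r) - exp (- C * \<tau>) * I \<tau>" .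
  have split: "C * exp (- C * s) * (N s - N \<tau>) = C * exp (- C * s) * u s - C * exp (- C * s) * I s
      + (I \<tau> - u \<tau>) * (C * exp (- C * s))" for s
    by (simp add: N I_def algebra_simps)
  have "(LINT s:{0..\<tau>}|lborel. C * exp (- C * s) * (N s - N \<tau>))
      = (LINT s:{0..\<tau>}|lborel. C * exp (- C * s) * u s) - (LINT s:{0..\<tau>}|lborel. C * exp (- C * s) * I s)
        + (I \<tau> - u \<tau>) * (LINT s:{0..\<tau>}|lborel. C * exp (- C * s))"
    unfolding split using int
    by (simp only: set_integral_add set_integral_diff set_integral_mult_right set_integrable_mult_right)
  also have "(LINT s:{0..\<tau>}|lborel. C * exp (- C * s)) = 1 - exp (- C * \<tau>)"
    using integral_exp_Icc[OF C \<tau>] by simp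
  finally have eq: "(LINT s:{0..\<tau>}|lborel. C * exp (- C * s) * (N s - N \<tau>))
      = (LINT s:{0..\<tau>}|lborel. C * exp (- C * s) * u s) - (LINT r:{0..\<tau>}|lborel. exp (- C * r) * g r)
        + exp (- C * \<tau>) * I \<tau> + (I \<tau> - u \<tau>) * (1 - exp (- C * \<tau>))"
    unfolding II by simp
  have "(LINT r:{0..\<tau>}|lborel. exp (- C * r) * g r) \<le> (LINT s:{0..\<tau>}|lborel. C * exp (- C * s) * u s)"
  proof (rule set_integral_mono[OF int(4) int(1)])
    fix s assume "s \<in> {0..\<tau>}"
    then have "exp (- C * s) * g s \<le> exp (- C * s) * (C * u s)"
      using le[of s] by (intro mult_left_mono) auto
    then show "exp (- C * s) * g s \<le> C * exp (- C * s) * u s" by (simp add: mult.assoc mult.left_commute)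
  qed
  then show ?thesis unfolding eq by (simp add: N I_def algebra_simps)
qed

context markov_process
begin

text \<open>
  Up to the stopping time, exp (- C * s) * p (X s) is a supermartingale. Integrating the
  pathwise inequality leaves the increments N s - N t on the event s < T; that event is known at
  time s, so their mean vanishes.
\<close>

lemma exp_stopped_mean_le:
  assumes x: "x \<in> S" and C: "C \<ge> 0" and t: "t \<ge> 0"
    and nonneg: "\<And>y. y \<in> S \<Longrightarrow> 0 \<le> poly p y"
    and le: "\<And>y. y \<in> S \<Longrightarrow> poly q y \<le> C * poly p y"
    and T: "stopping_time F T" "\<And>\<omega>. \<omega> \<in> space M \<Longrightarrow> 0 \<le> T \<omega>" and T_meas [measurable]: "T \<in> borel_measurable M"
    and mart: "martingale (P x) F (\<lambda>t \<omega>. dynkin p q x (min t (T \<omega>)) \<omega>)"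
    and mean: "\<And>t. 0 \<le> t \<Longrightarrow> (\<integral>\<omega>. dynkin p q x (min t (T \<omega>)) \<omega> \<partial>P x) = 0"
  shows "(\<integral>\<^sup>+\<omega>. ennreal (exp (- C * min t (T \<omega>)) * poly p (X0 (min t (T \<omega>)) \<omega>)) \<partial>P x) \<le> ennreal (poly p x)"
proof -
  interpret Px: prob_space "P x" by (rule prob_space_P[OF x])
  interpret lP: pair_sigma_finite lborel "P x" ..
  have pair_cong: "measurable (lborel \<Otimes>\<^sub>M P x) K = measurable (lborel \<Otimes>\<^sub>M M) K" for K :: "'k measure"
    by (intro measurable_cong_sets sets_pair_measure_cong refl sets_P[OF x])
  define N where "N s \<omega> = dynkin p q x (min s (T \<omega>)) \<omega>" for s \<omega>
  have N_int: "integrable (P x) (N s)" if "0 \<le> s" for s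
    using mart that by (auto simp: martingale_def N_def[abs_def])
  have N_meas [measurable (raw)]: "(\<lambda>y. N (f y) (h y)) \<in> borel_measurable K"
    if [measurable]: "f \<in> borel_measurable K" "h \<in> measurable K M" for f h and K :: "'k measure"
    unfolding N_def by measurable
  define w where "w s = (if 0 \<le> s \<and> s \<le> t then C * exp (- C * s) else 0)" for s
  have w_nonneg: "0 \<le> w s" for s using C by (simp add: w_def)
  have w_int: "integrable lborel w"
  proof -
    have "set_integrable lborel {0..t} (\<lambda>s. C * exp (- C * s))"
      using C by (intro set_integrable_bounded[where K = C]) (auto simp: abs_mult mult_le_cancel_left2)
    then show ?thesis unfolding set_integrable_def w_def
      by (rule Bochner_Integration.integrable_cong[THEN iffD1, rotated 2]) (auto split: split_indicator)
  qed
  have w_meas [measurable]: "w \<in> borel_measurable borel" using w_int by auto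
  \<comment> \<open>only s < T contributes to the pathwise integral, and on this event N s -
      N t is a martingale increment\<close>
  define D where "D s \<omega> = (if s < T \<omega> then w s * (N s \<omega> - N t \<omega>) else 0)" for s \<omega>
  define B where "B = (\<integral>\<omega>. \<bar>N t \<omega>\<bar> \<partial>P x)"
  have sub: "sigma_finite_subalgebra (P x) (F s)" for s by (rule cond_exp_P[OF x])
  have D_int: "integrable (P x) (D s)" and D_abs: "(\<integral>\<omega>. \<bar>D s \<omega>\<bar> \<partial>P x) \<le> w s * (2 * B)"
    and D_mean: "(\<integral>\<omega>. D s \<omega> \<partial>P x) = 0" for s
  proof -
    have *: "integrable (P x) (D s) \<and> (\<integral>\<omega>. \<bar>D s \<omega>\<bar> \<partial>P x) \<le> w s * (2 * B) \<and> (\<integral>\<omega>. D s \<omega> \<partial>P x) = 0"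
    proof (cases "0 \<le> s \<and> s \<le> t")
      case True
      define A where "A = {\<omega> \<in> space (F s). s < T \<omega>}"
      have A: "A \<in> sets (F s)" unfolding A_def using stopping_timeD2[OF T(1), of s] by measurable
      then have AM [measurable]: "A \<in> sets (P x)" using sets_F_M by (simp add: sets_P x)
      have D_eq: "D s \<omega> = w s * (indicator A \<omega> * N s \<omega> - indicator A \<omega> * N t \<omega>)" if "\<omega> \<in> space (P x)" for \<omega>
        using that by (auto simp: D_def A_def space_F space_P x)
      have intA: "integrable (P x) (\<lambda>\<omega>. indicator A \<omega> * N r \<omega>)" if "0 \<le> r" for r
        using integrable_mult_indicator[OF AM N_int[OF that]] by simp
      have ints: "integrable (P x) (\<lambda>\<omega>. indicator A \<omega> * N s \<omega>)" "integrable (P x) (\<lambda>\<omega>. indicator A \<omega> * N t \<omega>)"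
        using intA t True by auto
      have int: "integrable (P x) (D s)"
        using ints by (subst Bochner_Integration.integrable_cong[OF refl D_eq]) auto
      have "(\<integral>\<omega>. D s \<omega> \<partial>P x) = w s * ((\<integral>\<omega>. indicator A \<omega> * N s \<omega> \<partial>P x) - (\<integral>\<omega>. indicator A \<omega> * N t \<omega> \<partial>P x))"
        using ints by (subst Bochner_Integration.integral_cong[OF refl D_eq]) auto
      also have "(\<integral>\<omega>. indicator A \<omega> * N s \<omega> \<partial>P x) = (\<integral>\<omega>. indicator A \<omega> * N t \<omega> \<partial>P x)"
        unfolding N_def using True by (intro martingale_indicator[OF sub mart _ _ A]) auto
      finally have mean0: "(\<integral>\<omega>. D s \<omega> \<partial>P x) = 0" by simp
      have "(\<integral>\<omega>. \<bar>D s \<omega>\<bar> \<partial>P x) \<le> (\<integral>\<omega>. w s * (\<bar>N s \<omega>\<bar> + \<bar>N t \<omega>\<bar>) \<partial>P x)"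
      proof (rule integral_mono)
        show "integrable (P x) (\<lambda>\<omega>. \<bar>D s \<omega>\<bar>)" using int by simp
        show "integrable (P x) (\<lambda>\<omega>. w s * (\<bar>N s \<omega>\<bar> + \<bar>N t \<omega>\<bar>))" using N_int True by auto
        show "\<bar>D s \<omega>\<bar> \<le> w s * (\<bar>N s \<omega>\<bar> + \<bar>N t \<omega>\<bar>)" for \<omega>
          using w_nonneg[of s] by (auto simp: D_def abs_mult intro!: mult_left_mono)
      qed
      also have "\<dots> = w s * ((\<integral>\<omega>. \<bar>N s \<omega>\<bar> \<partial>P x) + B)"
        using N_int[of s] N_int[of t] True t by (simp add: B_def)
      also have "\<dots> \<le> w s * (2 * B)"
        using martingale_abs_mono[OF sub mart, of s t] True w_nonneg[of s]
        by (intro mult_left_mono) (auto simp: B_def N_def)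
      finally show ?thesis using int mean0 by simp
    next
      case False
      then have "D s = (\<lambda>_. 0)" "w s = 0" by (auto simp: D_def w_def fun_eq_iff)
      then show ?thesis by simp
    qed
    from * show "integrable (P x) (D s)" "(\<integral>\<omega>. \<bar>D s \<omega>\<bar> \<partial>P x) \<le> w s * (2 * B)" "(\<integral>\<omega>. D s \<omega> \<partial>P x) = 0"
      by auto
  qed
  have D_meas [measurable]: "case_prod D \<in> borel_measurable (lborel \<Otimes>\<^sub>M P x)"
    unfolding D_def pair_cong by measurable
  have D_pair: "integrable (lborel \<Otimes>\<^sub>M P x) (case_prod D)"
  proof (rule lP.Fubini_integrable)
    show "integrable lborel (\<lambda>s. \<integral>\<omega>. norm (case_prod D (s, \<omega>)) \<partial>P x)"
      by (rule Bochner_Integration.integrable_bound[OF integrable_mult_left[OF w_int, of "2 * B"]])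
         (measurable, use D_abs w_nonneg in \<open>auto intro!: AE_I2 order_trans[OF _ abs_ge_self] integral_nonneg_AE\<close>)
    show "AE s in lborel. integrable (P x) (\<lambda>\<omega>. case_prod D (s, \<omega>))"
      using D_int by simp
  qed measurable
  have DD_int: "integrable (P x) (\<lambda>\<omega>. \<integral>s. D s \<omega> \<partial>lborel)"
    by (rule lP.integrable_snd[OF D_pair])
  have DD_mean: "(\<integral>\<omega>. (\<integral>s. D s \<omega> \<partial>lborel) \<partial>P x) = 0"
    using lP.Fubini_integral[OF D_pair] D_mean by simp
  have path: "exp (- C * min t (T \<omega>)) * poly p (X0 (min t (T \<omega>)) \<omega>)
      \<le> poly p x + N t \<omega> + (\<integral>s. D s \<omega> \<partial>lborel)" if \<omega>: "\<omega> \<in> space M" for \<omega>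
  proof -
    define \<tau> where "\<tau> = min t (T \<omega>)"
    have \<tau>: "0 \<le> \<tau>" using t T(2)[OF \<omega>] by (simp add: \<tau>_def)
    obtain K1 where K1: "\<And>s. s \<le> \<tau> \<Longrightarrow> \<bar>poly p (X0 s \<omega>)\<bar> \<le> K1" using path_poly_bounded[OF \<omega>] by metis
    obtain K2 where K2: "\<And>s. s \<le> \<tau> \<Longrightarrow> \<bar>poly q (X0 s \<omega>)\<bar> \<le> K2" using path_poly_bounded[OF \<omega>] by metis
    note [measurable] = \<omega>
    have "exp (- C * \<tau>) * poly p (X0 \<tau> \<omega>) \<le> poly p x + dynkin p q x \<tau> \<omega>
        + (LINT s:{0..\<tau>}|lborel. C * exp (- C * s) * (dynkin p q x s \<omega> - dynkin p q x \<tau> \<omega>))"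
    proof (rule exp_path_inequality[where u = "\<lambda>s. poly p (X0 s \<omega>)" and g = "\<lambda>s. poly q (X0 s \<omega>)" and K = "max K1 K2"])
      show "\<bar>poly p (X0 s \<omega>)\<bar> \<le> max K1 K2" if "s \<le> \<tau>" for s using K1[OF that] by simp
      show "\<bar>poly q (X0 s \<omega>)\<bar> \<le> max K1 K2" if "s \<le> \<tau>" for s using K2[OF that] by simp
      show "poly q (X0 s \<omega>) \<le> C * poly p (X0 s \<omega>)" for s by (rule le[OF X0_in_S[OF \<omega>]])
    qed (use C \<tau> in \<open>auto simp: dynkin_def\<close>)
    also have "(LINT s:{0..\<tau>}|lborel. C * exp (- C * s) * (dynkin p q x s \<omega> - dynkin p q x \<tau> \<omega>)) = (\<integral>s. D s \<omega> \<partial>lborel)"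
      unfolding set_lebesgue_integral_def
    proof (rule integral_cong_AE)
      show "AE s in lborel. indicator {0..\<tau>} s *\<^sub>R (C * exp (- C * s) * (dynkin p q x s \<omega> - dynkin p q x \<tau> \<omega>)) = D s \<omega>"
        using AE_lborel_singleton[of "T \<omega>"]
        by eventually_elim (auto simp: D_def w_def N_def \<tau>_def min_def split: split_indicator)
      show "(\<lambda>s. D s \<omega>) \<in> borel_measurable lborel"
        unfolding D_def by measurable
    qed measurable
    finally show ?thesis by (simp add: N_def \<tau>_def)
  qed
  have "(\<integral>\<^sup>+\<omega>. ennreal (exp (- C * min t (T \<omega>)) * poly p (X0 (min t (T \<omega>)) \<omega>)) \<partial>P x)
      \<le> (\<integral>\<^sup>+\<omega>. ennreal (poly p x + N t \<omega> + (\<integral>s. D s \<omega> \<partial>lborel)) \<partial>P x)"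
    by (intro nn_integral_mono ennreal_leI path) (simp add: space_P x)
  also have "\<dots> = ennreal (\<integral>\<omega>. poly p x + N t \<omega> + (\<integral>s. D s \<omega> \<partial>lborel) \<partial>P x)"
  proof (rule nn_integral_eq_integral)
    show "integrable (P x) (\<lambda>\<omega>. poly p x + N t \<omega> + (\<integral>s. D s \<omega> \<partial>lborel))"
      using N_int[OF t] DD_int by auto
    show "AE \<omega> in P x. 0 \<le> poly p x + N t \<omega> + (\<integral>s. D s \<omega> \<partial>lborel)"
    proof (rule AE_I2)
      fix \<omega> assume "\<omega> \<in> space (P x)"
      then have \<omega>: "\<omega> \<in> space M" by (simp add: space_P x)
      have "0 \<le> exp (- C * min t (T \<omega>)) * poly p (X0 (min t (T \<omega>)) \<omega>)"
        using nonneg[OF X0_in_S[OF \<omega>]] by simp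
      with path[OF \<omega>] show "0 \<le> poly p x + N t \<omega> + (\<integral>s. D s \<omega> \<partial>lborel)" by linarith
    qed
  qed
  also have "(\<integral>\<omega>. poly p x + N t \<omega> + (\<integral>s. D s \<omega> \<partial>lborel) \<partial>P x) = poly p x"
    using N_int[OF t] DD_int DD_mean mean[OF t] by (simp add: N_def[abs_def] Px.prob_space)
  finally show ?thesis .
qed

text \<open>
  Fatou along a localizing sequence removes the stopping. For p = 1 + y^2 this is the source of
  the second moments of the process.
\<close>

lemma trans_exp_bound:
  assumes x: "x \<in> S" and gen: "generates S F P X (restrict (poly p) S) (restrict (poly q) S)"
    and C: "C \<ge> 0" and t: "t \<ge> 0"
    and nonneg: "\<And>y. y \<in> S \<Longrightarrow> 0 \<le> poly p y"
    and le: "\<And>y. y \<in> S \<Longrightarrow> poly q y \<le> C * poly p y"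
  shows "transition t (\<lambda>y. ennreal (poly p y)) x \<le> ennreal (exp (C * t) * poly p x)"
proof -
  obtain T :: "nat \<Rightarrow> 'a \<Rightarrow> real" where T: "\<And>n. stopping_time F (T n)" "\<And>n \<omega>. \<omega> \<in> space M \<Longrightarrow> 0 \<le> T n \<omega>"
    and [measurable]: "\<And>n. T n \<in> borel_measurable M"
    and lim: "AE \<omega> in P x. filterlim (\<lambda>n. T n \<omega>) at_top sequentially"
    and mart: "\<And>n. martingale (P x) F (\<lambda>t \<omega>. dynkin p q x (min t (T n \<omega>)) \<omega>)"
      "\<And>n t. 0 \<le> t \<Longrightarrow> (\<integral>\<omega>. dynkin p q x (min t (T n \<omega>)) \<omega> \<partial>P x) = 0"
    by (rule generates_localized[OF x gen]) (rule that)
  let ?f = "\<lambda>n \<omega>. ennreal (exp (- C * min t (T n \<omega>)) * poly p (X0 (min t (T n \<omega>)) \<omega>))"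
  have "(\<integral>\<^sup>+\<omega>. ennreal (exp (- C * t) * poly p (X0 t \<omega>)) \<partial>P x) \<le> (\<integral>\<^sup>+\<omega>. liminf (\<lambda>n. ?f n \<omega>) \<partial>P x)"
  proof (rule nn_integral_mono_AE, use lim in eventually_elim)
    fix \<omega> assume "filterlim (\<lambda>n. T n \<omega>) at_top sequentially"
    then have "eventually (\<lambda>n. t \<le> T n \<omega>) sequentially" by (simp add: filterlim_at_top)
    then have "eventually (\<lambda>n. ?f n \<omega> = ennreal (exp (- C * t) * poly p (X0 t \<omega>))) sequentially"
      by eventually_elim (simp add: min_def)
    then have "(\<lambda>n. ?f n \<omega>) \<longlonglongrightarrow> ennreal (exp (- C * t) * poly p (X0 t \<omega>))" by (rule tendsto_eventually)
    then show "ennreal (exp (- C * t) * poly p (X0 t \<omega>)) \<le> liminf (\<lambda>n. ?f n \<omega>)"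
      by (simp add: lim_imp_Liminf)
  qed
  also have "\<dots> \<le> liminf (\<lambda>n. \<integral>\<^sup>+\<omega>. ?f n \<omega> \<partial>P x)"
    by (rule nn_integral_liminf) (unfold measurable_P_cong[OF x], measurable)
  also have "\<dots> \<le> ennreal (poly p x)"
  proof (rule Liminf_le)
    have "(\<integral>\<^sup>+\<omega>. ?f n \<omega> \<partial>P x) \<le> ennreal (poly p x)" for n
      by (rule exp_stopped_mean_le[OF x C t nonneg le T(1) T(2) _ mart(1) mart(2)]) measurable
    then show "\<forall>\<^sub>F n in sequentially. (\<integral>\<^sup>+\<omega>. ?f n \<omega> \<partial>P x) \<le> ennreal (poly p x)" by simp
  qed simp
  finally have *: "(\<integral>\<^sup>+\<omega>. ennreal (exp (- C * t) * poly p (X0 t \<omega>)) \<partial>P x) \<le> ennreal (poly p x)" .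
  have "transition t (\<lambda>y. ennreal (poly p y)) x
      = (\<integral>\<^sup>+\<omega>. ennreal (exp (C * t)) * ennreal (exp (- C * t) * poly p (X0 t \<omega>)) \<partial>P x)"
    unfolding transition_def
    by (intro nn_integral_cong) (simp add: ennreal_mult'[symmetric] mult.assoc[symmetric] exp_add[symmetric])
  also have "\<dots> = ennreal (exp (C * t)) * (\<integral>\<^sup>+\<omega>. ennreal (exp (- C * t) * poly p (X0 t \<omega>)) \<partial>P x)"
    by (rule nn_integral_cmult) (unfold measurable_P_cong[OF x], measurable)
  also have "\<dots> \<le> ennreal (exp (C * t)) * ennreal (poly p x)" by (intro mult_left_mono *) simp
  also have "\<dots> = ennreal (exp (C * t) * poly p x)" by (simp add: ennreal_mult')
  finally show ?thesis .
qed

end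

section \<open>Quadratic weights at stopping times\<close>

text \<open>
  A weight that dominates every polynomial of degree at most two, up to a constant factor.
\<close>

definition wt :: "real \<Rightarrow> ennreal" where "wt y = ennreal (1 + y\<^sup>2)"

lemma wt_measurable [measurable]: "wt \<in> borel_measurable borel"
  unfolding wt_def[abs_def] by measurable

context markov_process
begin

text \<open>
  On T < t, the time T is replaced by the next point of the grid of mesh t / k. These points
  decrease to T from the right, so right-continuity and Fatou carry a bound that is uniform in k
  over to T itself. At grid points the Markov property at deterministic times applies.
\<close>

lemma stopped_wt_le_grid:
  assumes x: "x \<in> S" and t: "t > 0" and T: "\<And>\<omega>. \<omega> \<in> space M \<Longrightarrow> 0 \<le> T \<omega>"
    and T_meas [measurable]: "T \<in> borel_measurable M"
    and bound: "\<And>k. k > 0 \<Longrightarrow> (\<Sum>j<k. \<integral>\<^sup>+\<omega>. wt (X (real (Suc j) * (t / real k)) \<omega>)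
        * indicator {\<omega> \<in> space M. real j * (t / real k) \<le> T \<omega> \<and> T \<omega> < real (Suc j) * (t / real k)} \<omega> \<partial>P x) \<le> B"
  shows "(\<integral>\<^sup>+\<omega>. (if T \<omega> < t then wt (X0 (T \<omega>) \<omega>) else 0) \<partial>P x) \<le> B"
proof -
  define A where "A k j = {\<omega> \<in> space M. real j * (t / real k) \<le> T \<omega> \<and> T \<omega> < real (Suc j) * (t / real k)}" for k j
  have [measurable]: "A k j \<in> sets M" for k j unfolding A_def by measurable
  define W where "W k \<omega> = (\<Sum>j<k. wt (X0 (real (Suc j) * (t / real k)) \<omega>) * indicator (A k j) \<omega>)" for k \<omega>
  have [measurable]: "W k \<in> borel_measurable M" for k unfolding W_def by measurable
  have "(\<integral>\<^sup>+\<omega>. (if T \<omega> < t then wt (X0 (T \<omega>) \<omega>) else 0) \<partial>P x) \<le> (\<integral>\<^sup>+\<omega>. liminf (\<lambda>n. W (Suc n) \<omega>) \<partial>P x)"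
  proof (rule nn_integral_mono)
    fix \<omega> assume "\<omega> \<in> space (P x)"
    then have \<omega>: "\<omega> \<in> space M" by (simp add: space_P x)
    show "(if T \<omega> < t then wt (X0 (T \<omega>) \<omega>) else 0) \<le> liminf (\<lambda>n. W (Suc n) \<omega>)"
    proof (cases "T \<omega> < t")
      case True
      \<comment> \<open>T lies in the cell with left end i k * (t / k), and d k is the right
          end of this cell\<close>
      define i where "i k = nat \<lfloor>T \<omega> * real k / t\<rfloor>" for k
      define d where "d k = real (Suc (i k)) * (t / real k)" for k
      have Tnn: "0 \<le> T \<omega>" by (rule T[OF \<omega>])
      have i: "real (i k) \<le> T \<omega> * real k / t" "T \<omega> * real k / t < real (Suc (i k))" for k
      proof -
        have "0 \<le> T \<omega> * real k / t" using Tnn t by simp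
        then have "real (i k) = real_of_int \<lfloor>T \<omega> * real k / t\<rfloor>" by (simp add: i_def)
        then show "real (i k) \<le> T \<omega> * real k / t" "T \<omega> * real k / t < real (Suc (i k))" by linarith+
      qed
      have d: "real (i k) * (t / real k) \<le> T \<omega>" "T \<omega> < d k" "d k \<le> T \<omega> + t / real k" and ik: "i k < k" if "k > 0" for k
      proof -
        show *: "real (i k) * (t / real k) \<le> T \<omega>" using i(1)[of k] that t by (simp add: field_simps)
        show "T \<omega> < d k" using i(2)[of k] that t by (simp add: d_def field_simps)
        have "d k = real (i k) * (t / real k) + t / real k"
          unfolding d_def by (simp only: of_nat_Suc distrib_right mult_1 add.commute)
        with * show "d k \<le> T \<omega> + t / real k" by linarith
        have "T \<omega> * real k / t < real k"
          using True t that by (subst pos_divide_less_eq) (auto simp: mult.commute)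
        with i(1)[of k] show "i k < k" by linarith
      qed
      have d_lim: "(\<lambda>n. d (Suc n)) \<longlonglongrightarrow> T \<omega>"
      proof (rule real_tendsto_sandwich[where f = "\<lambda>_. T \<omega>" and h = "\<lambda>n. T \<omega> + t * inverse (real (Suc n))"])
        show "(\<lambda>n. T \<omega> + t * inverse (real (Suc n))) \<longlonglongrightarrow> T \<omega>"
          using tendsto_add[OF tendsto_const[of "T \<omega>"] tendsto_mult[OF tendsto_const[of t] LIMSEQ_inverse_real_of_nat]] by simp
        show "\<forall>\<^sub>F n in sequentially. T \<omega> \<le> d (Suc n)" using d(2) by (intro always_eventually allI less_imp_le) simp
        show "\<forall>\<^sub>F n in sequentially. d (Suc n) \<le> T \<omega> + t * inverse (real (Suc n))"
          using d(3) by (intro always_eventually allI) (simp add: divide_inverse del: of_nat_Suc)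
      qed simp
      have "filterlim (\<lambda>n. d (Suc n)) (at_right (T \<omega>)) sequentially"
        unfolding filterlim_at using d_lim d(2) by (auto simp: less_imp_neq[symmetric])
      moreover have "((\<lambda>s. X0 s \<omega>) \<longlongrightarrow> X0 (T \<omega>) \<omega>) (at_right (T \<omega>))"
        unfolding X0_def by (rule cadlag_right_continuous[OF cadlag_paths[OF \<omega>]])
      ultimately have "(\<lambda>n. X0 (d (Suc n)) \<omega>) \<longlonglongrightarrow> X0 (T \<omega>) \<omega>" by (rule filterlim_compose[rotated])
      then have "(\<lambda>n. wt (X0 (d (Suc n)) \<omega>)) \<longlonglongrightarrow> wt (X0 (T \<omega>) \<omega>)"
        unfolding wt_def by (intro tendsto_intros)
      then have "wt (X0 (T \<omega>) \<omega>) = liminf (\<lambda>n. wt (X0 (d (Suc n)) \<omega>))" by (simp add: lim_imp_Liminf)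
      also have "\<dots> \<le> liminf (\<lambda>n. W (Suc n) \<omega>)"
      proof (intro Liminf_mono always_eventually allI)
        fix n
        have "\<omega> \<in> A (Suc n) (i (Suc n))" using \<omega> d[of "Suc n"] by (simp add: A_def d_def)
        then have "wt (X0 (d (Suc n)) \<omega>) = wt (X0 (real (Suc (i (Suc n))) * (t / real (Suc n))) \<omega>) * indicator (A (Suc n) (i (Suc n))) \<omega>"
          by (simp add: d_def)
        also have "\<dots> \<le> W (Suc n) \<omega>"
          unfolding W_def by (rule member_le_sum) (use ik[of "Suc n"] in auto)
        finally show "wt (X0 (d (Suc n)) \<omega>) \<le> W (Suc n) \<omega>" .
      qed
      finally show ?thesis using True by simp
    qed simp
  qed
  also have "\<dots> \<le> liminf (\<lambda>n. \<integral>\<^sup>+\<omega>. W (Suc n) \<omega> \<partial>P x)"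
    by (rule nn_integral_liminf) (unfold measurable_P_cong[OF x], measurable)
  also have "\<dots> \<le> B"
  proof (rule Liminf_le)
    have "(\<integral>\<^sup>+\<omega>. W (Suc n) \<omega> \<partial>P x) \<le> B" for n
    proof -
      have "(\<integral>\<^sup>+\<omega>. W (Suc n) \<omega> \<partial>P x) = (\<Sum>j<Suc n. \<integral>\<^sup>+\<omega>. wt (X0 (real (Suc j) * (t / real (Suc n))) \<omega>) * indicator (A (Suc n) j) \<omega> \<partial>P x)"
        unfolding W_def by (rule nn_integral_sum) (unfold measurable_P_cong[OF x], measurable)
      also have "\<dots> \<le> B" using bound[of "Suc n"] t by (simp add: A_def del: of_nat_Suc sum.lessThan_Suc)
      finally show ?thesis .
    qed
    then show "\<forall>\<^sub>F n in sequentially. (\<integral>\<^sup>+\<omega>. W (Suc n) \<omega> \<partial>P x) \<le> B" by simp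
  qed simp
  finally show ?thesis .
qed

text \<open>
  The growth bound makes exp (- C * t) * wt (X t) a supermartingale, and this is optional
  stopping on a grid: a j is the mass still running at the j-th grid point, b j the mass
  collected in the j-th cell, and one step of the Markov property gives b j + a (Suc j) \<le>
  exp (C * \<delta>) * a j.
\<close>

lemma stopped_wt_le:
  assumes x: "x \<in> S" and t: "t > 0" and T: "\<And>\<omega>. \<omega> \<in> space M \<Longrightarrow> 0 \<le> T \<omega>" "stopping_time F T"
    and T_meas [measurable]: "T \<in> borel_measurable M" and C: "C \<ge> 0"
    and growth: "\<And>y r. y \<in> S \<Longrightarrow> 0 \<le> r \<Longrightarrow> transition r wt y \<le> ennreal (exp (C * r)) * wt y"
  shows "(\<integral>\<^sup>+\<omega>. (if T \<omega> < t then wt (X0 (T \<omega>) \<omega>) else 0) \<partial>P x) \<le> ennreal (exp (C * t)) * wt x"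
proof (rule stopped_wt_le_grid[OF x t T(1) T_meas])
  fix k :: nat assume k: "k > 0"
  interpret Px: prob_space "P x" by (rule prob_space_P[OF x])
  define \<delta> where "\<delta> = t / real k"
  have \<delta>: "0 < \<delta>" using t k by (simp add: \<delta>_def)
  define A where "A j = {\<omega> \<in> space M. real j * \<delta> \<le> T \<omega> \<and> T \<omega> < real (Suc j) * \<delta>}" for j
  define D where "D j = {\<omega> \<in> space M. real j * \<delta> \<le> T \<omega>}" for j
  have A_meas [measurable]: "A j \<in> sets M" for j unfolding A_def by measurable
  have D_meas [measurable]: "D j \<in> sets M" for j unfolding D_def by measurable
  have D_F: "D j \<in> sets (F (real j * \<delta>))" for j
  proof -
    have "{\<omega> \<in> space (F (real j * \<delta>)). \<not> T \<omega> < real j * \<delta>} \<in> sets (F (real j * \<delta>))"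
      using stopping_time_less_const[OF T(2), of "real j * \<delta>"] by measurable
    also have "{\<omega> \<in> space (F (real j * \<delta>)). \<not> T \<omega> < real j * \<delta>} = D j" by (auto simp: D_def space_F)
    finally show ?thesis .
  qed
  have X_meas [measurable]: "X (real j * \<delta>) \<in> borel_measurable M" for j
    using \<delta> by (intro X_measurable) simp
  have X_meas' [measurable]: "X (real (Suc j) * \<delta>) \<in> borel_measurable M" for j
    using \<delta> by (intro X_measurable) simp
  define a where "a j = (\<integral>\<^sup>+\<omega>. wt (X (real j * \<delta>) \<omega>) * indicator (D j) \<omega> \<partial>P x)" for j
  define b where "b j = (\<integral>\<^sup>+\<omega>. wt (X (real (Suc j) * \<delta>) \<omega>) * indicator (A j) \<omega> \<partial>P x)" for j
  have step: "b j + a (Suc j) \<le> ennreal (exp (C * \<delta>)) * a j" for j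
  proof -
    have "b j + a (Suc j) = (\<integral>\<^sup>+\<omega>. wt (X (real (Suc j) * \<delta>) \<omega>) * indicator (A j) \<omega>
        + wt (X (real (Suc j) * \<delta>) \<omega>) * indicator (D (Suc j)) \<omega> \<partial>P x)"
      unfolding a_def b_def by (rule nn_integral_add[symmetric]) (unfold measurable_P_cong[OF x], measurable)
    also have "\<dots> = (\<integral>\<^sup>+\<omega>. wt (X (real j * \<delta> + \<delta>) \<omega>) * indicator (D j) \<omega> \<partial>P x)"
    proof (rule nn_integral_cong)
      fix \<omega>
      have "real (Suc j) * \<delta> = real j * \<delta> + \<delta>" by (simp add: algebra_simps)
      moreover have "indicator (A j) \<omega> + indicator (D (Suc j)) \<omega> = (indicator (D j) \<omega> :: ennreal)"
        using \<delta> by (auto simp: A_def D_def algebra_simps split: split_indicator)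
      ultimately show "wt (X (real (Suc j) * \<delta>) \<omega>) * indicator (A j) \<omega> + wt (X (real (Suc j) * \<delta>) \<omega>) * indicator (D (Suc j)) \<omega>
          = wt (X (real j * \<delta> + \<delta>) \<omega>) * indicator (D j) \<omega>"
        by (metis distrib_left)
    qed
    also have "\<dots> = (\<integral>\<^sup>+\<omega>. transition \<delta> wt (X (real j * \<delta>) \<omega>) * indicator (D j) \<omega> \<partial>P x)"
      using \<delta> by (intro markov_nn[OF x _ _ D_F]) auto
    also have "\<dots> \<le> (\<integral>\<^sup>+\<omega>. ennreal (exp (C * \<delta>)) * (wt (X (real j * \<delta>) \<omega>) * indicator (D j) \<omega>) \<partial>P x)"
      using \<delta> by (intro nn_integral_mono)
        (auto simp: space_P x mult.assoc[symmetric] intro!: mult_right_mono growth X_in_S)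
    also have "\<dots> = ennreal (exp (C * \<delta>)) * a j"
      unfolding a_def by (rule nn_integral_cmult) (unfold measurable_P_cong[OF x], measurable)
    finally show ?thesis .
  qed
  have "(\<Sum>j<m. b j) + a m \<le> ennreal (exp (C * (real m * \<delta>))) * wt x" for m
  proof (induction m)
    case 0
    have "a 0 \<le> (\<integral>\<^sup>+\<omega>. wt x \<partial>P x)"
      unfolding a_def by (intro nn_integral_mono_AE, use initial[OF x] in eventually_elim) (auto split: split_indicator)
    then show ?case by (simp add: Px.emeasure_space_1)
  next
    case (Suc m)
    have e1: "1 \<le> ennreal (exp (C * \<delta>))" using C \<delta> by simp
    have "(\<Sum>j<Suc m. b j) + a (Suc m) = (\<Sum>j<m. b j) + (b m + a (Suc m))" by (simp add: add.assoc)
    also have "\<dots> \<le> ennreal (exp (C * \<delta>)) * (\<Sum>j<m. b j) + ennreal (exp (C * \<delta>)) * a m"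
      using step[of m] mult_right_mono[OF e1, of "\<Sum>j<m. b j"] by (intro add_mono) auto
    also have "\<dots> = ennreal (exp (C * \<delta>)) * ((\<Sum>j<m. b j) + a m)" by (simp add: distrib_left)
    also have "\<dots> \<le> ennreal (exp (C * \<delta>)) * (ennreal (exp (C * (real m * \<delta>))) * wt x)"
      by (intro mult_left_mono Suc.IH) simp
    also have "\<dots> = ennreal (exp (C * \<delta>) * exp (C * (real m * \<delta>))) * wt x"
      by (simp add: ennreal_mult mult.assoc)
    also have "exp (C * \<delta>) * exp (C * (real m * \<delta>)) = exp (C * (real (Suc m) * \<delta>))"
      unfolding mult_exp_exp by (simp add: algebra_simps)
    finally show ?case .
  qed
  from this[of k] have "(\<Sum>j<k. b j) + a k \<le> ennreal (exp (C * t)) * wt x" using k by (simp add: \<delta>_def)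
  then have "(\<Sum>j<k. b j) \<le> ennreal (exp (C * t)) * wt x" by (metis add_increasing2 order_trans zero_le order_refl)
  then show "(\<Sum>j<k. \<integral>\<^sup>+\<omega>. wt (X (real (Suc j) * (t / real k)) \<omega>)
        * indicator {\<omega> \<in> space M. real j * (t / real k) \<le> T \<omega> \<and> T \<omega> < real (Suc j) * (t / real k)} \<omega> \<partial>P x)
      \<le> ennreal (exp (C * t)) * wt x"
    by (simp add: b_def A_def \<delta>_def del: of_nat_Suc)
qed

text \<open>
  The reverse comparison: if the weight cannot decrease in the mean by more than a factor K,
  then the weight at time T is controlled by the weight at the fixed time t on the same event T
  < t. This is much stronger than stopped_wt_le, since the right-hand side tends to zero along a
  localizing sequence.
\<close>

lemma stopped_wt_le_terminal:
  assumes x: "x \<in> S" and t: "t > 0" and T: "\<And>\<omega>. \<omega> \<in> space M \<Longrightarrow> 0 \<le> T \<omega>" "stopping_time F T"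
    and T_meas [measurable]: "T \<in> borel_measurable M"
    and lower: "\<And>y r. y \<in> S \<Longrightarrow> 0 \<le> r \<Longrightarrow> r \<le> t \<Longrightarrow> wt y \<le> ennreal K * transition r wt y"
  shows "(\<integral>\<^sup>+\<omega>. (if T \<omega> < t then wt (X0 (T \<omega>) \<omega>) else 0) \<partial>P x)
      \<le> ennreal K * (\<integral>\<^sup>+\<omega>. (if T \<omega> < t then wt (X t \<omega>) else 0) \<partial>P x)"
proof (rule stopped_wt_le_grid[OF x t T(1) T_meas])
  fix k :: nat assume k: "k > 0"
  define \<delta> where "\<delta> = t / real k"
  have \<delta>: "0 < \<delta>" using t k by (simp add: \<delta>_def)
  define A where "A j = {\<omega> \<in> space M. real j * \<delta> \<le> T \<omega> \<and> T \<omega> < real (Suc j) * \<delta>}" for j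
  have A_meas [measurable]: "A j \<in> sets M" for j unfolding A_def by measurable
  have [measurable]: "X t \<in> borel_measurable M" using t by (intro X_measurable) simp
  have A_F: "A j \<in> sets (F (real (Suc j) * \<delta>))" for j
  proof -
    let ?F = "F (real (Suc j) * \<delta>)"
    have 1: "{\<omega> \<in> space ?F. T \<omega> < real (Suc j) * \<delta>} \<in> sets ?F"
      using stopping_time_less_const[OF T(2), of "real (Suc j) * \<delta>"] by measurable
    have "{\<omega> \<in> space (F (real j * \<delta>)). T \<omega> < real j * \<delta>} \<in> sets (F (real j * \<delta>))"
      using stopping_time_less_const[OF T(2), of "real j * \<delta>"] by measurable
    also have "sets (F (real j * \<delta>)) \<subseteq> sets ?F" using \<delta> by (intro sets_F_mono mult_right_mono) auto
    finally have 2: "{\<omega> \<in> space (F (real j * \<delta>)). T \<omega> < real j * \<delta>} \<in> sets ?F" .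
    have "A j = {\<omega> \<in> space ?F. T \<omega> < real (Suc j) * \<delta>} - {\<omega> \<in> space (F (real j * \<delta>)). T \<omega> < real j * \<delta>}"
      by (auto simp: A_def space_F)
    then show ?thesis using 1 2 by auto
  qed
  have sum_ind: "(\<Sum>j<m. indicator (A j) \<omega>) = (if T \<omega> < real m * \<delta> then 1 else 0 :: ennreal)" if "\<omega> \<in> space M" for m \<omega>
  proof (induction m)
    case 0 show ?case using T(1)[OF that] by simp
  next
    case (Suc m)
    have "real m * \<delta> \<le> real (Suc m) * \<delta>" using \<delta> by (intro mult_right_mono) auto
    with Suc show ?case using that by (auto simp: A_def simp del: of_nat_Suc split: split_indicator)
  qed
  have "(\<integral>\<^sup>+\<omega>. wt (X (real (Suc j) * \<delta>) \<omega>) * indicator (A j) \<omega> \<partial>P x)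
      \<le> ennreal K * (\<integral>\<^sup>+\<omega>. wt (X t \<omega>) * indicator (A j) \<omega> \<partial>P x)" if j: "j < k" for j
  proof -
    define r where "r = t - real (Suc j) * \<delta>"
    have "real (Suc j) * \<delta> \<le> real k * \<delta>" using j \<delta> by (intro mult_right_mono) auto
    moreover have "real k * \<delta> = t" using k by (simp add: \<delta>_def)
    moreover have sj: "0 \<le> real (Suc j) * \<delta>" using \<delta> by simp
    ultimately have r: "0 \<le> r" "r \<le> t" "real (Suc j) * \<delta> + r = t" unfolding r_def by linarith+
    have m: "(\<lambda>\<omega>. transition r wt (X (real (Suc j) * \<delta>) \<omega>)) \<in> borel_measurable M"
      by (rule measurable_F_M[OF trans_X_measurable[OF wt_measurable sj]])
    have "(\<integral>\<^sup>+\<omega>. wt (X (real (Suc j) * \<delta>) \<omega>) * indicator (A j) \<omega> \<partial>P x)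
        \<le> (\<integral>\<^sup>+\<omega>. ennreal K * (transition r wt (X (real (Suc j) * \<delta>) \<omega>) * indicator (A j) \<omega>) \<partial>P x)"
      using lower[OF X_in_S[OF sj] r(1,2)]
      by (intro nn_integral_mono) (auto simp: space_P x mult.assoc[symmetric] simp del: of_nat_Suc intro!: mult_right_mono)
    also have "\<dots> = ennreal K * (\<integral>\<^sup>+\<omega>. transition r wt (X (real (Suc j) * \<delta>) \<omega>) * indicator (A j) \<omega> \<partial>P x)"
      by (rule nn_integral_cmult)
         (unfold measurable_P_cong[OF x], intro borel_measurable_times_ennreal m borel_measurable_indicator A_meas)
    also have "(\<integral>\<^sup>+\<omega>. transition r wt (X (real (Suc j) * \<delta>) \<omega>) * indicator (A j) \<omega> \<partial>P x)
        = (\<integral>\<^sup>+\<omega>. wt (X (real (Suc j) * \<delta> + r) \<omega>) * indicator (A j) \<omega> \<partial>P x)"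
      by (rule markov_nn[OF x sj r(1) A_F wt_measurable, symmetric])
    finally show ?thesis by (simp only: r(3))
  qed
  then have "(\<Sum>j<k. \<integral>\<^sup>+\<omega>. wt (X (real (Suc j) * \<delta>) \<omega>) * indicator (A j) \<omega> \<partial>P x)
      \<le> (\<Sum>j<k. ennreal K * (\<integral>\<^sup>+\<omega>. wt (X t \<omega>) * indicator (A j) \<omega> \<partial>P x))"
    by (intro sum_mono) auto
  also have "\<dots> = ennreal K * (\<integral>\<^sup>+\<omega>. (\<Sum>j<k. wt (X t \<omega>) * indicator (A j) \<omega>) \<partial>P x)"
    by (subst nn_integral_sum) (unfold measurable_P_cong[OF x], measurable, simp add: sum_distrib_left)
  also have "(\<integral>\<^sup>+\<omega>. (\<Sum>j<k. wt (X t \<omega>) * indicator (A j) \<omega>) \<partial>P x) = (\<integral>\<^sup>+\<omega>. (if T \<omega> < t then wt (X t \<omega>) else 0) \<partial>P x)"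
    using k by (intro nn_integral_cong) (simp add: sum_distrib_left[symmetric] sum_ind space_P x \<delta>_def)
  finally show "(\<Sum>j<k. \<integral>\<^sup>+\<omega>. wt (X (real (Suc j) * (t / real k)) \<omega>)
        * indicator {\<omega> \<in> space M. real j * (t / real k) \<le> T \<omega> \<and> T \<omega> < real (Suc j) * (t / real k)} \<omega> \<partial>P x)
      \<le> ennreal K * (\<integral>\<^sup>+\<omega>. (if T \<omega> < t then wt (X t \<omega>) else 0) \<partial>P x)"
    by (simp add: A_def \<delta>_def del: of_nat_Suc)
qed

end

section \<open>Dynkin's formula for quadratic polynomials\<close>

text \<open>
  A single integrable function dominates, and the events T n < t vanish almost surely.
\<close>

lemma nn_integral_vanishing:
  fixes T :: "nat \<Rightarrow> 'a \<Rightarrow> real"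
  assumes [measurable]: "\<And>n. T n \<in> borel_measurable N" "f \<in> borel_measurable N"
    and lim: "AE \<omega> in N. filterlim (\<lambda>n. T n \<omega>) at_top sequentially"
    and fin: "(\<integral>\<^sup>+\<omega>. f \<omega> \<partial>N) < \<infinity>"
  shows "(\<lambda>n. \<integral>\<^sup>+\<omega>. (if T n \<omega> < t then f \<omega> else 0) \<partial>N) \<longlonglongrightarrow> 0"
proof -
  have "(\<lambda>n. \<integral>\<^sup>+\<omega>. (if T n \<omega> < t then f \<omega> else 0) \<partial>N) \<longlonglongrightarrow> (\<integral>\<^sup>+\<omega>. 0 \<partial>N)"
  proof (rule nn_integral_dominated_convergence[OF _ _ _ _ fin])
    show "AE \<omega> in N. (\<lambda>n. if T n \<omega> < t then f \<omega> else 0) \<longlonglongrightarrow> 0"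
      using lim
    proof eventually_elim
      case (elim \<omega>)
      then have "eventually (\<lambda>n. t \<le> T n \<omega>) sequentially" by (simp add: filterlim_at_top)
      then have "eventually (\<lambda>n. (if T n \<omega> < t then f \<omega> else 0) = 0) sequentially"
        by eventually_elim simp
      then show ?case by (rule tendsto_eventually)
    qed
  qed auto
  then show ?thesis by simp
qed

lemma ennreal_le_wt:
  assumes "a \<le> K * (1 + y\<^sup>2)" "0 \<le> K"
  shows "ennreal a \<le> ennreal K * wt y"
proof -
  have "ennreal a \<le> ennreal (K * (1 + y\<^sup>2))" by (rule ennreal_leI[OF assms(1)])
  also have "\<dots> = ennreal K * wt y" unfolding wt_def by (rule ennreal_mult) (use assms in auto)
  finally show ?thesis .
qed

context markov_process
begin

text \<open>
  The localized formula differs from the true one only on T n < t, where the difference is at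
  most p (X (T n)) in absolute value plus an integrable random variable V that does not depend
  on n. The part with V vanishes by dominated convergence; the part with X (T n) is the real
  obstacle and is the assumption ui.
\<close>

lemma dynkin_formula:
  assumes x: "x \<in> S" and t: "t > 0"
    and gen: "generates S F P X (restrict (poly p) S) (restrict (poly q) S)"
    and C: "C \<ge> 0"
    and growth: "\<And>y r. y \<in> S \<Longrightarrow> 0 \<le> r \<Longrightarrow> transition r wt y \<le> ennreal (exp (C * r)) * wt y"
    and K: "\<And>y. \<bar>poly p y\<bar> \<le> K * (1 + y\<^sup>2)" "\<And>y. \<bar>poly q y\<bar> \<le> K * (1 + y\<^sup>2)"
    and ui: "\<And>(T :: nat \<Rightarrow> 'a \<Rightarrow> real) e. (\<And>n. stopping_time F (T n)) \<Longrightarrow> (\<And>n \<omega>. \<omega> \<in> space M \<Longrightarrow> 0 \<le> T n \<omega>) \<Longrightarrow>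
      (\<And>n. T n \<in> borel_measurable M) \<Longrightarrow> AE \<omega> in P x. filterlim (\<lambda>n. T n \<omega>) at_top sequentially \<Longrightarrow> 0 < e \<Longrightarrow>
      eventually (\<lambda>n. (\<integral>\<^sup>+\<omega>. (if T n \<omega> < t then ennreal \<bar>poly p (X0 (T n \<omega>) \<omega>)\<bar> else 0) \<partial>P x) \<le> ennreal e) sequentially"
  shows "(\<integral>\<omega>. poly p (X0 t \<omega>) \<partial>P x) = poly p x + (LINT s:{0..t}|lborel. (\<integral>\<omega>. poly q (X0 s \<omega>) \<partial>P x))"
proof -
  interpret Px: prob_space "P x" by (rule prob_space_P[OF x])
  interpret lP: pair_sigma_finite lborel "P x" ..
  have pair_cong: "measurable (lborel \<Otimes>\<^sub>M P x) N = measurable (lborel \<Otimes>\<^sub>M M) N" for N :: "'k measure"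
    by (intro measurable_cong_sets sets_pair_measure_cong refl sets_P[OF x])
  have K0: "0 \<le> K" using K(1)[of 0] abs_ge_zero[of "poly p 0"] by simp
  have wt_le: "(\<integral>\<^sup>+\<omega>. wt (X0 s \<omega>) \<partial>P x) \<le> ennreal (exp (C * t)) * wt x" if "0 \<le> s" "s \<le> t" for s
  proof -
    have "(\<integral>\<^sup>+\<omega>. wt (X0 s \<omega>) \<partial>P x) \<le> ennreal (exp (C * s)) * wt x"
      using growth[OF x that(1)] by (simp add: transition_def)
    also have "\<dots> \<le> ennreal (exp (C * t)) * wt x"
      using that C by (intro mult_right_mono ennreal_leI) (auto intro: mult_left_mono)
    finally show ?thesis .
  qed
  have abs_le: "(\<integral>\<^sup>+\<omega>. ennreal \<bar>poly r (X0 s \<omega>)\<bar> \<partial>P x) \<le> ennreal K * (ennreal (exp (C * t)) * wt x)"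
    if r: "\<And>y. \<bar>poly r y\<bar> \<le> K * (1 + y\<^sup>2)" and s: "0 \<le> s" "s \<le> t" for r s
  proof -
    have "(\<integral>\<^sup>+\<omega>. ennreal \<bar>poly r (X0 s \<omega>)\<bar> \<partial>P x) \<le> (\<integral>\<^sup>+\<omega>. ennreal K * wt (X0 s \<omega>) \<partial>P x)"
      by (intro nn_integral_mono ennreal_le_wt r K0)
    also have "\<dots> = ennreal K * (\<integral>\<^sup>+\<omega>. wt (X0 s \<omega>) \<partial>P x)"
      by (rule nn_integral_cmult) (unfold measurable_P_cong[OF x], measurable)
    also have "\<dots> \<le> ennreal K * (ennreal (exp (C * t)) * wt x)"
      by (intro mult_left_mono wt_le s) simp
    finally show ?thesis .
  qed
  have fin: "ennreal K * (ennreal (exp (C * t)) * wt x) < \<infinity>"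
    by (simp add: wt_def ennreal_mult_less_top)
  have int: "integrable (P x) (\<lambda>\<omega>. poly r (X0 s \<omega>))" if "\<And>y. \<bar>poly r y\<bar> \<le> K * (1 + y\<^sup>2)" "0 \<le> s" "s \<le> t" for r s
  proof (rule integrableI_bounded)
    show "(\<lambda>\<omega>. poly r (X0 s \<omega>)) \<in> borel_measurable (P x)" unfolding measurable_P_cong[OF x] by measurable
    show "(\<integral>\<^sup>+\<omega>. ennreal (norm (poly r (X0 s \<omega>))) \<partial>P x) < \<infinity>"
      using le_less_trans[OF abs_le[OF that] fin] by simp
  qed
  define G where "G s \<omega> = indicator {0..t} s * poly q (X0 s \<omega>)" for s \<omega>
  have G_meas: "case_prod G \<in> borel_measurable (lborel \<Otimes>\<^sub>M P x)" unfolding G_def pair_cong by measurable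
  define Z where "Z \<omega> = (\<integral>\<^sup>+s. ennreal \<bar>G s \<omega>\<bar> \<partial>lborel)" for \<omega>
  have Z_meas [measurable]: "Z \<in> borel_measurable M" unfolding Z_def[abs_def] G_def by measurable
  have G_fin: "(\<integral>\<^sup>+s. (\<integral>\<^sup>+\<omega>. ennreal \<bar>G s \<omega>\<bar> \<partial>P x) \<partial>lborel) < \<infinity>"
  proof -
    have "(\<integral>\<^sup>+s. (\<integral>\<^sup>+\<omega>. ennreal \<bar>G s \<omega>\<bar> \<partial>P x) \<partial>lborel)
        \<le> (\<integral>\<^sup>+s. ennreal K * (ennreal (exp (C * t)) * wt x) * indicator {0..t} s \<partial>lborel)"
      using abs_le[OF K(2)] by (intro nn_integral_mono) (auto simp: G_def split: split_indicator)
    also have "\<dots> = ennreal K * (ennreal (exp (C * t)) * wt x) * ennreal t"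
      using t by (subst nn_integral_cmult_indicator) auto
    also have "\<dots> < \<infinity>" using fin by (simp add: ennreal_mult_less_top)
    finally show ?thesis .
  qed
  have G_int: "integrable (lborel \<Otimes>\<^sub>M P x) (case_prod G)"
  proof (rule integrableI_bounded[OF G_meas])
    have "(\<integral>\<^sup>+p. ennreal (norm (case_prod G p)) \<partial>(lborel \<Otimes>\<^sub>M P x)) = (\<integral>\<^sup>+s. (\<integral>\<^sup>+\<omega>. ennreal \<bar>G s \<omega>\<bar> \<partial>P x) \<partial>lborel)"
      using G_meas by (subst Px.nn_integral_fst[symmetric]) (auto simp: case_prod_beta')
    with G_fin show "(\<integral>\<^sup>+p. ennreal (norm (case_prod G p)) \<partial>(lborel \<Otimes>\<^sub>M P x)) < \<infinity>" by simp
  qed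
  have Z_fin: "(\<integral>\<^sup>+\<omega>. Z \<omega> \<partial>P x) < \<infinity>"
  proof -
    have "(\<integral>\<^sup>+\<omega>. Z \<omega> \<partial>P x) = (\<integral>\<^sup>+s. (\<integral>\<^sup>+\<omega>. ennreal \<bar>G s \<omega>\<bar> \<partial>P x) \<partial>lborel)"
      unfolding Z_def using G_meas by (intro lP.Fubini') (simp add: case_prod_beta')
    with G_fin show ?thesis by simp
  qed
  have I_eq: "(LINT r:{0..t}|lborel. poly q (X0 r \<omega>)) = (\<integral>s. G s \<omega> \<partial>lborel)" for \<omega>
    by (simp add: set_lebesgue_integral_def G_def)
  have I_int: "integrable (P x) (\<lambda>\<omega>. LINT r:{0..t}|lborel. poly q (X0 r \<omega>))"
    unfolding I_eq by (rule lP.integrable_snd[OF G_int])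
  have I_mean: "(\<integral>\<omega>. (LINT r:{0..t}|lborel. poly q (X0 r \<omega>)) \<partial>P x) = (LINT s:{0..t}|lborel. (\<integral>\<omega>. poly q (X0 s \<omega>) \<partial>P x))"
  proof -
    have "(\<integral>\<omega>. G s \<omega> \<partial>P x) = indicator {0..t} s * (\<integral>\<omega>. poly q (X0 s \<omega>) \<partial>P x)" for s
      unfolding G_def by (rule integral_mult_right_zero)
    then show ?thesis
      unfolding I_eq lP.Fubini_integral[OF G_int] by (simp add: set_lebesgue_integral_def)
  qed
  have p_int: "integrable (P x) (\<lambda>\<omega>. poly p (X0 t \<omega>))" using t by (intro int K(1)) auto
  have dyn_int: "integrable (P x) (dynkin p q x t)"
    unfolding dynkin_def[abs_def] using p_int I_int by auto
  define E where "E = (\<integral>\<omega>. dynkin p q x t \<omega> \<partial>P x)"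
  have E_eq: "E = (\<integral>\<omega>. poly p (X0 t \<omega>) \<partial>P x) - poly p x - (LINT s:{0..t}|lborel. (\<integral>\<omega>. poly q (X0 s \<omega>) \<partial>P x))"
    unfolding E_def dynkin_def using p_int I_int by (simp add: I_mean Px.prob_space)
  obtain T :: "nat \<Rightarrow> 'a \<Rightarrow> real" where T: "\<And>n. stopping_time F (T n)" "\<And>n \<omega>. \<omega> \<in> space M \<Longrightarrow> 0 \<le> T n \<omega>"
    and T_meas [measurable]: "\<And>n. T n \<in> borel_measurable M"
    and lim: "AE \<omega> in P x. filterlim (\<lambda>n. T n \<omega>) at_top sequentially"
    and mart: "\<And>n. martingale (P x) F (\<lambda>t \<omega>. dynkin p q x (min t (T n \<omega>)) \<omega>)"
      "\<And>n t. 0 \<le> t \<Longrightarrow> (\<integral>\<omega>. dynkin p q x (min t (T n \<omega>)) \<omega> \<partial>P x) = 0"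
    by (rule generates_localized[OF x gen]) (rule that)
  \<comment> \<open>V collects everything in the increment of the Dynkin process over [T n,
      t] except the value of p at time T n\<close>
  define V where "V \<omega> = ennreal \<bar>poly p (X0 t \<omega>)\<bar> + Z \<omega>" for \<omega>
  have V_meas [measurable]: "V \<in> borel_measurable M" unfolding V_def[abs_def] by measurable
  have V_fin: "(\<integral>\<^sup>+\<omega>. V \<omega> \<partial>P x) < \<infinity>"
  proof -
    have "(\<integral>\<^sup>+\<omega>. V \<omega> \<partial>P x) = (\<integral>\<^sup>+\<omega>. ennreal \<bar>poly p (X0 t \<omega>)\<bar> \<partial>P x) + (\<integral>\<^sup>+\<omega>. Z \<omega> \<partial>P x)"
      unfolding V_def by (rule nn_integral_add) (unfold measurable_P_cong[OF x], measurable)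
    also have "\<dots> < \<infinity>" using Z_fin le_less_trans[OF abs_le[OF K(1), of t] fin] t by simp
    finally show ?thesis .
  qed
  define a where "a n = (\<integral>\<^sup>+\<omega>. (if T n \<omega> < t then ennreal \<bar>poly p (X0 (T n \<omega>) \<omega>)\<bar> else 0) \<partial>P x)" for n
  define b where "b n = (\<integral>\<^sup>+\<omega>. (if T n \<omega> < t then V \<omega> else 0) \<partial>P x)" for n
  have path: "ennreal \<bar>dynkin p q x t \<omega> - dynkin p q x (min t (T n \<omega>)) \<omega>\<bar>
      \<le> (if T n \<omega> < t then ennreal \<bar>poly p (X0 (T n \<omega>) \<omega>)\<bar> else 0) + (if T n \<omega> < t then V \<omega> else 0)"
    if \<omega>: "\<omega> \<in> space M" for n \<omega>
  proof (cases "T n \<omega> < t")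
    case True
    note [measurable] = \<omega>
    define r where "r = T n \<omega>"
    have r: "0 \<le> r" "r < t" using True T(2)[OF \<omega>] by (auto simp: r_def)
    obtain B where B: "\<And>s. s \<le> t \<Longrightarrow> \<bar>poly q (X0 s \<omega>)\<bar> \<le> B" using path_poly_bounded[OF \<omega>] by metis
    have si: "set_integrable lborel {0..c} (\<lambda>s. poly q (X0 s \<omega>))" if "c \<le> t" for c
      by (rule set_integrable_bounded[where K = B]) (measurable, rule B, use that in simp)
    define f where "f s = indicator {0..t} s *\<^sub>R poly q (X0 s \<omega>) - indicator {0..r} s *\<^sub>R poly q (X0 s \<omega>)" for s
    have f_int: "integrable lborel f"
      unfolding f_def using si[of t] si[of r] r by (auto simp: set_integrable_def)
    have f_eq: "(LINT s:{0..t}|lborel. poly q (X0 s \<omega>)) - (LINT s:{0..r}|lborel. poly q (X0 s \<omega>)) = (\<integral>s. f s \<partial>lborel)"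
      unfolding f_def set_lebesgue_integral_def using si[of t] si[of r] r
      by (subst Bochner_Integration.integral_diff) (auto simp: set_integrable_def)
    have "ennreal \<bar>\<integral>s. f s \<partial>lborel\<bar> \<le> (\<integral>\<^sup>+s. ennreal \<bar>f s\<bar> \<partial>lborel)"
      using integral_norm_bound_ennreal[OF f_int] by simp
    also have "\<dots> \<le> Z \<omega>"
      unfolding Z_def using r by (intro nn_integral_mono ennreal_leI) (auto simp: f_def G_def split: split_indicator)
    finally have fZ: "ennreal \<bar>\<integral>s. f s \<partial>lborel\<bar> \<le> Z \<omega>" .
    have "\<bar>dynkin p q x t \<omega> - dynkin p q x r \<omega>\<bar> \<le> \<bar>poly p (X0 r \<omega>)\<bar> + (\<bar>poly p (X0 t \<omega>)\<bar> + \<bar>\<integral>s. f s \<partial>lborel\<bar>)"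
      unfolding dynkin_def f_eq[symmetric] by linarith
    then have "ennreal \<bar>dynkin p q x t \<omega> - dynkin p q x r \<omega>\<bar>
        \<le> ennreal \<bar>poly p (X0 r \<omega>)\<bar> + (ennreal \<bar>poly p (X0 t \<omega>)\<bar> + ennreal \<bar>\<integral>s. f s \<partial>lborel\<bar>)"
      by (simp add: ennreal_plus[symmetric] ennreal_leI del: ennreal_plus)
    also have "\<dots> \<le> ennreal \<bar>poly p (X0 r \<omega>)\<bar> + V \<omega>"
      unfolding V_def by (intro add_left_mono fZ)
    finally show ?thesis using True by (simp add: r_def min_def)
  qed (simp add: min_def)
  have E_le: "ennreal \<bar>E\<bar> \<le> a n + b n" for n
  proof -
    have di: "integrable (P x) (\<lambda>\<omega>. dynkin p q x (min t (T n \<omega>)) \<omega>)"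
      using mart(1)[of n] t by (auto simp: martingale_def)
    have "E = (\<integral>\<omega>. dynkin p q x t \<omega> - dynkin p q x (min t (T n \<omega>)) \<omega> \<partial>P x)"
      using mart(2)[of t n] t dyn_int di by (simp add: E_def)
    then have "ennreal \<bar>E\<bar> \<le> (\<integral>\<^sup>+\<omega>. ennreal \<bar>dynkin p q x t \<omega> - dynkin p q x (min t (T n \<omega>)) \<omega>\<bar> \<partial>P x)"
      using integral_norm_bound_ennreal[OF Bochner_Integration.integrable_diff[OF dyn_int di]] by simp
    also have "\<dots> \<le> (\<integral>\<^sup>+\<omega>. (if T n \<omega> < t then ennreal \<bar>poly p (X0 (T n \<omega>) \<omega>)\<bar> else 0) + (if T n \<omega> < t then V \<omega> else 0) \<partial>P x)"
      by (intro nn_integral_mono path) (simp add: space_P x)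
    also have "\<dots> = a n + b n"
      unfolding a_def b_def by (rule nn_integral_add) (unfold measurable_P_cong[OF x], measurable)
    finally show ?thesis .
  qed
  have b_lim: "b \<longlonglongrightarrow> 0"
    unfolding b_def[abs_def] by (rule nn_integral_vanishing[OF _ _ lim V_fin]) (unfold measurable_P_cong[OF x], measurable)
  have "\<bar>E\<bar> \<le> 0 + e" if e: "0 < e" for e
  proof -
    have "eventually (\<lambda>n. a n \<le> ennreal (e / 2)) sequentially"
      unfolding a_def using e by (intro ui T T_meas lim) auto
    moreover have "eventually (\<lambda>n. b n < ennreal (e / 2)) sequentially"
      using b_lim e by (intro order_tendstoD(2)) auto
    ultimately have "eventually (\<lambda>n. ennreal \<bar>E\<bar> \<le> ennreal e) sequentially"
    proof eventually_elim
      case (elim n)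
      have "ennreal \<bar>E\<bar> \<le> ennreal (e / 2) + ennreal (e / 2)"
        using E_le[of n] elim by (meson add_mono less_imp_le order_trans)
      then show ?case using e by (simp add: ennreal_plus[symmetric] del: ennreal_plus)
    qed
    then show ?thesis using e by (auto simp: eventually_sequentially)
  qed
  then have "\<bar>E\<bar> \<le> 0" by (rule field_le_epsilon)
  then show ?thesis using E_eq by simp
qed

text \<open>
  A function of linear growth is at most d * (1 + y^2) + L with d as small as desired. The
  quadratic part is uniformly small by the bound at stopping times, and the constant L is
  handled by the vanishing of the events T n < t.
\<close>

lemma linear_uniformly_integrable:
  assumes x: "x \<in> S" and t: "t > 0" and C: "C \<ge> 0"
    and growth: "\<And>y r. y \<in> S \<Longrightarrow> 0 \<le> r \<Longrightarrow> transition r wt y \<le> ennreal (exp (C * r)) * wt y"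
    and K: "\<And>y. \<bar>poly p y\<bar> \<le> K * (1 + \<bar>y\<bar>)"
    and T: "\<And>n. stopping_time F (T n)" "\<And>n \<omega>. \<omega> \<in> space M \<Longrightarrow> 0 \<le> T n \<omega>"
    and T_meas [measurable]: "\<And>n. T n \<in> borel_measurable M"
    and lim: "AE \<omega> in P x. filterlim (\<lambda>n. T n \<omega>) at_top sequentially" and e: "e > 0"
  shows "eventually (\<lambda>n. (\<integral>\<^sup>+\<omega>. (if T n \<omega> < t then ennreal \<bar>poly p (X0 (T n \<omega>) \<omega>)\<bar> else 0) \<partial>P x) \<le> ennreal e) sequentially"
proof -
  interpret Px: prob_space "P x" by (rule prob_space_P[OF x])
  have K0: "0 \<le> K" using K[of 0] abs_ge_zero[of "poly p 0"] by simp
  define B where "B = exp (C * t) * (1 + x\<^sup>2)"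
  have B: "B > 0" unfolding B_def by (intro mult_pos_pos add_pos_nonneg) auto
  \<comment> \<open>chosen so that the quadratic part contributes e / 2\<close>
  define d where "d = e / (2 * B)"
  have d: "d > 0" using e B by (simp add: d_def)
  \<comment> \<open>the constant left after completing the square in K * \<bar>y\<bar> \<le>
      d * y^2 + K^2 / (4 * d)\<close>
  define L where "L = K + K\<^sup>2 / (4 * d)"
  have L: "L \<ge> 0" using K0 d by (simp add: L_def)
  have le: "\<bar>poly p y\<bar> \<le> d * (1 + y\<^sup>2) + L" for y
  proof -
    have "0 \<le> (2 * d * \<bar>y\<bar> - K)\<^sup>2 / (4 * d)" using d by simp
    also have "\<dots> = d * y\<^sup>2 - K * \<bar>y\<bar> + K\<^sup>2 / (4 * d)"
      using d by (simp add: power2_eq_square field_simps)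
    finally have "K * \<bar>y\<bar> \<le> d * y\<^sup>2 + K\<^sup>2 / (4 * d)" by linarith
    with K[of y] d show ?thesis by (simp add: L_def algebra_simps)
  qed
  have "(\<lambda>n. \<integral>\<^sup>+\<omega>. (if T n \<omega> < t then ennreal L else 0) \<partial>P x) \<longlonglongrightarrow> 0"
    by (rule nn_integral_vanishing[OF _ _ lim])
       (unfold measurable_P_cong[OF x], measurable, simp add: Px.emeasure_space_1)
  then have "eventually (\<lambda>n. (\<integral>\<^sup>+\<omega>. (if T n \<omega> < t then ennreal L else 0) \<partial>P x) < ennreal (e / 2)) sequentially"
    using e by (intro order_tendstoD(2)) auto
  then show ?thesis
  proof eventually_elim
    case (elim n)
    have "(\<integral>\<^sup>+\<omega>. (if T n \<omega> < t then ennreal \<bar>poly p (X0 (T n \<omega>) \<omega>)\<bar> else 0) \<partial>P x)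
        \<le> (\<integral>\<^sup>+\<omega>. ennreal d * (if T n \<omega> < t then wt (X0 (T n \<omega>) \<omega>) else 0) + (if T n \<omega> < t then ennreal L else 0) \<partial>P x)"
      using le d L by (intro nn_integral_mono)
        (auto simp: wt_def ennreal_mult[symmetric] ennreal_plus[symmetric] simp del: ennreal_plus intro!: ennreal_leI)
    also have "\<dots> = ennreal d * (\<integral>\<^sup>+\<omega>. (if T n \<omega> < t then wt (X0 (T n \<omega>) \<omega>) else 0) \<partial>P x)
        + (\<integral>\<^sup>+\<omega>. (if T n \<omega> < t then ennreal L else 0) \<partial>P x)"
      by (subst nn_integral_add, unfold measurable_P_cong[OF x], measurable, subst nn_integral_cmult)
         (unfold measurable_P_cong[OF x], measurable)
    also have "\<dots> \<le> ennreal d * (ennreal (exp (C * t)) * wt x) + ennreal (e / 2)"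
      using elim by (intro add_mono mult_left_mono stopped_wt_le[OF x t T(2) T(1) T_meas C growth]) auto
    also have "ennreal d * (ennreal (exp (C * t)) * wt x) = ennreal (d * B)"
      using d by (simp add: wt_def B_def ennreal_mult)
    also have "d * B = e / 2" using B by (simp add: d_def)
    also have "ennreal (e / 2) + ennreal (e / 2) = ennreal e"
      using e by (simp add: ennreal_plus[symmetric] del: ennreal_plus)
    finally show ?case .
  qed
qed

text \<open>
  For quadratic growth there is no room to spare, so the weight at time T n is replaced by the
  integrable weight at time t, which no longer depends on n.
\<close>

lemma quadratic_uniformly_integrable:
  assumes x: "x \<in> S" and t: "t > 0" and fin: "transition t wt x < \<infinity>"
    and lower: "\<And>y r. y \<in> S \<Longrightarrow> 0 \<le> r \<Longrightarrow> r \<le> t \<Longrightarrow> wt y \<le> ennreal D * transition r wt y"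
    and K: "\<And>y. \<bar>poly p y\<bar> \<le> K * (1 + y\<^sup>2)"
    and T: "\<And>n. stopping_time F (T n)" "\<And>n \<omega>. \<omega> \<in> space M \<Longrightarrow> 0 \<le> T n \<omega>"
    and T_meas [measurable]: "\<And>n. T n \<in> borel_measurable M"
    and lim: "AE \<omega> in P x. filterlim (\<lambda>n. T n \<omega>) at_top sequentially" and e: "e > 0"
  shows "eventually (\<lambda>n. (\<integral>\<^sup>+\<omega>. (if T n \<omega> < t then ennreal \<bar>poly p (X0 (T n \<omega>) \<omega>)\<bar> else 0) \<partial>P x) \<le> ennreal e) sequentially"
proof -
  have K0: "0 \<le> K" using K[of 0] abs_ge_zero[of "poly p 0"] by simp
  define v where "v n = (\<integral>\<^sup>+\<omega>. (if T n \<omega> < t then wt (X0 t \<omega>) else 0) \<partial>P x)" for n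
  have "v \<longlonglongrightarrow> 0"
    unfolding v_def[abs_def] using fin
    by (intro nn_integral_vanishing[OF _ _ lim]) (unfold measurable_P_cong[OF x] transition_def, measurable)
  then have "(\<lambda>n. ennreal K * (ennreal D * v n)) \<longlonglongrightarrow> ennreal K * (ennreal D * 0)"
    by (intro ennreal_tendsto_cmult) auto
  then have "eventually (\<lambda>n. ennreal K * (ennreal D * v n) < ennreal e) sequentially"
    using e by (intro order_tendstoD(2)) auto
  then show ?thesis
  proof eventually_elim
    case (elim n)
    have "(\<integral>\<^sup>+\<omega>. (if T n \<omega> < t then ennreal \<bar>poly p (X0 (T n \<omega>) \<omega>)\<bar> else 0) \<partial>P x)
        \<le> (\<integral>\<^sup>+\<omega>. ennreal K * (if T n \<omega> < t then wt (X0 (T n \<omega>) \<omega>) else 0) \<partial>P x)"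
      using K K0 by (intro nn_integral_mono) (auto intro!: ennreal_le_wt)
    also have "\<dots> = ennreal K * (\<integral>\<^sup>+\<omega>. (if T n \<omega> < t then wt (X0 (T n \<omega>) \<omega>) else 0) \<partial>P x)"
      by (rule nn_integral_cmult) (unfold measurable_P_cong[OF x], measurable)
    also have "\<dots> \<le> ennreal K * (ennreal D * v n)"
      using stopped_wt_le_terminal[OF x t T(2) T(1) T_meas lower, of n] t
      by (intro mult_left_mono) (auto simp: v_def cong: if_cong)
    finally show ?case using elim by simp
  qed
qed

end

section \<open>Linear integral equations\<close>

text \<open>
  Inserting the inequality n times into itself gives h s \<le> H * (K * s) ^ n / fact n.
\<close>

lemma gronwall_zero:
  fixes h :: "real \<Rightarrow> real"
  assumes h [measurable]: "h \<in> borel_measurable borel" and K: "K \<ge> 0"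
    and bd: "\<And>s. 0 \<le> s \<Longrightarrow> s \<le> t \<Longrightarrow> 0 \<le> h s \<and> h s \<le> H"
    and le: "\<And>s. 0 \<le> s \<Longrightarrow> s \<le> t \<Longrightarrow> h s \<le> K * (LINT r:{0..s}|lborel. h r)"
    and s: "0 \<le> s" "s \<le> t"
  shows "h s = 0"
proof -
  have pow: "(LINT r:{0..s}|lborel. r ^ n / fact n) = s ^ Suc n / fact (Suc n)" if "0 \<le> s" for s :: real and n
  proof -
    have "(\<integral>r. (r ^ n / fact n) * indicator {0..s} r \<partial>lborel) = s ^ Suc n / fact (Suc n) - 0 ^ Suc n / fact (Suc n)"
    proof (rule integral_FTC_Icc_nonneg)
      fix r :: real
      have "((\<lambda>s. s ^ Suc n / fact (Suc n)) has_real_derivative (real (Suc n) * r ^ n) / fact (Suc n)) (at r)"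
        using DERIV_cdivide[OF DERIV_pow[of "Suc n" r], of "fact (Suc n)"]
        by (simp del: of_nat_Suc fact_Suc power_Suc)
      then show "((\<lambda>s. s ^ Suc n / fact (Suc n)) has_real_derivative r ^ n / fact n) (at r)"
        by (simp only: fact_Suc of_nat_mult) (simp del: of_nat_Suc power_Suc)
    qed (use that in auto)
    moreover have "(LINT r:{0..s}|lborel. r ^ n / fact n) = (\<integral>r. (r ^ n / fact n) * indicator {0..s} r \<partial>lborel)"
      unfolding set_lebesgue_integral_def by (intro Bochner_Integration.integral_cong) auto
    ultimately show ?thesis by simp
  qed
  have bound: "h s \<le> H * (K ^ n * (s ^ n / fact n))" if "0 \<le> s" "s \<le> t" for n s
    using that
  proof (induction n arbitrary: s)
    case 0 then show ?case using bd by simp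
  next
    case (Suc n)
    have "h s \<le> K * (LINT r:{0..s}|lborel. h r)" by (rule le[OF Suc.prems])
    also have "\<dots> \<le> K * (LINT r:{0..s}|lborel. (H * K ^ n) * (r ^ n / fact n))"
    proof (intro mult_left_mono set_integral_mono K)
      show "set_integrable lborel {0..s} h"
        by (rule set_integrable_bounded[where K = H]) (measurable, use bd Suc.prems in auto)
      show "set_integrable lborel {0..s} (\<lambda>r. (H * K ^ n) * (r ^ n / fact n))"
      proof (intro set_integrable_mult_right set_integrable_bounded[where K = "s ^ n / fact n"])
        show "\<bar>r ^ n / fact n\<bar> \<le> s ^ n / fact n" if "0 \<le> r" "r \<le> s" for r :: real
          using that by (simp add: divide_right_mono power_mono)
      qed measurable
      show "h r \<le> (H * K ^ n) * (r ^ n / fact n)" if "r \<in> {0..s}" for r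
        using Suc.IH[of r] that Suc.prems by (simp add: mult.assoc)
    qed
    also have "(LINT r:{0..s}|lborel. (H * K ^ n) * (r ^ n / fact n)) = (H * K ^ n) * (s ^ Suc n / fact (Suc n))"
      by (simp only: set_integral_mult_right pow[OF Suc.prems(1)])
    also have "K * ((H * K ^ n) * (s ^ Suc n / fact (Suc n))) = H * (K ^ Suc n * (s ^ Suc n / fact (Suc n)))"
      by (simp only: power_Suc mult_ac)
    finally show ?case .
  qed
  have "(\<lambda>n. H * (inverse (fact n) * (K * s) ^ n)) \<longlonglongrightarrow> H * 0"
    by (intro tendsto_mult_left summable_LIMSEQ_zero summable_exp)
  moreover have "h s \<le> H * (inverse (fact n) * (K * s) ^ n)" for n
    using bound[OF s, of n] by (simp add: power_mult_distrib field_simps)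
  ultimately have "h s \<le> 0" using LIMSEQ_le_const[of _ "H * 0" "h s"] by auto
  with bd[OF s] show ?thesis by simp
qed

text \<open>
  The difference of f and the exponential solves the homogeneous equation and is zero by
  gronwall_zero.
\<close>

lemma exponential_integral_equation:
  fixes f :: "real \<Rightarrow> real"
  assumes f [measurable]: "f \<in> borel_measurable borel"
    and bd: "\<And>s. 0 \<le> s \<Longrightarrow> s \<le> t \<Longrightarrow> \<bar>f s\<bar> \<le> H"
    and eq: "\<And>s. 0 \<le> s \<Longrightarrow> s \<le> t \<Longrightarrow> f s = c + (LINT r:{0..s}|lborel. l * f r)"
    and t: "0 \<le> t"
  shows "f t = c * exp (l * t)"
proof -
  define g where "g s = c * exp (l * s)" for s
  have g_meas [measurable]: "g \<in> borel_measurable borel" unfolding g_def[abs_def] by measurable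
  have g_bd: "\<bar>g s\<bar> \<le> \<bar>c\<bar> * exp (\<bar>l\<bar> * t)" if "0 \<le> s" "s \<le> t" for s
  proof -
    have "l * s \<le> \<bar>l\<bar> * t" using that by (meson abs_ge_self abs_ge_zero mult_mono order_trans t)
    then show ?thesis by (simp add: g_def abs_mult mult_left_mono)
  qed
  have g_eq: "g s = c + (LINT r:{0..s}|lborel. l * g r)" if "0 \<le> s" for s
  proof -
    have "(LINT r:{0..s}|lborel. l * g r) = g s - g 0"
      unfolding set_lebesgue_integral_def
      by (rule integral_FTC_Icc)
         (use that in \<open>auto simp: g_def has_real_derivative_iff_has_vector_derivative[symmetric]
            intro!: derivative_eq_intros continuous_intros\<close>)
    moreover have "g 0 = c" by (simp add: g_def)
    ultimately show ?thesis by linarith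
  qed
  define h where "h s = \<bar>f s - g s\<bar>" for s
  have h_meas [measurable]: "h \<in> borel_measurable borel" unfolding h_def[abs_def] by measurable
  define B where "B = H + \<bar>c\<bar> * exp (\<bar>l\<bar> * t)"
  have h_bd: "0 \<le> h s \<and> h s \<le> B" if "0 \<le> s" "s \<le> t" for s
    using bd[OF that] g_bd[OF that] by (auto simp: h_def B_def)
  have int: "set_integrable lborel {0..s} f" "set_integrable lborel {0..s} g" "set_integrable lborel {0..s} h"
    if "s \<le> t" for s
    using that bd g_bd h_bd
    by (auto intro!: set_integrable_bounded[OF f, of _ _ H] set_integrable_bounded[OF g_meas, of _ _ "\<bar>c\<bar> * exp (\<bar>l\<bar> * t)"]
        set_integrable_bounded[OF h_meas, of _ _ B])
  have "h t = 0"
  proof (rule gronwall_zero[OF h_meas _ h_bd, of "\<bar>l\<bar>" t])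
    fix s assume s: "0 \<le> s" "s \<le> t"
    have "f s - g s = l * (LINT r:{0..s}|lborel. f r - g r)"
      using eq[OF s] g_eq[OF s(1)] int[OF s(2)] by (simp add: set_integral_diff(2) right_diff_distrib)
    then have "h s = \<bar>l\<bar> * \<bar>LINT r:{0..s}|lborel. f r - g r\<bar>" by (simp add: h_def abs_mult)
    also have "\<bar>LINT r:{0..s}|lborel. f r - g r\<bar> \<le> (LINT r:{0..s}|lborel. h r)"
      using integral_abs_bound[of lborel "\<lambda>r. indicator {0..s} r *\<^sub>R (f r - g r)"]
      by (simp add: set_lebesgue_integral_def abs_mult h_def)
    finally show "h s \<le> \<bar>l\<bar> * (LINT r:{0..s}|lborel. h r)" by (simp add: mult_left_mono)
  qed (use t in auto)
  then show ?thesis by (simp add: h_def g_def)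
qed

text \<open>
  Uniqueness for systems of linear integral equations: gronwall_zero applies to the sum of the
  absolute values of the components.
\<close>

lemma linear_system_zero:
  fixes z :: "nat \<Rightarrow> real \<Rightarrow> real" and a :: "nat \<Rightarrow> nat \<Rightarrow> real"
  assumes z [measurable]: "\<And>j. z j \<in> borel_measurable borel"
    and bd: "\<And>j s. j \<le> k \<Longrightarrow> 0 \<le> s \<Longrightarrow> s \<le> t \<Longrightarrow> \<bar>z j s\<bar> \<le> H"
    and eq: "\<And>j s. j \<le> k \<Longrightarrow> 0 \<le> s \<Longrightarrow> s \<le> t \<Longrightarrow> z j s = (LINT r:{0..s}|lborel. (\<Sum>i\<le>k. a i j * z i r))"
    and t: "0 \<le> t" and j: "j \<le> k"
  shows "z j t = 0"
proof -
  define A where "A = (\<Sum>i\<le>k. \<Sum>j\<le>k. \<bar>a i j\<bar>)"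
  have A: "\<bar>a i j\<bar> \<le> A" if "i \<le> k" "j \<le> k" for i j
  proof -
    have "\<bar>a i j\<bar> \<le> (\<Sum>j\<le>k. \<bar>a i j\<bar>)" by (rule member_le_sum) (use that in auto)
    also have "\<dots> \<le> A" unfolding A_def
      by (rule member_le_sum[of i _ "\<lambda>i. \<Sum>j\<le>k. \<bar>a i j\<bar>"]) (use that in \<open>auto intro: sum_nonneg\<close>)
    finally show ?thesis .
  qed
  have A0: "0 \<le> A" unfolding A_def by (intro sum_nonneg) auto
  define h where "h s = (\<Sum>j\<le>k. \<bar>z j s\<bar>)" for s
  have h_meas [measurable]: "h \<in> borel_measurable borel" unfolding h_def[abs_def] by measurable
  have h_bd: "0 \<le> h s \<and> h s \<le> real (Suc k) * H" if "0 \<le> s" "s \<le> t" for s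
  proof -
    have "h s \<le> (\<Sum>j\<le>k. H)" unfolding h_def by (intro sum_mono bd that) simp
    then show ?thesis by (auto simp: h_def intro: sum_nonneg)
  qed
  have "h t = 0"
  proof (rule gronwall_zero[OF h_meas _ h_bd, of "real (Suc k) * A" t])
    fix s assume s: "0 \<le> s" "s \<le> t"
    have h_int: "set_integrable lborel {0..s} h"
      by (rule set_integrable_bounded[OF h_meas, of _ _ "real (Suc k) * H"]) (use h_bd s in auto)
    have "\<bar>z j s\<bar> \<le> A * (LINT r:{0..s}|lborel. h r)" if j: "j \<le> k" for j
    proof -
      have row: "\<bar>\<Sum>i\<le>k. a i j * z i r\<bar> \<le> A * h r" for r
      proof -
        have "\<bar>\<Sum>i\<le>k. a i j * z i r\<bar> \<le> (\<Sum>i\<le>k. \<bar>a i j * z i r\<bar>)" by (rule sum_abs)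
        also have "\<dots> \<le> (\<Sum>i\<le>k. A * \<bar>z i r\<bar>)"
          using A j by (intro sum_mono) (auto simp: abs_mult intro!: mult_right_mono)
        finally show ?thesis by (simp add: h_def sum_distrib_left)
      qed
      have "\<bar>z j s\<bar> \<le> (LINT r:{0..s}|lborel. \<bar>\<Sum>i\<le>k. a i j * z i r\<bar>)"
        unfolding eq[OF j s]
        using integral_abs_bound[of lborel "\<lambda>r. indicator {0..s} r *\<^sub>R (\<Sum>i\<le>k. a i j * z i r)"]
        by (simp add: set_lebesgue_integral_def abs_mult)
      also have "\<dots> \<le> (LINT r:{0..s}|lborel. A * h r)"
      proof (rule set_integral_mono)
        show "\<bar>\<Sum>i\<le>k. a i j * z i r\<bar> \<le> A * h r" for r by (rule row)
        show "set_integrable lborel {0..s} (\<lambda>r. \<bar>\<Sum>i\<le>k. a i j * z i r\<bar>)"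
        proof (rule set_integrable_bounded[where K = "A * (real (Suc k) * H)"])
          fix r assume "0 \<le> r" "r \<le> s"
          with h_bd[of r] s have "h r \<le> real (Suc k) * H" by auto
          then have "A * h r \<le> A * (real (Suc k) * H)" by (intro mult_left_mono A0)
          with row[of r] show "\<bar>\<bar>\<Sum>i\<le>k. a i j * z i r\<bar>\<bar> \<le> A * (real (Suc k) * H)"
            unfolding abs_idempotent by (rule order_trans)
        qed measurable
        show "set_integrable lborel {0..s} (\<lambda>r. A * h r)" by (intro set_integrable_mult_right impI h_int)
      qed
      finally show ?thesis by simp
    qed
    then have "h s \<le> (\<Sum>j\<le>k. A * (LINT r:{0..s}|lborel. h r))" unfolding h_def by (intro sum_mono) auto
    then show "h s \<le> real (Suc k) * A * (LINT r:{0..s}|lborel. h r)" by (simp add: mult.assoc)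
  qed (use t A0 in auto)
  then show ?thesis using j by (simp add: h_def sum_nonneg_eq_0_iff)
qed

lemma poly_degree_le_2:
  fixes p :: "real poly"
  assumes "degree p \<le> 2"
  shows "poly p y = coeff p 0 + coeff p 1 * y + coeff p 2 * y\<^sup>2"
proof -
  have "poly p y = (\<Sum>i\<le>2. coeff p i * y ^ i)"
    unfolding poly_altdef using assms by (intro sum.mono_neutral_left) (auto simp: coeff_eq_0)
  then show ?thesis by (simp add: numeral_2_eq_2)
qed

lemma quadratic_abs_bound:
  fixes p :: "real poly"
  assumes "degree p \<le> 2"
  shows "\<bar>poly p y\<bar> \<le> (\<bar>coeff p 0\<bar> + \<bar>coeff p 1\<bar> + \<bar>coeff p 2\<bar>) * (1 + y\<^sup>2)"
proof -
  have "0 \<le> (\<bar>y\<bar> - 1)\<^sup>2" by simp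
  then have y: "\<bar>y\<bar> \<le> 1 + y\<^sup>2" by (simp add: power2_diff)
  have "\<bar>poly p y\<bar> \<le> \<bar>coeff p 0\<bar> * 1 + \<bar>coeff p 1\<bar> * \<bar>y\<bar> + \<bar>coeff p 2\<bar> * y\<^sup>2"
  proof -
    have "\<bar>coeff p 1 * y\<bar> = \<bar>coeff p 1\<bar> * \<bar>y\<bar>" "\<bar>coeff p 2 * y\<^sup>2\<bar> = \<bar>coeff p 2\<bar> * y\<^sup>2"
      by (simp_all add: abs_mult)
    then show ?thesis unfolding poly_degree_le_2[OF assms] by linarith
  qed
  also have "\<dots> \<le> \<bar>coeff p 0\<bar> * (1 + y\<^sup>2) + \<bar>coeff p 1\<bar> * (1 + y\<^sup>2) + \<bar>coeff p 2\<bar> * (1 + y\<^sup>2)"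
    using y by (intro add_mono mult_left_mono) auto
  finally show ?thesis by (simp add: algebra_simps)
qed

section \<open>Conditional moments of polynomial processes\<close>

locale quadratic_process = markov_process M F S P X
  for M :: "'a measure" and F :: "real \<Rightarrow> 'a measure" and S P X +
  fixes \<G> :: "(real \<Rightarrow> real) \<Rightarrow> (real \<Rightarrow> real)"
  assumes generator: "extended_generator S F P X \<G>"
    and polynomial: "polynomial_process 2 S F P X \<G>"
begin

lemma generator_poly:
  assumes "degree p \<le> k" "k \<in> {1..2}"
  obtains q where "degree q \<le> k" "\<G> (restrict (poly p) S) = restrict (poly q) S"
    "generates S F P X (restrict (poly p) S) (restrict (poly q) S)"
proof -
  have "restrict (poly p) S \<in> polys S k" using assms by (auto simp: polys_def)
  then have dom: "restrict (poly p) S \<in> generator_domain S F P X"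
    and img: "\<G> (restrict (poly p) S) \<in> polys S k"
    using polynomial assms(2) unfolding polynomial_process_def by blast+
  from img obtain q where q: "degree q \<le> k" "\<G> (restrict (poly p) S) = restrict (poly q) S"
    by (auto simp: polys_def)
  moreover have "generates S F P X (restrict (poly p) S) (\<G> (restrict (poly p) S))"
    using generator dom unfolding extended_generator_def by blast
  ultimately show ?thesis using that by metis
qed

text \<open>
  The generator maps 1 + y^2 to a polynomial of degree at most two, hence to at most C * (1 +
  y^2).
\<close>

lemma growth_bound:
  obtains C where "C \<ge> 0"
    "\<And>y r. y \<in> S \<Longrightarrow> 0 \<le> r \<Longrightarrow> transition r wt y \<le> ennreal (exp (C * r)) * wt y"
proof -
  define p :: "real poly" where "p = [:1, 0, 1:]"
  have p: "poly p y = 1 + y\<^sup>2" for y by (simp add: p_def power2_eq_square)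
  have "degree p \<le> 2" by (simp add: p_def)
  then obtain q where q: "degree q \<le> 2" "generates S F P X (restrict (poly p) S) (restrict (poly q) S)"
    by (rule generator_poly) auto
  define C where "C = \<bar>coeff q 0\<bar> + \<bar>coeff q 1\<bar> + \<bar>coeff q 2\<bar>"
  have C: "C \<ge> 0" by (simp add: C_def)
  have wt: "wt = (\<lambda>y. ennreal (poly p y))" by (simp add: wt_def p fun_eq_iff)
  have "transition r wt y \<le> ennreal (exp (C * r)) * wt y" if "y \<in> S" "0 \<le> r" for y r
  proof -
    have "transition r wt y \<le> ennreal (exp (C * r) * poly p y)"
      unfolding wt
    proof (rule trans_exp_bound[OF that(1) q(2) C that(2)])
      show "0 \<le> poly p y" for y by (simp add: p)
      show "poly q y \<le> C * poly p y" for y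
        using quadratic_abs_bound[OF q(1), of y] by (simp add: p C_def)
    qed
    then show ?thesis by (simp add: wt_def p ennreal_mult)
  qed
  with C show ?thesis by (rule that)
qed

lemma trans_wt_finite: "x \<in> S \<Longrightarrow> 0 \<le> t \<Longrightarrow> transition t wt x < \<infinity>"
proof -
  assume x: "x \<in> S" "0 \<le> t"
  obtain C where "C \<ge> 0" "\<And>y r. y \<in> S \<Longrightarrow> 0 \<le> r \<Longrightarrow> transition r wt y \<le> ennreal (exp (C * r)) * wt y"
    by (rule growth_bound) (rule that)
  then have "transition t wt x \<le> ennreal (exp (C * t)) * wt x" using x by blast
  also have "\<dots> < \<infinity>" by (simp add: wt_def ennreal_mult_less_top)
  finally show ?thesis .
qed

lemma integrable_poly:
  assumes x: "x \<in> S" and p: "degree p \<le> 2" and t: "0 \<le> t"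
  shows "integrable (P x) (\<lambda>\<omega>. poly p (X0 t \<omega>))"
proof (rule integrableI_bounded)
  show "(\<lambda>\<omega>. poly p (X0 t \<omega>)) \<in> borel_measurable (P x)" unfolding measurable_P_cong[OF x] by measurable
  define K where "K = \<bar>coeff p 0\<bar> + \<bar>coeff p 1\<bar> + \<bar>coeff p 2\<bar>"
  have K: "K \<ge> 0" by (simp add: K_def)
  have "(\<integral>\<^sup>+\<omega>. ennreal (norm (poly p (X0 t \<omega>))) \<partial>P x) \<le> (\<integral>\<^sup>+\<omega>. ennreal K * wt (X0 t \<omega>) \<partial>P x)"
    unfolding real_norm_def by (intro nn_integral_mono ennreal_le_wt K quadratic_abs_bound[OF p, folded K_def])
  also have "\<dots> = ennreal K * transition t wt x"
    unfolding transition_def by (rule nn_integral_cmult) (unfold measurable_P_cong[OF x], measurable)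
  also have "\<dots> < \<infinity>" using trans_wt_finite[OF x t] by (simp add: ennreal_mult_less_top)
  finally show "(\<integral>\<^sup>+\<omega>. ennreal (norm (poly p (X0 t \<omega>))) \<partial>P x) < \<infinity>" .
qed

definition mean :: "real poly \<Rightarrow> real \<Rightarrow> real \<Rightarrow> real" where
  "mean p t x = (\<integral>\<omega>. poly p (X0 t \<omega>) \<partial>P x)"

lemma mean_0: "x \<in> S \<Longrightarrow> mean p 0 x = poly p x"
proof -
  assume x: "x \<in> S"
  interpret Px: prob_space "P x" by (rule prob_space_P[OF x])
  have "mean p 0 x = (\<integral>\<omega>. poly p x \<partial>P x)"
    unfolding mean_def
    by (rule integral_cong_AE)
       (unfold measurable_P_cong[OF x], measurable, use initial[OF x] in \<open>auto elim!: eventually_mono\<close>)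
  then show ?thesis by (simp add: Px.prob_space)
qed

lemma mean_measurable:
  assumes x: "x \<in> S"
  shows "(\<lambda>t. mean p t x) \<in> borel_measurable borel"
proof -
  interpret Px: prob_space "P x" by (rule prob_space_P[OF x])
  have cong: "measurable (borel \<Otimes>\<^sub>M P x) (borel :: real measure) = measurable ((borel :: real measure) \<Otimes>\<^sub>M M) borel"
    by (intro measurable_cong_sets sets_pair_measure_cong refl sets_P[OF x])
  have "(\<lambda>(t, \<omega>). poly p (X0 t \<omega>)) \<in> borel_measurable (borel \<Otimes>\<^sub>M P x)"
    unfolding cong by measurable
  then show ?thesis unfolding mean_def by (rule Px.borel_measurable_lebesgue_integral)
qed

lemma mean_abs_le:
  assumes x: "x \<in> S" and p: "degree p \<le> 2"
  obtains H where "\<And>s. 0 \<le> s \<Longrightarrow> s \<le> t \<Longrightarrow> \<bar>mean p s x\<bar> \<le> H"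
proof -
  obtain C where C: "C \<ge> 0" "\<And>y r. y \<in> S \<Longrightarrow> 0 \<le> r \<Longrightarrow> transition r wt y \<le> ennreal (exp (C * r)) * wt y"
    by (rule growth_bound) (rule that)
  define K where "K = \<bar>coeff p 0\<bar> + \<bar>coeff p 1\<bar> + \<bar>coeff p 2\<bar>"
  have K: "K \<ge> 0" by (simp add: K_def)
  define H where "H = K * (exp (C * t) * (1 + x\<^sup>2))"
  have H0: "0 \<le> H" using K by (simp add: H_def)
  have "\<bar>mean p s x\<bar> \<le> H" if s: "0 \<le> s" "s \<le> t" for s
  proof -
    have "ennreal \<bar>mean p s x\<bar> \<le> (\<integral>\<^sup>+\<omega>. ennreal (norm (poly p (X0 s \<omega>))) \<partial>P x)"
      unfolding mean_def using integral_norm_bound_ennreal[OF integrable_poly[OF x p s(1)]] by simp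
    also have "\<dots> \<le> (\<integral>\<^sup>+\<omega>. ennreal K * wt (X0 s \<omega>) \<partial>P x)"
      unfolding real_norm_def by (intro nn_integral_mono ennreal_le_wt K quadratic_abs_bound[OF p, folded K_def])
    also have "\<dots> = ennreal K * transition s wt x"
      unfolding transition_def by (rule nn_integral_cmult) (unfold measurable_P_cong[OF x], measurable)
    also have "\<dots> \<le> ennreal K * (ennreal (exp (C * t)) * wt x)"
    proof (intro mult_left_mono order_trans[OF C(2)[OF x s(1)]] mult_right_mono ennreal_leI)
      show "exp (C * s) \<le> exp (C * t)" using C(1) s by (simp add: mult_left_mono)
    qed auto
    also have "\<dots> = ennreal H"
      using K by (simp only: H_def wt_def ennreal_mult mult_nonneg_nonneg exp_ge_zero add_nonneg_nonneg zero_le_one zero_le_power2)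
    finally show ?thesis using H0 by simp
  qed
  then show ?thesis by (rule that)
qed

text \<open>
  Dynkin's formula in degree one, where the growth bound gives the uniform integrability.
\<close>

lemma mean_linear_equation:
  assumes x: "x \<in> S" and t: "0 \<le> t" and p: "degree p \<le> 1"
    and gen: "generates S F P X (restrict (poly p) S) (restrict (poly q) S)" and q: "degree q \<le> 2"
  shows "mean p t x = poly p x + (LINT s:{0..t}|lborel. mean q s x)"
proof (cases "t = 0")
  case True
  have "(LINT s:{0}|lborel. mean q s x) = 0"
    unfolding set_lebesgue_integral_def
    by (rule integral_eq_zero_AE) (use AE_lborel_singleton[of "0::real"] in \<open>auto elim!: eventually_mono\<close>)
  with True show ?thesis using mean_0[OF x] by simp
next
  case False
  with t have t: "0 < t" by simp
  obtain C where C: "C \<ge> 0" "\<And>y r. y \<in> S \<Longrightarrow> 0 \<le> r \<Longrightarrow> transition r wt y \<le> ennreal (exp (C * r)) * wt y"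
    by (rule growth_bound) (rule that)
  have p2: "degree p \<le> 2" using p by simp
  define K where "K = \<bar>coeff p 0\<bar> + \<bar>coeff p 1\<bar> + \<bar>coeff p 2\<bar> + \<bar>coeff q 0\<bar> + \<bar>coeff q 1\<bar> + \<bar>coeff q 2\<bar>"
  have K: "\<bar>poly p y\<bar> \<le> K * (1 + y\<^sup>2)" "\<bar>poly q y\<bar> \<le> K * (1 + y\<^sup>2)" for y
    by (rule order_trans[OF quadratic_abs_bound], rule p2 q, rule mult_right_mono, simp add: K_def, simp)+
  have lin: "\<bar>poly p y\<bar> \<le> (\<bar>coeff p 0\<bar> + \<bar>coeff p 1\<bar>) * (1 + \<bar>y\<bar>)" for y
  proof -
    have "poly p y = coeff p 0 + coeff p 1 * y" using poly_degree_le_2[OF p2, of y] p by (simp add: coeff_eq_0)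
    also have "\<bar>\<dots>\<bar> \<le> \<bar>coeff p 0\<bar> + \<bar>coeff p 1\<bar> * \<bar>y\<bar>" by (metis abs_mult abs_triangle_ineq)
    also have "\<dots> \<le> (\<bar>coeff p 0\<bar> + \<bar>coeff p 1\<bar>) * (1 + \<bar>y\<bar>)" by (simp add: algebra_simps)
    finally show ?thesis .
  qed
  show ?thesis
    unfolding mean_def
    by (rule dynkin_formula[OF x t gen C K], assumption, assumption,
        rule linear_uniformly_integrable[OF x t C lin])
qed

text \<open>
  Dynkin's formula in degree two, given that the weight does not decay too fast in the mean.
  That assumption is derived below from the formula in degree one.
\<close>

lemma mean_quadratic_equation:
  assumes x: "x \<in> S" and t: "0 \<le> t" and p: "degree p \<le> 2"
    and gen: "generates S F P X (restrict (poly p) S) (restrict (poly q) S)" and q: "degree q \<le> 2"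
    and lower: "\<And>t. 0 < t \<Longrightarrow> \<exists>D. \<forall>y\<in>S. \<forall>r. 0 \<le> r \<longrightarrow> r \<le> t \<longrightarrow> wt y \<le> ennreal D * transition r wt y"
  shows "mean p t x = poly p x + (LINT s:{0..t}|lborel. mean q s x)"
proof (cases "t = 0")
  case True
  have "(LINT s:{0}|lborel. mean q s x) = 0"
    unfolding set_lebesgue_integral_def
    by (rule integral_eq_zero_AE) (use AE_lborel_singleton[of "0::real"] in \<open>auto elim!: eventually_mono\<close>)
  with True show ?thesis using mean_0[OF x] by simp
next
  case False
  with t have t: "0 < t" by simp
  obtain C where C: "C \<ge> 0" "\<And>y r. y \<in> S \<Longrightarrow> 0 \<le> r \<Longrightarrow> transition r wt y \<le> ennreal (exp (C * r)) * wt y"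
    by (rule growth_bound) (rule that)
  from lower[OF t] obtain D where D: "\<And>y r. y \<in> S \<Longrightarrow> 0 \<le> r \<Longrightarrow> r \<le> t \<Longrightarrow> wt y \<le> ennreal D * transition r wt y"
    by blast
  define K where "K = \<bar>coeff p 0\<bar> + \<bar>coeff p 1\<bar> + \<bar>coeff p 2\<bar> + \<bar>coeff q 0\<bar> + \<bar>coeff q 1\<bar> + \<bar>coeff q 2\<bar>"
  have K: "\<bar>poly p y\<bar> \<le> K * (1 + y\<^sup>2)" "\<bar>poly q y\<bar> \<le> K * (1 + y\<^sup>2)" for y
    by (rule order_trans[OF quadratic_abs_bound], rule p q, rule mult_right_mono, simp add: K_def, simp)+
  show ?thesis
    unfolding mean_def
    by (rule dynkin_formula[OF x t gen C K], assumption, assumption,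
        rule quadratic_uniformly_integrable[OF x t trans_wt_finite[OF x less_imp_le[OF t]] D K(1)])
qed

text \<open>
  The matrix of the generator turns Dynkin's formula into a linear system for the means of the
  basis functions. The formula itself is passed as the assumption eq, so that the degrees one
  and two are treated together.
\<close>

lemma mean_generator_basis:
  assumes A: "generator_matrix S \<G> k B A" and k: "k \<in> {1..2}"
    and eq: "\<And>p q x t. degree p \<le> k \<Longrightarrow> degree q \<le> k \<Longrightarrow> x \<in> S \<Longrightarrow> 0 \<le> t \<Longrightarrow>
      generates S F P X (restrict (poly p) S) (restrict (poly q) S) \<Longrightarrow>
      mean p t x = poly p x + (LINT s:{0..t}|lborel. mean q s x)"
  obtains p where "\<And>j. j \<le> k \<Longrightarrow> degree (p j) \<le> k" "\<And>j x. j \<le> k \<Longrightarrow> x \<in> S \<Longrightarrow> B j x = poly (p j) x"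
    "\<And>j x t. j \<le> k \<Longrightarrow> x \<in> S \<Longrightarrow> 0 \<le> t \<Longrightarrow>
      mean (p j) t x = poly (p j) x + (LINT s:{0..t}|lborel. (\<Sum>i\<le>k. A $$ (i, j) * mean (p i) s x))"
proof -
  have "\<forall>j\<le>k. \<exists>p. degree p \<le> k \<and> B j = restrict (poly p) S"
    using A unfolding generator_matrix_def polys_basis_def polys_def by blast
  then obtain p where p: "\<And>j. j \<le> k \<Longrightarrow> degree (p j) \<le> k" "\<And>j. j \<le> k \<Longrightarrow> B j = restrict (poly (p j)) S"
    by metis
  show ?thesis
  proof (rule that[of p])
    show "degree (p j) \<le> k" if "j \<le> k" for j by (rule p(1)[OF that])
    show "B j x = poly (p j) x" if "j \<le> k" "x \<in> S" for j x using p(2)[OF that(1)] that(2) by simp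
    fix j x and t :: real assume j: "j \<le> k" and x: "x \<in> S" and t: "0 \<le> t"
    obtain q where q: "degree q \<le> k" "\<G> (restrict (poly (p j)) S) = restrict (poly q) S"
        "generates S F P X (restrict (poly (p j)) S) (restrict (poly q) S)"
      by (rule generator_poly[OF p(1)[OF j] k]) (rule that)
    have q_eq: "poly q y = (\<Sum>i\<le>k. A $$ (i, j) * poly (p i) y)" if y: "y \<in> S" for y
    proof -
      have "\<G> (B j) y = (\<Sum>i\<le>k. A $$ (i, j) * B i y)" using A j y unfolding generator_matrix_def by blast
      then show ?thesis using q(2) p(2) j y by simp
    qed
    have "mean q s x = (\<Sum>i\<le>k. A $$ (i, j) * mean (p i) s x)" if s: "0 \<le> s" for s
    proof -
      have "mean q s x = (\<integral>\<omega>. (\<Sum>i\<le>k. A $$ (i, j) * poly (p i) (X0 s \<omega>)) \<partial>P x)"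
        unfolding mean_def
        by (intro Bochner_Integration.integral_cong refl) (simp add: q_eq X0_in_S space_P x del: X0_eq)
      also have "\<dots> = (\<Sum>i\<le>k. (\<integral>\<omega>. A $$ (i, j) * poly (p i) (X0 s \<omega>) \<partial>P x))"
        using p(1) k by (intro Bochner_Integration.integral_sum integrable_mult_right integrable_poly x s)
          (auto intro: order_trans)
      finally show ?thesis by (simp add: mean_def)
    qed
    then have "(LINT s:{0..t}|lborel. mean q s x) = (LINT s:{0..t}|lborel. (\<Sum>i\<le>k. A $$ (i, j) * mean (p i) s x))"
      by (intro set_lebesgue_integral_cong) auto
    with eq[OF p(1)[OF j] q(1) x t q(3)]
    show "mean (p j) t x = poly (p j) x + (LINT s:{0..t}|lborel. (\<Sum>i\<le>k. A $$ (i, j) * mean (p i) s x))" by simp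
  qed
qed

end

text \<open>
  A real eigenvalue of a real matrix that is found in the complex spectrum is a root of the real
  characteristic polynomial and therefore has a real eigenvector.
\<close>

lemma real_eigenvector:
  fixes A :: "real mat"
  assumes A: "A \<in> carrier_mat (Suc k) (Suc k)" and l: "complex_of_real l \<in> complex_spectrum A"
  obtains v where "\<exists>j\<le>k. v j \<noteq> 0" "\<And>i. i \<le> k \<Longrightarrow> (\<Sum>j\<le>k. A $$ (i, j) * v j) = l * v i"
proof -
  have "map_mat complex_of_real A \<in> carrier_mat (Suc k) (Suc k)" using A by simp
  then have "poly (char_poly (map_mat complex_of_real A)) (complex_of_real l) = 0"
    using l by (simp add: complex_spectrum_def spectrum_def eigenvalue_root_char_poly)
  also have "char_poly (map_mat complex_of_real A) = map_poly complex_of_real (char_poly A)"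
    by (rule of_real_hom.char_poly_hom[OF A])
  finally have "poly (char_poly A) l = 0" by simp
  then obtain w where w: "eigenvector A w l"
    using eigenvalue_root_char_poly[OF A] by (auto simp: eigenvalue_def)
  have dim: "w \<in> carrier_vec (Suc k)" and w0: "w \<noteq> 0\<^sub>v (Suc k)" and ev: "A *\<^sub>v w = l \<cdot>\<^sub>v w"
    using w A by (auto simp: eigenvector_def)
  show ?thesis
  proof (rule that[of "\<lambda>j. w $ j"])
    show "\<exists>j\<le>k. w $ j \<noteq> 0"
    proof (rule ccontr)
      assume "\<not> (\<exists>j\<le>k. w $ j \<noteq> 0)"
      then have "w = 0\<^sub>v (Suc k)" using dim by (intro eq_vecI) auto
      with w0 show False ..
    qed
    fix i assume i: "i \<le> k"
    have "(A *\<^sub>v w) $ i = (l \<cdot>\<^sub>v w) $ i" by (simp add: ev)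
    moreover have "(A *\<^sub>v w) $ i = (\<Sum>j<Suc k. A $$ (i, j) * w $ j)"
      using i A dim by (simp add: scalar_prod_def lessThan_atLeast0)
    ultimately show "(\<Sum>j\<le>k. A $$ (i, j) * w $ j) = l * w $ i"
      using i dim by (simp add: lessThan_Suc_atMost)
  qed
qed

text \<open>
  Lagrange interpolation at the nodes a - h, a and a + h.
\<close>

lemma quadratic_interpolation:
  fixes q :: "real poly" and a h u x :: real
  assumes q: "degree q \<le> 2" and x: "x = a + h * u"
  shows "poly q x = u * (u - 1) / 2 * poly q (a - h) + (1 - u\<^sup>2) * poly q a + u * (u + 1) / 2 * poly q (a + h)"
  unfolding poly_degree_le_2[OF q] x by (simp add: power2_eq_square field_simps)

context quadratic_process
begin

lemma mean_add:
  assumes "x \<in> S" "0 \<le> t" "degree p \<le> 2" "degree q \<le> 2"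
  shows "mean (p + q) t x = mean p t x + mean q t x" "mean (p - q) t x = mean p t x - mean q t x"
  unfolding mean_def using assms by (simp_all add: integrable_poly del: X0_eq)

lemma mean_smult: "mean (Polynomial.smult c p) t x = c * mean p t x"
  unfolding mean_def by simp

lemma mean_sum:
  assumes "x \<in> S" "0 \<le> t" "\<And>j. j \<le> k \<Longrightarrow> degree (p j) \<le> 2"
  shows "mean (\<Sum>j\<le>k. Polynomial.smult (c j) (p j)) t x = (\<Sum>j\<le>k. c j * mean (p j) t x)"
proof -
  have "mean (\<Sum>j\<le>k. Polynomial.smult (c j) (p j)) t x = (\<integral>\<omega>. (\<Sum>j\<le>k. c j * poly (p j) (X0 t \<omega>)) \<partial>P x)"
    unfolding mean_def by (simp add: poly_sum)
  also have "\<dots> = (\<Sum>j\<le>k. (\<integral>\<omega>. c j * poly (p j) (X0 t \<omega>) \<partial>P x))"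
    using assms by (intro Bochner_Integration.integral_sum integrable_mult_right integrable_poly) auto
  finally show ?thesis by (simp add: mean_def)
qed

lemma mean_const: "x \<in> S \<Longrightarrow> mean [:c:] t x = c"
  using prob_space.prob_space[OF prob_space_P] unfolding mean_def by simp

lemma mean_cong:
  assumes "x \<in> S" "\<And>y. y \<in> S \<Longrightarrow> poly p y = poly q y"
  shows "mean p t x = mean q t x"
  unfolding mean_def by (intro Bochner_Integration.integral_cong refl) (simp add: assms X0_in_S space_P)

lemma limiting_mean:
  assumes mu: "limiting 2 S P X \<mu>" and p: "degree p \<le> 2" and x: "x \<in> S"
  shows "((\<lambda>t. mean p t x) \<longlongrightarrow> (\<integral>y. poly p y \<partial>\<mu>)) at_top" "integrable \<mu> (poly p)"
proof -
  have space: "space \<mu> = S"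
    using mu sets_eq_imp_space_eq[of \<mu> "restrict_space borel S"] by (simp add: limiting_def space_restrict_space)
  have "restrict (poly p) S \<in> polys S 2" using p by (auto simp: polys_def)
  with mu x have lim: "((\<lambda>t. \<integral>\<omega>. restrict (poly p) S (X t \<omega>) \<partial>P x) \<longlongrightarrow> (\<integral>y. restrict (poly p) S y \<partial>\<mu>)) at_top"
    and int: "integrable \<mu> (restrict (poly p) S)" unfolding limiting_def by blast+
  have eq: "(\<integral>y. restrict (poly p) S y \<partial>\<mu>) = (\<integral>y. poly p y \<partial>\<mu>)"
    by (rule Bochner_Integration.integral_cong) (auto simp: space)
  have "eventually (\<lambda>t. (\<integral>\<omega>. restrict (poly p) S (X t \<omega>) \<partial>P x) = mean p t x) at_top"
    using eventually_ge_at_top[of 0]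
    by eventually_elim (auto simp: mean_def X_in_S space_P x intro!: Bochner_Integration.integral_cong)
  then show "((\<lambda>t. mean p t x) \<longlongrightarrow> (\<integral>y. poly p y \<partial>\<mu>)) at_top"
    using lim unfolding eq by (rule Lim_transform_eventually[rotated])
  show "integrable \<mu> (poly p)"
    using int by (rule Bochner_Integration.integrable_cong[THEN iffD1, rotated 2]) (auto simp: space)
qed

text \<open>
  An eigenvector of the matrix is the coefficient vector of a polynomial u. The linear system
  for the means of the basis functions then gives the scalar integral equation of the
  exponential function for the mean of u. Linear independence of the basis keeps the polynomial
  from vanishing on S.
\<close>

lemma eigenfunction:
  assumes A: "generator_matrix S \<G> 1 B A" and l: "complex_of_real l \<in> complex_spectrum A"
  obtains u where "degree u \<le> 1" "\<exists>x\<in>S. poly u x \<noteq> 0"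
    "\<And>x t. x \<in> S \<Longrightarrow> 0 \<le> t \<Longrightarrow> mean u t x = poly u x * exp (l * t)"
proof -
  have "A \<in> carrier_mat (Suc 1) (Suc 1)" using A by (simp add: generator_matrix_def)
  then obtain v where v: "\<exists>j\<le>1. v j \<noteq> 0" "\<And>i. i \<le> 1 \<Longrightarrow> (\<Sum>j\<le>1. A $$ (i, j) * v j) = l * v i"
    by (rule real_eigenvector[OF _ l]) (rule that)
  obtain p where p: "\<And>j. j \<le> 1 \<Longrightarrow> degree (p j) \<le> 1" "\<And>j x. j \<le> 1 \<Longrightarrow> x \<in> S \<Longrightarrow> B j x = poly (p j) x"
    and eq: "\<And>j x t. j \<le> 1 \<Longrightarrow> x \<in> S \<Longrightarrow> 0 \<le> t \<Longrightarrow>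
      mean (p j) t x = poly (p j) x + (LINT s:{0..t}|lborel. (\<Sum>i\<le>1. A $$ (i, j) * mean (p i) s x))"
  proof (rule mean_generator_basis[OF A])
    show "mean p t x = poly p x + (LINT s:{0..t}|lborel. mean q s x)"
      if "degree p \<le> 1" "degree q \<le> 1" "x \<in> S" "0 \<le> t"
        "generates S F P X (restrict (poly p) S) (restrict (poly q) S)" for p q x t
      using that by (intro mean_linear_equation) auto
  qed auto
  have p2: "degree (p j) \<le> 2" if "j \<le> 1" for j using p(1)[OF that] by simp
  define u where "u = (\<Sum>j\<le>1. Polynomial.smult (v j) (p j))"
  have u_mean: "mean u t x = (\<Sum>j\<le>1. v j * mean (p j) t x)" if "x \<in> S" "0 \<le> t" for x t
    unfolding u_def using that p2 by (intro mean_sum) auto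
  have u_B: "poly u x = (\<Sum>j\<le>1. v j * B j x)" if "x \<in> S" for x
    unfolding u_def poly_sum using p(2) that by (intro sum.cong) auto
  have deg: "degree u \<le> 1"
    unfolding u_def using p(1) by (intro degree_sum_le order_trans[OF degree_smult_le]) auto
  have "\<exists>x\<in>S. poly u x \<noteq> 0"
  proof (rule ccontr)
    assume "\<not> (\<exists>x\<in>S. poly u x \<noteq> 0)"
    then have "\<forall>x\<in>S. (\<Sum>j\<le>1. v j * B j x) = 0" using u_B by auto
    then have "\<forall>j\<le>1. v j = 0" using A unfolding generator_matrix_def polys_basis_def by blast
    with v(1) show False by blast
  qed
  moreover have "mean u t x = poly u x * exp (l * t)" if x: "x \<in> S" and t: "0 \<le> t" for x t
  proof -
    obtain H where H: "\<And>s. 0 \<le> s \<Longrightarrow> s \<le> t \<Longrightarrow> \<bar>mean u s x\<bar> \<le> H"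
      by (rule mean_abs_le[OF x, of u t]) (use deg in auto)
    show ?thesis
    proof (rule exponential_integral_equation[OF mean_measurable[OF x] H _ t])
      fix s assume s: "0 \<le> s" "s \<le> t"
      define g where "g j r = (\<Sum>i\<le>1. A $$ (i, j) * mean (p i) r x)" for j r
      have g_int: "set_integrable lborel {0..s} (g j)" for j
      proof -
        have "set_integrable lborel {0..s} (\<lambda>r. A $$ (i, j) * mean (p i) r x)" if i: "i \<le> 1" for i
        proof -
          obtain H where "\<And>r. 0 \<le> r \<Longrightarrow> r \<le> s \<Longrightarrow> \<bar>mean (p i) r x\<bar> \<le> H"
            by (rule mean_abs_le[OF x, of "p i" s]) (use p2[OF i] in auto)
          then show ?thesis
            by (intro set_integrable_mult_right impI set_integrable_bounded[OF mean_measurable[OF x], where K = H]) auto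
        qed
        then have "set_integrable lborel {0..s} (\<lambda>r. A $$ (0, j) * mean (p 0) r x + A $$ (1, j) * mean (p 1) r x)"
          by (intro set_integral_add) auto
        then show ?thesis by (simp add: g_def[abs_def])
      qed
      have "mean u s x = (\<Sum>j\<le>1. v j * (poly (p j) x + (LINT r:{0..s}|lborel. g j r)))"
        unfolding u_mean[OF x s(1)] g_def using eq[OF _ x s(1)] by simp
      also have "\<dots> = poly u x + ((LINT r:{0..s}|lborel. v 0 * g 0 r) + (LINT r:{0..s}|lborel. v 1 * g 1 r))"
        by (simp add: u_def algebra_simps)
      also have "(LINT r:{0..s}|lborel. v 0 * g 0 r) + (LINT r:{0..s}|lborel. v 1 * g 1 r)
          = (LINT r:{0..s}|lborel. v 0 * g 0 r + v 1 * g 1 r)"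
        using g_int by (intro set_integral_add(2)[symmetric] set_integrable_mult_right) auto
      also have "\<dots> = (LINT r:{0..s}|lborel. l * mean u r x)"
      proof (rule set_lebesgue_integral_cong)
        show "\<forall>r. r \<in> {0..s} \<longrightarrow> v 0 * g 0 r + v 1 * g 1 r = l * mean u r x"
        proof (intro allI impI)
          fix r assume "r \<in> {0..s}"
          then have r: "0 \<le> r" by simp
          have "v 0 * g 0 r + v 1 * g 1 r = (\<Sum>j\<le>1. A $$ (0, j) * v j) * mean (p 0) r x + (\<Sum>j\<le>1. A $$ (1, j) * v j) * mean (p 1) r x"
            by (simp add: g_def algebra_simps)
          also have "\<dots> = l * mean u r x"
            unfolding u_mean[OF x r] using v(2)[of 0] v(2)[of 1] by (simp add: algebra_simps)
          finally show "v 0 * g 0 r + v 1 * g 1 r = l * mean u r x" .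
        qed
      qed simp
      finally show "mean u s x = poly u x + (LINT r:{0..s}|lborel. l * mean u r x)" .
    qed
  qed
  ultimately show ?thesis using deg that by blast
qed

text \<open>
  The eigenfunction for - \<beta> is not constant, since the mean of a constant does not decay;
  hence it is a multiple of y - m. Letting t tend to infinity identifies m as the mean of the
  limiting law.
\<close>

lemma mean_reversion:
  assumes A: "generator_matrix S \<G> 1 B A" and l: "complex_of_real (- \<beta>) \<in> complex_spectrum A"
    and \<beta>: "\<beta> > 0" and mu: "limiting 2 S P X \<mu>" and x: "x \<in> S" and t: "0 \<le> t"
  shows "mean [:0, 1:] t x = (\<integral>y. y \<partial>\<mu>) + exp (- \<beta> * t) * (x - (\<integral>y. y \<partial>\<mu>))"
proof -
  obtain u where u: "degree u \<le> 1" "\<exists>x\<in>S. poly u x \<noteq> 0"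
    "\<And>x t. x \<in> S \<Longrightarrow> 0 \<le> t \<Longrightarrow> mean u t x = poly u x * exp (- \<beta> * t)"
    by (rule eigenfunction[OF A l]) (rule that)
  define a where "a = coeff u 0"
  define b where "b = coeff u 1"
  have u_eq: "u = [:a:] + Polynomial.smult b [:0, 1:]"
  proof (rule poly_eqI)
    fix n show "coeff u n = coeff ([:a:] + Polynomial.smult b [:0, 1:]) n"
      using u(1) by (cases n rule: nat.exhaust[case_names 0 Suc]; cases "n - 1")
        (auto simp: a_def b_def coeff_eq_0)
  qed
  have u_mean: "mean u t x = a + b * mean [:0, 1:] t x" if "x \<in> S" "0 \<le> t" for x t
    unfolding u_eq using that by (subst mean_add(1)) (simp_all add: mean_const mean_smult del: smult_pCons)
  have u_poly: "poly u y = a + b * y" for y by (simp add: u_eq)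
  have b0: "b \<noteq> 0"
  proof
    assume b: "b = 0"
    obtain y where y: "y \<in> S" "poly u y \<noteq> 0" using u(2) by blast
    have "a = a * exp (- \<beta> * 1)" using u(3)[OF y(1), of 1] u_mean[OF y(1), of 1] by (simp add: b u_poly)
    moreover have "exp (- \<beta> * 1) \<noteq> 1" using \<beta> by simp
    ultimately have "a = 0" by (metis mult_cancel_left2)
    with y b show False by (simp add: u_poly)
  qed
  define m where "m = - a / b"
  have rev: "mean [:0, 1:] t y = m + exp (- \<beta> * t) * (y - m)" if "y \<in> S" "0 \<le> t" for y t
  proof -
    have "b * mean [:0, 1:] t y = b * (m + exp (- \<beta> * t) * (y - m))"
      using u(3)[OF that] u_mean[OF that] b0 by (simp add: u_poly m_def algebra_simps)
    with b0 show ?thesis by simp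
  qed
  have "((\<lambda>t. exp (- \<beta> * t)) \<longlongrightarrow> 0) at_top"
    using \<beta> by (intro filterlim_compose[OF exp_at_bot] filterlim_tendsto_neg_mult_at_bot[OF tendsto_const _ filterlim_ident]) auto
  then have "((\<lambda>t. m + exp (- \<beta> * t) * (x - m)) \<longlongrightarrow> m + 0 * (x - m)) at_top"
    by (intro tendsto_intros)
  moreover have "eventually (\<lambda>t. m + exp (- \<beta> * t) * (x - m) = mean [:0, 1:] t x) at_top"
    using eventually_ge_at_top[of 0] by eventually_elim (simp add: rev x)
  ultimately have "((\<lambda>t. mean [:0, 1:] t x) \<longlongrightarrow> m) at_top"
    by (simp add: Lim_transform_eventually)
  moreover have "((\<lambda>t. mean [:0, 1:] t x) \<longlongrightarrow> (\<integral>y. y \<partial>\<mu>)) at_top"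
    using limiting_mean(1)[OF mu _ x, of "[:0, 1:]"] by simp
  ultimately have "m = (\<integral>y. y \<partial>\<mu>)" using tendsto_unique trivial_limit_at_top_linorder by blast
  with rev[OF x t] show ?thesis by simp
qed

lemma trans_poly:
  assumes x: "x \<in> S" and q: "degree q \<le> 2" and nonneg: "\<And>y. 0 \<le> poly q y" and t: "0 \<le> t"
  shows "transition t (\<lambda>y. ennreal (poly q y)) x = ennreal (mean q t x)" "0 \<le> mean q t x"
  unfolding transition_def mean_def using integrable_poly[OF x q t] nonneg
  by (auto intro!: nn_integral_eq_integral integral_nonneg_AE simp del: X0_eq)

lemma wt_poly: "wt = (\<lambda>y. ennreal (poly [:1, 0, 1:] y))"
  by (simp add: wt_def fun_eq_iff power2_eq_square)

text \<open>
  By mean reversion the starting point y is recovered from z, the mean of X r, up to a factor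
  exp (\<beta> * r), and z^2 is at most the second moment of X r. So a large weight at the start
  forces a large weight in the mean at every later time up to t.
\<close>

lemma trans_wt_lower:
  assumes rev: "\<And>y r. y \<in> S \<Longrightarrow> 0 \<le> r \<Longrightarrow> mean [:0, 1:] r y = m + exp (- \<beta> * r) * (y - m)"
    and \<beta>: "\<beta> > 0" and t: "0 < t"
  shows "\<exists>D. \<forall>y\<in>S. \<forall>r. 0 \<le> r \<longrightarrow> r \<le> t \<longrightarrow> wt y \<le> ennreal D * transition r wt y"
proof -
  define E where "E = exp (\<beta> * t)"
  have E: "E > 0" by (simp add: E_def)
  define D where "D = 1 + 2 * (\<bar>m\<bar> + E * \<bar>m\<bar>)\<^sup>2 + 2 * E\<^sup>2"
  have "wt y \<le> ennreal D * transition r wt y" if y: "y \<in> S" and r: "0 \<le> r" "r \<le> t" for y r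
  proof -
    interpret Py: prob_space "P y" by (rule prob_space_P[OF y])
    define z where "z = mean [:0, 1:] r y"
    have ints: "integrable (P y) (\<lambda>\<omega>. X0 r \<omega>)" "integrable (P y) (\<lambda>\<omega>. (X0 r \<omega>)\<^sup>2)"
      using integrable_poly[OF y _ r(1), of "[:0, 1:]"] integrable_poly[OF y _ r(1), of "[:0, 0, 1:]"]
      by (simp_all add: power2_eq_square)
    have "0 \<le> (\<integral>\<omega>. (X0 r \<omega> - z)\<^sup>2 \<partial>P y)" by simp
    also have "\<dots> = (\<integral>\<omega>. (X0 r \<omega>)\<^sup>2 - 2 * z * X0 r \<omega> + z\<^sup>2 \<partial>P y)"
      by (intro Bochner_Integration.integral_cong) (auto simp: power2_diff algebra_simps)
    also have "\<dots> = (\<integral>\<omega>. (X0 r \<omega>)\<^sup>2 \<partial>P y) - 2 * z * z + z\<^sup>2"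
      using ints by (simp add: Py.prob_space z_def mean_def del: X0_eq)
    finally have z2: "z\<^sup>2 \<le> (\<integral>\<omega>. (X0 r \<omega>)\<^sup>2 \<partial>P y)" by (simp add: power2_eq_square)
    have tr: "transition r wt y = ennreal (1 + (\<integral>\<omega>. (X0 r \<omega>)\<^sup>2 \<partial>P y))"
    proof -
      have "transition r wt y = ennreal (mean [:1, 0, 1:] r y)"
        unfolding wt_poly by (rule trans_poly[OF y _ _ r(1)]) (auto simp: power2_eq_square[symmetric] add_nonneg_nonneg)
      also have "mean [:1, 0, 1:] r y = (\<integral>\<omega>. 1 + (X0 r \<omega>)\<^sup>2 \<partial>P y)"
        by (simp add: mean_def power2_eq_square)
      also have "\<dots> = 1 + (\<integral>\<omega>. (X0 r \<omega>)\<^sup>2 \<partial>P y)" using ints by (simp add: Py.prob_space del: X0_eq)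
      finally show ?thesis .
    qed
    have "exp (\<beta> * r) * (z - m) = y - m"
      unfolding z_def rev[OF y r(1)] by (simp add: mult.assoc[symmetric] exp_add[symmetric])
    then have "y = m + exp (\<beta> * r) * (z - m)" by simp
    moreover have "exp (\<beta> * r) \<le> E" using r \<beta> by (simp add: E_def)
    ultimately have "\<bar>y\<bar> \<le> \<bar>m\<bar> + E * (\<bar>z\<bar> + \<bar>m\<bar>)"
    proof -
      assume 1: "y = m + exp (\<beta> * r) * (z - m)" and 2: "exp (\<beta> * r) \<le> E"
      have "\<bar>y\<bar> \<le> \<bar>m\<bar> + exp (\<beta> * r) * \<bar>z - m\<bar>"
        unfolding 1 using abs_triangle_ineq[of m "exp (\<beta> * r) * (z - m)"] by (simp add: abs_mult)
      also have "exp (\<beta> * r) * \<bar>z - m\<bar> \<le> E * (\<bar>z\<bar> + \<bar>m\<bar>)"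
        using 2 E by (intro mult_mono) auto
      finally show ?thesis by simp
    qed
    then have "y\<^sup>2 \<le> ((\<bar>m\<bar> + E * \<bar>m\<bar>) + E * \<bar>z\<bar>)\<^sup>2"
      by (intro abs_le_square_iff[THEN iffD1]) (use E in \<open>auto simp: algebra_simps\<close>)
    also have "\<dots> \<le> 2 * (\<bar>m\<bar> + E * \<bar>m\<bar>)\<^sup>2 + 2 * (E * \<bar>z\<bar>)\<^sup>2"
    proof -
      have "(u + v)\<^sup>2 \<le> 2 * u\<^sup>2 + 2 * v\<^sup>2" for u v :: real
        using sum_squares_bound[of u v] by (simp add: power2_sum)
      then show ?thesis .
    qed
    also have "(E * \<bar>z\<bar>)\<^sup>2 = E\<^sup>2 * z\<^sup>2" by (simp add: power_mult_distrib)
    finally have "1 + y\<^sup>2 \<le> D * 1 + D * z\<^sup>2"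
    proof -
      assume *: "y\<^sup>2 \<le> 2 * (\<bar>m\<bar> + E * \<bar>m\<bar>)\<^sup>2 + 2 * (E\<^sup>2 * z\<^sup>2)"
      have "2 * E\<^sup>2 * z\<^sup>2 \<le> D * z\<^sup>2" by (intro mult_right_mono) (auto simp: D_def)
      moreover have "1 + 2 * (\<bar>m\<bar> + E * \<bar>m\<bar>)\<^sup>2 \<le> D" by (simp add: D_def)
      ultimately show ?thesis using * by simp
    qed
    also have "\<dots> \<le> D * (1 + (\<integral>\<omega>. (X0 r \<omega>)\<^sup>2 \<partial>P y))"
      using z2 by (simp add: distrib_left) (auto simp: D_def intro!: mult_left_mono add_nonneg_nonneg)
    finally have "ennreal (1 + y\<^sup>2) \<le> ennreal (D * (1 + (\<integral>\<omega>. (X0 r \<omega>)\<^sup>2 \<partial>P y)))" by (rule ennreal_leI)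
    also have "\<dots> = ennreal D * transition r wt y"
      unfolding tr by (rule ennreal_mult) (auto simp: D_def intro!: add_nonneg_nonneg)
    finally show ?thesis by (simp only: wt_def)
  qed
  then show ?thesis by blast
qed

text \<open>
  The mean of a polynomial at time t is again a polynomial in the starting point. Quadratic
  interpolation in the starting point commutes with the linear system for the means of the
  basis, so the interpolation error solves the homogeneous system with zero initial value and
  vanishes. An interior point of S provides the three nodes.
\<close>

lemma mean_polynomial:
  assumes A: "generator_matrix S \<G> 2 B A" and int: "interior S \<noteq> {}"
    and lower: "\<And>t. 0 < t \<Longrightarrow> \<exists>D. \<forall>y\<in>S. \<forall>r. 0 \<le> r \<longrightarrow> r \<le> t \<longrightarrow> wt y \<le> ennreal D * transition r wt y"
    and q: "degree q \<le> 2" and t: "0 \<le> t"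
  obtains Q where "degree Q \<le> 2" "\<And>x. x \<in> S \<Longrightarrow> mean q t x = poly Q x"
proof -
  obtain p where p: "\<And>j. j \<le> 2 \<Longrightarrow> degree (p j) \<le> 2" "\<And>j x. j \<le> 2 \<Longrightarrow> x \<in> S \<Longrightarrow> B j x = poly (p j) x"
    and eq: "\<And>j x t. j \<le> 2 \<Longrightarrow> x \<in> S \<Longrightarrow> 0 \<le> t \<Longrightarrow>
      mean (p j) t x = poly (p j) x + (LINT s:{0..t}|lborel. (\<Sum>i\<le>2. A $$ (i, j) * mean (p i) s x))"
  proof (rule mean_generator_basis[OF A])
    show "mean p t x = poly p x + (LINT s:{0..t}|lborel. mean q s x)"
      if "degree p \<le> 2" "degree q \<le> 2" "x \<in> S" "0 \<le> t"
        "generates S F P X (restrict (poly p) S) (restrict (poly q) S)" for p q x t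
      using that by (intro mean_quadratic_equation lower) auto
  qed auto
  obtain a e where ae: "e > 0" "ball a e \<subseteq> S" using int by (metis ex_in_conv mem_interior)
  define h where "h = e / 2"
  have h: "h > 0" using ae by (simp add: h_def)
  have aS: "a \<in> S" "a - h \<in> S" "a + h \<in> S" using ae by (auto simp: h_def dist_real_def intro!: subsetD[OF ae(2)])
  define \<sigma> where "\<sigma> x = (x - a) / h" for x
  define w where "w i x = (if i = 0 then \<sigma> x * (\<sigma> x - 1) / 2 else if i = 1 then 1 - (\<sigma> x)\<^sup>2 else \<sigma> x * (\<sigma> x + 1) / 2)"
    for i :: nat and x
  define c where "c i = (if i = 0 then a - h else if i = 1 then a else a + h)" for i :: nat
  have cS: "c i \<in> S" for i using aS by (simp add: c_def)
  have interp: "poly r x = (\<Sum>i\<le>2. w i x * poly r (c i))" if "degree r \<le> 2" for r x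
    using quadratic_interpolation[OF that, of x a h "\<sigma> x"] h
    by (simp add: w_def c_def \<sigma>_def numeral_2_eq_2)
  have basis: "mean (p j) t x = (\<Sum>i\<le>2. w i x * mean (p j) t (c i))" if x: "x \<in> S" and j: "j \<le> 2" for x j
  proof -
    \<comment> \<open>the interpolation error in the starting point x, as a function of the
        time s\<close>
    define z where "z j s = mean (p j) s x - (\<Sum>i\<le>2. w i x * mean (p j) s (c i))" for j s
    have z_meas: "z j \<in> borel_measurable borel" for j
      unfolding z_def[abs_def] using mean_measurable[OF x] mean_measurable[OF cS]
      by (intro borel_measurable_diff borel_measurable_sum borel_measurable_times) auto
    have bd: "\<exists>H. \<forall>s. 0 \<le> s \<longrightarrow> s \<le> t \<longrightarrow> \<bar>mean (p j) s y\<bar> \<le> H" if "j \<le> 2" "y \<in> S" for j y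
      by (rule mean_abs_le[OF that(2) p(1)[OF that(1)], of t]) blast
    have "\<exists>H. \<forall>s. 0 \<le> s \<longrightarrow> s \<le> t \<longrightarrow> \<bar>z j s\<bar> \<le> H" if j: "j \<le> 2" for j
    proof -
      obtain H where H: "\<And>s. 0 \<le> s \<Longrightarrow> s \<le> t \<Longrightarrow> \<bar>mean (p j) s x\<bar> \<le> H" using bd[OF j x] by blast
      obtain G where G: "\<And>i s. 0 \<le> s \<Longrightarrow> s \<le> t \<Longrightarrow> \<bar>mean (p j) s (c i)\<bar> \<le> G i" using bd[OF j cS] by metis
      have "\<bar>z j s\<bar> \<le> H + (\<Sum>i\<le>2. \<bar>w i x\<bar> * G i)" if s: "0 \<le> s" "s \<le> t" for s
      proof -
        have "\<bar>z j s\<bar> \<le> \<bar>mean (p j) s x\<bar> + \<bar>\<Sum>i\<le>2. w i x * mean (p j) s (c i)\<bar>" unfolding z_def by linarith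
        also have "\<bar>\<Sum>i\<le>2. w i x * mean (p j) s (c i)\<bar> \<le> (\<Sum>i\<le>2. \<bar>w i x * mean (p j) s (c i)\<bar>)" by (rule sum_abs)
        also have "\<dots> \<le> (\<Sum>i\<le>2. \<bar>w i x\<bar> * G i)"
          using G[OF s] by (intro sum_mono) (auto simp: abs_mult intro!: mult_left_mono)
        finally show ?thesis using H[OF s] by simp
      qed
      then show ?thesis by blast
    qed
    then obtain H where H: "\<And>j s. j \<le> 2 \<Longrightarrow> 0 \<le> s \<Longrightarrow> s \<le> t \<Longrightarrow> \<bar>z j s\<bar> \<le> H j" by metis
    have Hmax: "\<bar>z j s\<bar> \<le> (\<Sum>j\<le>2. \<bar>H j\<bar>)" if "j \<le> 2" "0 \<le> s" "s \<le> t" for j s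
    proof -
      have "\<bar>z j s\<bar> \<le> \<bar>H j\<bar>" using H[OF that] by simp
      also have "\<dots> \<le> (\<Sum>j\<le>2. \<bar>H j\<bar>)" by (rule member_le_sum) (use that in auto)
      finally show ?thesis .
    qed
    have "z j t = 0"
    proof (rule linear_system_zero[where a = "\<lambda>i j. A $$ (i, j)" and k = 2, OF z_meas Hmax _ t j])
      fix j :: nat and s :: real assume j: "j \<le> 2" and s: "0 \<le> s" "s \<le> t"
      define g where "g y r = (\<Sum>i\<le>2. A $$ (i, j) * mean (p i) r y)" for y r
      have g_int: "set_integrable lborel {0..s} (g y)" if y: "y \<in> S" for y
      proof -
        have 1: "set_integrable lborel {0..s} (\<lambda>r. A $$ (i, j) * mean (p i) r y)" if i: "i \<le> 2" for i
        proof -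
          obtain H where "\<And>r. 0 \<le> r \<Longrightarrow> r \<le> t \<Longrightarrow> \<bar>mean (p i) r y\<bar> \<le> H" using bd[OF i y] by blast
          then show ?thesis using s
            by (intro set_integrable_mult_right impI set_integrable_bounded[OF mean_measurable[OF y], where K = H]) auto
        qed
        have "set_integrable lborel {0..s} (\<lambda>r. A $$ (0, j) * mean (p 0) r y + A $$ (1, j) * mean (p 1) r y + A $$ (2, j) * mean (p 2) r y)"
          by (intro set_integral_add 1) auto
        then show ?thesis by (simp add: g_def[abs_def] numeral_2_eq_2)
      qed
      have m: "mean (p j) s y = poly (p j) y + (LINT r:{0..s}|lborel. g y r)" if "y \<in> S" for y
        unfolding g_def by (rule eq[OF j that s(1)])
      have "z j s = (LINT r:{0..s}|lborel. g x r) - (\<Sum>i\<le>2. w i x * (LINT r:{0..s}|lborel. g (c i) r))"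
        unfolding z_def m[OF x] m[OF cS] interp[OF p(1)[OF j], of x]
        by (simp add: distrib_left sum.distrib)
      also have "\<dots> = (LINT r:{0..s}|lborel. g x r - (w 0 x * g (c 0) r + w 1 x * g (c 1) r + w 2 x * g (c 2) r))"
        using g_int[OF x] g_int[OF cS]
        by (simp add: set_integral_diff set_integral_add numeral_2_eq_2)
      also have "\<dots> = (LINT r:{0..s}|lborel. (\<Sum>i\<le>2. A $$ (i, j) * z i r))"
        by (simp add: g_def z_def numeral_2_eq_2 algebra_simps)
      finally show "z j s = (LINT r:{0..s}|lborel. (\<Sum>i\<le>2. A $$ (i, j) * z i r))" .
    qed
    then show ?thesis by (simp add: z_def)
  qed
  have "\<exists>d. \<forall>x\<in>S. restrict (poly q) S x = (\<Sum>i\<le>2. d i * B i x)"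
    using A q unfolding generator_matrix_def polys_basis_def polys_def by blast
  then obtain d where d: "\<And>x. x \<in> S \<Longrightarrow> poly q x = (\<Sum>i\<le>2. d i * B i x)" by auto
  have qm: "mean q t x = (\<Sum>j\<le>2. d j * mean (p j) t x)" if x: "x \<in> S" for x
  proof -
    have "mean q t x = mean (\<Sum>j\<le>2. Polynomial.smult (d j) (p j)) t x"
      using d p(2) by (intro mean_cong x) (simp add: poly_sum)
    also have "\<dots> = (\<Sum>j\<le>2. d j * mean (p j) t x)" using x t p(1) by (intro mean_sum) auto
    finally show ?thesis .
  qed
  have q_interp: "mean q t x = (\<Sum>i\<le>2. w i x * mean q t (c i))" if x: "x \<in> S" for x
  proof -
    have "mean q t x = (\<Sum>j\<le>2. d j * (\<Sum>i\<le>2. w i x * mean (p j) t (c i)))"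
      unfolding qm[OF x] using basis[OF x] by (intro sum.cong) auto
    also have "\<dots> = (\<Sum>i\<le>2. w i x * (\<Sum>j\<le>2. d j * mean (p j) t (c i)))"
      unfolding sum_distrib_left by (subst sum.swap) (simp add: mult.left_commute)
    finally show ?thesis by (simp add: qm[OF cS])
  qed
  define L where "L = [:- a / h, 1 / h:]"
  have L: "poly L x = \<sigma> x" for x by (simp add: L_def \<sigma>_def diff_divide_distrib)
  define W where "W i = (if i = 0 then Polynomial.smult (1 / 2) (L * (L - 1)) else if i = 1 then 1 - L * L else Polynomial.smult (1 / 2) (L * (L + 1)))" for i :: nat
  have W: "poly (W i) x = w i x" for i x by (simp add: W_def w_def L power2_eq_square)
  have degL: "degree L \<le> 1" "degree (L - 1) \<le> 1" "degree (L + 1) \<le> 1" by (auto simp: L_def one_pCons)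
  have degLL: "degree (L * M) \<le> 2" if "degree M \<le> 1" for M
    using degree_mult_le[of L M] degL(1) that by simp
  have degW: "degree (W i) \<le> 2" for i
    using degLL[OF degL(1)] degLL[OF degL(2)] degLL[OF degL(3)]
    by (auto simp: W_def intro!: degree_diff_le)
  show ?thesis
  proof (rule that[of "\<Sum>i\<le>2. Polynomial.smult (mean q t (c i)) (W i)"])
    show "degree (\<Sum>i\<le>2. Polynomial.smult (mean q t (c i)) (W i)) \<le> 2"
      using degW by (intro degree_sum_le order_trans[OF degree_smult_le]) auto
    show "mean q t x = poly (\<Sum>i\<le>2. Polynomial.smult (mean q t (c i)) (W i)) x" if "x \<in> S" for x
      unfolding q_interp[OF that] poly_sum by (simp add: W mult.commute)
  qed
qed

text \<open>
  By the Markov property the mean of q at time s + t is the mean of the quadratic polynomial Q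
  at time s. As s tends to infinity, both sides converge to integrals over \<mu>, of q and of Q.
  Convergence to \<mu> is known for quadratic means only, which is why the representation by Q
  is essential.
\<close>

lemma mean_invariant:
  assumes A: "generator_matrix S \<G> 2 B A" and int: "interior S \<noteq> {}"
    and lower: "\<And>t. 0 < t \<Longrightarrow> \<exists>D. \<forall>y\<in>S. \<forall>r. 0 \<le> r \<longrightarrow> r \<le> t \<longrightarrow> wt y \<le> ennreal D * transition r wt y"
    and mu: "limiting 2 S P X \<mu>"
    and q: "degree q \<le> 2" "\<And>y. 0 \<le> poly q y" and t: "0 \<le> t"
  shows "integrable \<mu> (\<lambda>y. mean q t y)" "(\<integral>y. mean q t y \<partial>\<mu>) = (\<integral>y. poly q y \<partial>\<mu>)"
proof -
  obtain Q where Q: "degree Q \<le> 2" "\<And>x. x \<in> S \<Longrightarrow> mean q t x = poly Q x"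
    by (rule mean_polynomial[OF A int lower q(1) t]) (auto intro: that)
  obtain x where x: "x \<in> S" using int interior_subset by blast
  have space: "space \<mu> = S"
    using mu sets_eq_imp_space_eq[of \<mu> "restrict_space borel S"] by (simp add: limiting_def space_restrict_space)
  have Qnn: "0 \<le> poly Q y" if "y \<in> S" for y using Q(2)[OF that] trans_poly(2)[OF that q t] by simp
  have semigroup: "mean q (s + t) x = mean Q s x" if s: "0 \<le> s" for s
  proof -
    have top: "space M \<in> sets (F s)" using sets.top[of "F s"] by (simp add: space_F)
    have "ennreal (mean q (s + t) x) = transition (s + t) (\<lambda>y. ennreal (poly q y)) x"
      using trans_poly(1)[OF x q, of "s + t"] s t by simp
    also have "\<dots> = (\<integral>\<^sup>+\<omega>. ennreal (poly q (X (s + t) \<omega>)) * indicator (space M) \<omega> \<partial>P x)"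
      unfolding transition_def using s t by (intro nn_integral_cong) (simp add: space_P x)
    also have "\<dots> = (\<integral>\<^sup>+\<omega>. transition t (\<lambda>y. ennreal (poly q y)) (X s \<omega>) * indicator (space M) \<omega> \<partial>P x)"
      by (rule markov_nn[OF x s t top]) measurable
    also have "\<dots> = (\<integral>\<^sup>+\<omega>. ennreal (poly Q (X0 s \<omega>)) \<partial>P x)"
      using s by (intro nn_integral_cong) (simp add: space_P x trans_poly(1)[OF X_in_S q t] Q(2)[OF X_in_S])
    also have "\<dots> = ennreal (mean Q s x)"
      unfolding mean_def using Qnn
      by (intro nn_integral_eq_integral integrable_poly x Q s) (auto simp: space_P x X0_in_S simp del: X0_eq)
    finally have "ennreal (mean q (s + t) x) = ennreal (mean Q s x)" .
    moreover have "0 \<le> mean q (s + t) x" using trans_poly(2)[OF x q, of "s + t"] s t by simp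
    moreover have "0 \<le> mean Q s x" unfolding mean_def using Qnn
      by (intro integral_nonneg_AE AE_I2) (auto simp: space_P x X0_in_S simp del: X0_eq)
    ultimately show ?thesis by simp
  qed
  have "((\<lambda>s. mean q (s + t) x) \<longlongrightarrow> (\<integral>y. poly q y \<partial>\<mu>)) at_top"
    by (rule filterlim_compose[OF limiting_mean(1)[OF mu q(1) x]])
       (intro filterlim_at_top_add_at_top[THEN filterlim_mono] filterlim_tendsto_add_at_top[OF tendsto_const filterlim_ident, of t, simplified add.commute])
  moreover have "eventually (\<lambda>s. mean q (s + t) x = mean Q s x) at_top"
    using eventually_ge_at_top[of 0] by eventually_elim (rule semigroup)
  ultimately have "((\<lambda>s. mean Q s x) \<longlongrightarrow> (\<integral>y. poly q y \<partial>\<mu>)) at_top"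
    by (rule Lim_transform_eventually)
  with limiting_mean(1)[OF mu Q(1) x] have eq: "(\<integral>y. poly Q y \<partial>\<mu>) = (\<integral>y. poly q y \<partial>\<mu>)"
    using tendsto_unique trivial_limit_at_top_linorder by blast
  have "(\<integral>y. mean q t y \<partial>\<mu>) = (\<integral>y. poly Q y \<partial>\<mu>)"
    by (intro Bochner_Integration.integral_cong) (auto simp: space Q)
  with eq show "(\<integral>y. mean q t y \<partial>\<mu>) = (\<integral>y. poly q y \<partial>\<mu>)" by simp
  show "integrable \<mu> (\<lambda>y. mean q t y)"
    using limiting_mean(2)[OF mu Q(1) x]
    by (rule Bochner_Integration.integrable_cong[THEN iffD1, rotated 2]) (auto simp: space Q)
qed

end

section \<open>Covariances under the limiting law\<close>

text \<open>
  The hypotheses on the process alone. Q below is the law under which the process starts from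
  its limiting law.
\<close>

locale reverting_process = quadratic_process M F S P X \<G>
  for M :: "'a measure" and F :: "real \<Rightarrow> 'a measure" and S P X \<G> +
  fixes \<mu> :: "real measure" and \<beta> :: real and B1 B2 :: "nat \<Rightarrow> real \<Rightarrow> real" and A1 A2 :: "real mat"
  assumes interior: "interior S \<noteq> {}"
    and limiting: "limiting 2 S P X \<mu>"
    and A1: "generator_matrix S \<G> 1 B1 A1" "complex_of_real (- \<beta>) \<in> complex_spectrum A1"
    and A2: "generator_matrix S \<G> 2 B2 A2"
    and \<beta>: "\<beta> > 0"
begin

definition mu_mean where "mu_mean = (\<integral>y. y \<partial>\<mu>)"
definition mu_square where "mu_square = (\<integral>y. y\<^sup>2 \<partial>\<mu>)"
definition Q where "Q = initial_law P \<mu>"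

lemma revert: "x \<in> S \<Longrightarrow> 0 \<le> t \<Longrightarrow> mean [:0, 1:] t x = mu_mean + exp (- \<beta> * t) * (x - mu_mean)"
  unfolding mu_mean_def by (rule mean_reversion[OF A1 \<beta> limiting])

lemmas lower = trans_wt_lower[OF revert \<beta>]

lemma space_mu: "space \<mu> = S"
  using limiting sets_eq_imp_space_eq[of \<mu> "restrict_space borel S"] by (simp add: limiting_def space_restrict_space)

lemma kernel_mu: "P \<in> \<mu> \<rightarrow>\<^sub>M prob_algebra M"
  using kernel limiting by (simp add: limiting_def cong: measurable_cong_sets)

lemma mu_prob: "\<mu> \<in> space (prob_algebra (restrict_space borel S))"
  using limiting by (simp add: limiting_def space_prob_algebra)

lemma prob_Q: "prob_space Q"
  unfolding Q_def initial_law_def by (rule prob_space_bind'[OF mu_prob kernel])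

lemma sets_Q: "sets Q = sets M"
  unfolding Q_def initial_law_def by (rule sets_bind'[OF mu_prob kernel])

lemma space_Q: "space Q = space M"
  by (rule sets_eq_imp_space_eq[OF sets_Q])

lemma measurable_Q_cong: "measurable Q N = measurable M N"
  by (rule measurable_cong_sets) (simp_all add: sets_Q)

lemma nn_integral_Q: "f \<in> borel_measurable M \<Longrightarrow> (\<integral>\<^sup>+\<omega>. f \<omega> \<partial>Q) = (\<integral>\<^sup>+x. (\<integral>\<^sup>+\<omega>. f \<omega> \<partial>P x) \<partial>\<mu>)"
  unfolding Q_def initial_law_def by (rule nn_integral_bind[OF _ measurable_prob_algebraD[OF kernel_mu]])

lemma cond_exp_Q: "sigma_finite_subalgebra Q (F s)"
  using subalg prob_Q by (intro finite_measure_subalgebra_is_sigma_finite finite_measure_subalgebra.intro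
      finite_measure_subalgebra_axioms.intro prob_space.finite_measure)
    (auto simp: subalgebra_def space_F space_Q sets_Q)

lemma markov_Q:
  assumes s: "0 \<le> s" and t: "0 \<le> t" and A: "A \<in> sets (F s)" and f [measurable]: "f \<in> borel_measurable borel"
  shows "(\<integral>\<^sup>+\<omega>. f (X (s + t) \<omega>) * indicator A \<omega> \<partial>Q) = (\<integral>\<^sup>+\<omega>. transition t f (X s \<omega>) * indicator A \<omega> \<partial>Q)"
proof -
  have [measurable]: "A \<in> sets M" "X (s + t) \<in> borel_measurable M"
    using sets_F_M[OF A] X_measurable s t by auto
  have meas1: "(\<lambda>\<omega>. f (X (s + t) \<omega>) * indicator A \<omega>) \<in> borel_measurable M" by measurable
  have meas2: "(\<lambda>\<omega>. transition t f (X s \<omega>) * indicator A \<omega>) \<in> borel_measurable M"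
    by (intro borel_measurable_times_ennreal measurable_F_M[OF trans_X_measurable[OF f s]] borel_measurable_indicator) fact
  show ?thesis
    unfolding nn_integral_Q[OF meas1] nn_integral_Q[OF meas2]
    by (intro nn_integral_cong markov_nn s t A f) (simp add: space_mu)
qed

text \<open>
  Invariance of the moments under the limiting law, read for the process started from it: the
  first two moments do not depend on the time.
\<close>

lemma nn_integral_poly_Q:
  assumes q: "degree q \<le> 2" "\<And>y. 0 \<le> poly q y"
  shows "(\<integral>\<^sup>+\<omega>. ennreal (poly q (X0 t \<omega>)) \<partial>Q) = ennreal (\<integral>y. poly q y \<partial>\<mu>)"
proof -
  define t' where "t' = max 0 t"
  have t': "0 \<le> t'" "X0 t = X0 t'" by (auto simp: t'_def X0_def)
  have "(\<integral>\<^sup>+\<omega>. ennreal (poly q (X0 t' \<omega>)) \<partial>Q) = (\<integral>\<^sup>+x. transition t' (\<lambda>y. ennreal (poly q y)) x \<partial>\<mu>)"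
    unfolding transition_def by (rule nn_integral_Q) measurable
  also have "\<dots> = (\<integral>\<^sup>+x. ennreal (mean q t' x) \<partial>\<mu>)"
    by (intro nn_integral_cong trans_poly(1) q t') (simp add: space_mu)
  also have "\<dots> = ennreal (\<integral>x. mean q t' x \<partial>\<mu>)"
    using mean_invariant(1)[OF A2 interior lower limiting q t'(1)] trans_poly(2)[OF _ q t'(1)]
    by (intro nn_integral_eq_integral) (auto simp: space_mu)
  also have "(\<integral>x. mean q t' x \<partial>\<mu>) = (\<integral>y. poly q y \<partial>\<mu>)"
    by (rule mean_invariant(2)[OF A2 interior lower limiting q t'(1)])
  finally show ?thesis by (simp add: t')
qed

lemma integrable_poly_Q:
  assumes p: "degree p \<le> 2"
  shows "integrable Q (\<lambda>\<omega>. poly p (X0 t \<omega>))"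
proof (rule integrableI_bounded)
  show "(\<lambda>\<omega>. poly p (X0 t \<omega>)) \<in> borel_measurable Q" unfolding measurable_Q_cong by measurable
  define K where "K = \<bar>coeff p 0\<bar> + \<bar>coeff p 1\<bar> + \<bar>coeff p 2\<bar>"
  have K: "K \<ge> 0" by (simp add: K_def)
  have "(\<integral>\<^sup>+\<omega>. ennreal (norm (poly p (X0 t \<omega>))) \<partial>Q) \<le> (\<integral>\<^sup>+\<omega>. ennreal K * wt (X0 t \<omega>) \<partial>Q)"
    unfolding real_norm_def by (intro nn_integral_mono ennreal_le_wt K quadratic_abs_bound[OF p, folded K_def])
  also have "\<dots> = ennreal K * (\<integral>\<^sup>+\<omega>. wt (X0 t \<omega>) \<partial>Q)"
    by (rule nn_integral_cmult) (unfold measurable_Q_cong, measurable)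
  also have "(\<integral>\<^sup>+\<omega>. wt (X0 t \<omega>) \<partial>Q) = ennreal (\<integral>y. poly [:1, 0, 1:] y \<partial>\<mu>)"
    unfolding wt_poly by (rule nn_integral_poly_Q) (auto simp: power2_eq_square[symmetric] add_nonneg_nonneg)
  finally show "(\<integral>\<^sup>+\<omega>. ennreal (norm (poly p (X0 t \<omega>))) \<partial>Q) < \<infinity>"
    by (simp add: ennreal_mult_less_top le_less_trans)
qed

text \<open>
  The identity function is the difference of these two quadratic polynomials. Both are
  nonnegative, so the Markov property for nonnegative functions applies to each of them.
\<close>

lemma q_nonneg: "0 \<le> poly [:1, 0, 1:] (y :: real)" "0 \<le> poly [:1, 1, 1:] (y :: real)"
proof -
  have "poly [:1, 1, 1:] y = (y + 1 / 2)\<^sup>2 + 3 / 4" by (simp add: power2_eq_square field_simps)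
  then show "0 \<le> poly [:1, 1, 1:] y" by simp
qed (auto simp: power2_eq_square[symmetric])

lemma poly_Q:
  assumes q: "degree q \<le> 2" "\<And>y. 0 \<le> poly q y"
  shows "(\<integral>\<omega>. poly q (X0 t \<omega>) \<partial>Q) = (\<integral>y. poly q y \<partial>\<mu>)"
proof -
  have "(\<integral>\<omega>. poly q (X0 t \<omega>) \<partial>Q) = enn2real (\<integral>\<^sup>+\<omega>. ennreal (poly q (X0 t \<omega>)) \<partial>Q)"
    by (rule integral_eq_nn_integral) (unfold measurable_Q_cong, measurable, simp add: q)
  then show ?thesis using q by (simp add: nn_integral_poly_Q integral_nonneg_AE)
qed

lemma integrable_mu: "degree p \<le> 2 \<Longrightarrow> integrable \<mu> (poly p)"
proof -
  obtain x where "x \<in> S" using interior interior_subset by blast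
  then show "degree p \<le> 2 \<Longrightarrow> integrable \<mu> (poly p)" using limiting_mean(2)[OF limiting] by blast
qed

lemma square_integrable_Q: "integrable Q (X0 t)" "integrable Q (\<lambda>\<omega>. (X0 t \<omega>)\<^sup>2)"
  using integrable_poly_Q[of "[:0, 1:]" t] integrable_poly_Q[of "[:0, 0, 1:]" t] by (simp_all add: power2_eq_square)

lemma moments_Q: "(\<integral>\<omega>. X0 t \<omega> \<partial>Q) = mu_mean" "(\<integral>\<omega>. (X0 t \<omega>)\<^sup>2 \<partial>Q) = mu_square"
proof -
  interpret prob_space Q by (rule prob_Q)
  interpret mu: prob_space \<mu> using limiting by (simp add: limiting_def)
  have ints: "integrable \<mu> (\<lambda>y. y)" "integrable \<mu> (\<lambda>y. y\<^sup>2)"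
    using integrable_mu[of "[:0, 1:]"] integrable_mu[of "[:0, 0, 1:]"]
    by (simp_all add: power2_eq_square cong: Bochner_Integration.integrable_cong)
  have 1: "1 + (\<integral>\<omega>. (X0 t \<omega>)\<^sup>2 \<partial>Q) = 1 + mu_square"
    using poly_Q[of "[:1, 0, 1:]" t, OF _ q_nonneg(1)] square_integrable_Q ints
    by (simp add: power2_eq_square[symmetric] prob_space mu.prob_space mu_square_def)
  have "(\<integral>\<omega>. 1 + X0 t \<omega> + (X0 t \<omega>)\<^sup>2 \<partial>Q) = (\<integral>y. 1 + y + y\<^sup>2 \<partial>\<mu>)"
    using poly_Q[of "[:1, 1, 1:]" t, OF _ q_nonneg(2)] by (simp add: power2_eq_square algebra_simps)
  then have 2: "1 + (\<integral>\<omega>. X0 t \<omega> \<partial>Q) + (\<integral>\<omega>. (X0 t \<omega>)\<^sup>2 \<partial>Q) = 1 + mu_mean + mu_square"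
    using square_integrable_Q ints by (simp add: prob_space mu.prob_space mu_mean_def mu_square_def)
  from 1 2 show "(\<integral>\<omega>. X0 t \<omega> \<partial>Q) = mu_mean" "(\<integral>\<omega>. (X0 t \<omega>)\<^sup>2 \<partial>Q) = mu_square" by simp_all
qed

text \<open>
  Mean reversion at the conditional level. The variable X is written as the difference of two
  nonnegative quadratic polynomials of X, because the Markov property is available for
  nonnegative functions.
\<close>

lemma cond_exp_X:
  assumes a: "0 \<le> a" and c: "0 \<le> c"
  shows "AE \<omega> in Q. real_cond_exp Q (F a) (X0 (a + c)) \<omega> = mu_mean + exp (- \<beta> * c) * (X0 a \<omega> - mu_mean)"
proof -
  interpret prob_space Q by (rule prob_Q)
  interpret sigma_finite_subalgebra Q "F a" by (rule cond_exp_Q)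
  define g where "g \<omega> = mu_mean + exp (- \<beta> * c) * (X0 a \<omega> - mu_mean)" for \<omega>
  have XF: "X0 a \<in> borel_measurable (F a)" using X_measurable_F[OF a] a by (simp add: X0_def[abs_def])
  \<comment> \<open>the Markov property for a nonnegative quadratic polynomial, between real
      integrals\<close>
  have key: "(\<integral>\<omega>. indicator A \<omega> * poly q (X0 (a + c) \<omega>) \<partial>Q) = (\<integral>\<omega>. indicator A \<omega> * mean q c (X0 a \<omega>) \<partial>Q)
      \<and> integrable Q (\<lambda>\<omega>. indicator A \<omega> * mean q c (X0 a \<omega>))"
    if A: "A \<in> sets (F a)" and q: "degree q \<le> 2" "\<And>y. 0 \<le> poly q y" for A q
  proof -
    have [measurable]: "A \<in> sets M" by (rule sets_F_M[OF A])
    obtain q' where q': "degree q' \<le> 2" "\<And>x. x \<in> S \<Longrightarrow> mean q c x = poly q' x"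
      by (rule mean_polynomial[OF A2 interior lower q(1) c]) (auto intro: that)
    have q'nn: "0 \<le> poly q' (X0 a \<omega>)" if "\<omega> \<in> space Q" for \<omega>
      using trans_poly(2)[OF X0_in_S q c, of \<omega> a] that q'(2)[OF X0_in_S, of \<omega> a] by (simp add: space_Q)
    have "(\<integral>\<omega>. indicator A \<omega> * poly q (X0 (a + c) \<omega>) \<partial>Q) = enn2real (\<integral>\<^sup>+\<omega>. ennreal (indicator A \<omega> * poly q (X0 (a + c) \<omega>)) \<partial>Q)"
      by (rule integral_eq_nn_integral) (unfold measurable_Q_cong, measurable, simp add: q)
    also have "(\<integral>\<^sup>+\<omega>. ennreal (indicator A \<omega> * poly q (X0 (a + c) \<omega>)) \<partial>Q)
        = (\<integral>\<^sup>+\<omega>. ennreal (poly q (X (a + c) \<omega>)) * indicator A \<omega> \<partial>Q)"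
      using a c by (intro nn_integral_cong) (auto split: split_indicator)
    also have "\<dots> = (\<integral>\<^sup>+\<omega>. transition c (\<lambda>y. ennreal (poly q y)) (X a \<omega>) * indicator A \<omega> \<partial>Q)"
      by (rule markov_Q[OF a c A]) measurable
    also have "\<dots> = (\<integral>\<^sup>+\<omega>. ennreal (indicator A \<omega> * poly q' (X0 a \<omega>)) \<partial>Q)"
      using a by (intro nn_integral_cong) (auto simp: space_Q trans_poly(1)[OF X_in_S q c] q'(2)[OF X_in_S] split: split_indicator)
    also have "enn2real \<dots> = (\<integral>\<omega>. indicator A \<omega> * poly q' (X0 a \<omega>) \<partial>Q)"
      by (rule integral_eq_nn_integral[symmetric])
         (unfold measurable_Q_cong, measurable, use q'nn in \<open>auto intro!: AE_I2\<close>)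
    also have "\<dots> = (\<integral>\<omega>. indicator A \<omega> * mean q c (X0 a \<omega>) \<partial>Q)"
      by (intro Bochner_Integration.integral_cong) (auto simp: q'(2)[OF X0_in_S] space_Q simp del: X0_eq)
    finally have 1: "(\<integral>\<omega>. indicator A \<omega> * poly q (X0 (a + c) \<omega>) \<partial>Q) = (\<integral>\<omega>. indicator A \<omega> * mean q c (X0 a \<omega>) \<partial>Q)" .
    have "integrable Q (\<lambda>\<omega>. indicator A \<omega> * poly q' (X0 a \<omega>))"
      using integrable_mult_indicator[of A Q, OF _ integrable_poly_Q[OF q'(1), of a]] by (simp add: sets_Q del: X0_eq)
    then have "integrable Q (\<lambda>\<omega>. indicator A \<omega> * mean q c (X0 a \<omega>))"
      by (rule Bochner_Integration.integrable_cong[THEN iffD1, rotated 2]) (auto simp: q'(2)[OF X0_in_S] space_Q simp del: X0_eq)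
    with 1 show ?thesis by simp
  qed
  have "AE \<omega> in Q. real_cond_exp Q (F a) (X0 (a + c)) \<omega> = g \<omega>"
  proof (rule real_cond_exp_charact)
    show "integrable Q (X0 (a + c))" by (rule square_integrable_Q)
    show "integrable Q g" unfolding g_def using square_integrable_Q(1)[of a] by simp
    show "g \<in> borel_measurable (F a)" unfolding g_def[abs_def] using XF by measurable
    fix A assume A: "A \<in> sets (F a)"
    then have AM: "A \<in> sets Q" using sets_F_M by (simp add: sets_Q)
    have i: "integrable Q (\<lambda>\<omega>. indicator A \<omega> * poly q (X0 r \<omega>))" if "degree q \<le> 2" for q r
      using integrable_mult_indicator[OF AM integrable_poly_Q[OF that, of r]] by simp
    note k1 = key[OF A _ q_nonneg(1)] and k2 = key[OF A _ q_nonneg(2)]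
    have "(\<integral>\<omega>. indicator A \<omega> * X0 (a + c) \<omega> \<partial>Q)
        = (\<integral>\<omega>. indicator A \<omega> * poly [:1, 1, 1:] (X0 (a + c) \<omega>) - indicator A \<omega> * poly [:1, 0, 1:] (X0 (a + c) \<omega>) \<partial>Q)"
      by (intro Bochner_Integration.integral_cong) (auto simp: algebra_simps)
    also have "\<dots> = (\<integral>\<omega>. indicator A \<omega> * poly [:1, 1, 1:] (X0 (a + c) \<omega>) \<partial>Q) - (\<integral>\<omega>. indicator A \<omega> * poly [:1, 0, 1:] (X0 (a + c) \<omega>) \<partial>Q)"
      by (intro Bochner_Integration.integral_diff i) auto
    also have "\<dots> = (\<integral>\<omega>. indicator A \<omega> * mean [:1, 1, 1:] c (X0 a \<omega>) \<partial>Q) - (\<integral>\<omega>. indicator A \<omega> * mean [:1, 0, 1:] c (X0 a \<omega>) \<partial>Q)"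
      using k1 k2 by simp
    also have "\<dots> = (\<integral>\<omega>. indicator A \<omega> * mean [:1, 1, 1:] c (X0 a \<omega>) - indicator A \<omega> * mean [:1, 0, 1:] c (X0 a \<omega>) \<partial>Q)"
      using k1 k2 by (intro Bochner_Integration.integral_diff[symmetric]) auto
    also have "\<dots> = (\<integral>\<omega>. indicator A \<omega> * g \<omega> \<partial>Q)"
    proof (rule Bochner_Integration.integral_cong)
      fix \<omega> assume "\<omega> \<in> space Q"
      then have y: "X0 a \<omega> \<in> S" by (intro X0_in_S) (simp add: space_Q)
      have "mean [:1, 1, 1:] c (X0 a \<omega>) - mean [:1, 0, 1:] c (X0 a \<omega>) = mean ([:1, 1, 1:] - [:1, 0, 1:]) c (X0 a \<omega>)"
        by (rule mean_add(2)[OF y c, symmetric]) auto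
      also have "\<dots> = g \<omega>" using revert[OF y c] by (simp add: g_def)
      finally show "indicator A \<omega> * mean [:1, 1, 1:] c (X0 a \<omega>) - indicator A \<omega> * mean [:1, 0, 1:] c (X0 a \<omega>) = indicator A \<omega> * g \<omega>"
        by (simp add: right_diff_distrib[symmetric])
    qed simp
    finally show "(LINT \<omega>:A|Q. X0 (a + c) \<omega>) = (LINT \<omega>:A|Q. g \<omega>)"
      by (simp add: set_lebesgue_integral_def)
  qed
  then show ?thesis by (simp add: g_def)
qed

lemma integrable_product_Q: "integrable Q (\<lambda>\<omega>. X0 a \<omega> * X0 b \<omega>)" "(\<integral>\<omega>. \<bar>X0 a \<omega> * X0 b \<omega>\<bar> \<partial>Q) \<le> 2 * mu_square"
proof -
  have le: "\<bar>u * v\<bar> \<le> u\<^sup>2 + v\<^sup>2" for u v :: real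
  proof -
    have "2 * \<bar>u\<bar> * \<bar>v\<bar> \<le> u\<^sup>2 + v\<^sup>2" using sum_squares_bound[of "\<bar>u\<bar>" "\<bar>v\<bar>"] by simp
    moreover have "0 \<le> \<bar>u\<bar> * \<bar>v\<bar>" by simp
    ultimately show ?thesis unfolding abs_mult by linarith
  qed
  have int: "integrable Q (\<lambda>\<omega>. (X0 a \<omega>)\<^sup>2 + (X0 b \<omega>)\<^sup>2)"
    using square_integrable_Q by auto
  show 1: "integrable Q (\<lambda>\<omega>. X0 a \<omega> * X0 b \<omega>)"
    by (rule Bochner_Integration.integrable_bound[OF int])
       (unfold measurable_Q_cong, measurable, use le in \<open>auto intro!: AE_I2 order_trans[OF _ abs_ge_self]\<close>)
  have "(\<integral>\<omega>. \<bar>X0 a \<omega> * X0 b \<omega>\<bar> \<partial>Q) \<le> (\<integral>\<omega>. (X0 a \<omega>)\<^sup>2 + (X0 b \<omega>)\<^sup>2 \<partial>Q)"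
    using 1 int le by (intro integral_mono) auto
  also have "\<dots> = 2 * mu_square" using square_integrable_Q by (simp add: moments_Q)
  finally show "(\<integral>\<omega>. \<bar>X0 a \<omega> * X0 b \<omega>\<bar> \<partial>Q) \<le> 2 * mu_square" .
qed

lemma product_moment_forward:
  assumes a: "0 \<le> a" and c: "0 \<le> c"
  shows "(\<integral>\<omega>. X0 a \<omega> * X0 (a + c) \<omega> \<partial>Q) = mu_mean\<^sup>2 + exp (- \<beta> * c) * (mu_square - mu_mean\<^sup>2)"
proof -
  interpret prob_space Q by (rule prob_Q)
  interpret sigma_finite_subalgebra Q "F a" by (rule cond_exp_Q)
  have XF: "X0 a \<in> borel_measurable (F a)" using X_measurable_F[OF a] a by (simp add: X0_def[abs_def])
  have Xm: "X0 b \<in> borel_measurable Q" for b unfolding measurable_Q_cong by measurable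
  have "(\<integral>\<omega>. X0 a \<omega> * X0 (a + c) \<omega> \<partial>Q) = (\<integral>\<omega>. X0 a \<omega> * real_cond_exp Q (F a) (X0 (a + c)) \<omega> \<partial>Q)"
    by (rule real_cond_exp_intg(2)[OF integrable_product_Q(1) XF Xm, symmetric])
  also have "\<dots> = (\<integral>\<omega>. X0 a \<omega> * (mu_mean + exp (- \<beta> * c) * (X0 a \<omega> - mu_mean)) \<partial>Q)"
  proof (rule integral_cong_AE)
    show "(\<lambda>\<omega>. X0 a \<omega> * real_cond_exp Q (F a) (X0 (a + c)) \<omega>) \<in> borel_measurable Q"
      using Xm by measurable
    show "(\<lambda>\<omega>. X0 a \<omega> * (mu_mean + exp (- \<beta> * c) * (X0 a \<omega> - mu_mean))) \<in> borel_measurable Q"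
      using Xm by measurable
    show "AE \<omega> in Q. X0 a \<omega> * real_cond_exp Q (F a) (X0 (a + c)) \<omega> = X0 a \<omega> * (mu_mean + exp (- \<beta> * c) * (X0 a \<omega> - mu_mean))"
      using cond_exp_X[OF a c] by eventually_elim simp
  qed
  also have "\<dots> = (\<integral>\<omega>. (mu_mean - exp (- \<beta> * c) * mu_mean) * X0 a \<omega> + exp (- \<beta> * c) * (X0 a \<omega>)\<^sup>2 \<partial>Q)"
    by (intro Bochner_Integration.integral_cong) (auto simp: power2_eq_square algebra_simps)
  also have "\<dots> = (mu_mean - exp (- \<beta> * c) * mu_mean) * mu_mean + exp (- \<beta> * c) * mu_square"
    using square_integrable_Q[of a] by (simp add: moments_Q del: X0_eq)
  finally show ?thesis by (simp add: power2_eq_square algebra_simps)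
qed

text \<open>
  The autocovariance is the variance times exp (- \<beta> * \<bar>a - b\<bar>): conditioning on
  the earlier time leaves the factor exp (- \<beta> * c) in front of the deviation from the
  mean.
\<close>

lemma product_moment:
  assumes "0 \<le> a" "0 \<le> b"
  shows "(\<integral>\<omega>. X0 a \<omega> * X0 b \<omega> \<partial>Q) = mu_mean\<^sup>2 + exp (- \<beta> * \<bar>a - b\<bar>) * (mu_square - mu_mean\<^sup>2)"
proof (cases "a \<le> b")
  case True
  then show ?thesis using product_moment_forward[of a "b - a"] assms by simp
next
  case False
  then show ?thesis using product_moment_forward[of b "a - b"] assms by (simp add: mult.commute)
qed

end

section \<open>Independent random times\<close>

text \<open>
  Integration first over the process with the random times frozen, then over the times. The
  identity on the sample space is viewed as a pair of maps into the two sigma-algebras MX and MS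
  generated by the paths of X and of \<sigma>; independence says that its law on their product
  is a product measure. The value of X at a time that depends on \<sigma> is jointly measurable
  there because the paths of X are right-continuous. The assumption T says that the times are
  functionals of \<sigma>.
\<close>

lemma independent_time_change:
  fixes X \<sigma> :: "real \<Rightarrow> 'a \<Rightarrow> real" and f :: "real \<times> real \<Rightarrow> real"
  assumes prob: "prob_space Q" and indep: "independent_processes Q X \<sigma>"
    and cadlag: "\<And>\<omega>. \<omega> \<in> space Q \<Longrightarrow> cadlag (\<lambda>t. X t \<omega>)"
    and T: "\<And>N. space N = space Q \<Longrightarrow> (\<And>t. 0 \<le> t \<Longrightarrow> \<sigma> t \<in> borel_measurable N) \<Longrightarrow> T1 \<in> borel_measurable N \<and> T2 \<in> borel_measurable N"
    and f [measurable]: "f \<in> borel_measurable (borel \<Otimes>\<^sub>M borel)"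
    and int: "\<And>a b. integrable Q (\<lambda>\<omega>. f (X (max 0 a) \<omega>, X (max 0 b) \<omega>))"
    and bd: "\<And>a b. (\<integral>\<omega>. \<bar>f (X (max 0 a) \<omega>, X (max 0 b) \<omega>)\<bar> \<partial>Q) \<le> C"
  shows "(\<integral>\<omega>. f (X (max 0 (T1 \<omega>)) \<omega>, X (max 0 (T2 \<omega>)) \<omega>) \<partial>Q)
    = (\<integral>\<omega>. (\<integral>\<omega>'. f (X (max 0 (T1 \<omega>)) \<omega>', X (max 0 (T2 \<omega>)) \<omega>') \<partial>Q) \<partial>Q)"
proof -
  interpret prob_space Q by (rule prob)
  define Pi where "Pi = (\<Pi>\<^sub>M t\<in>{0::real..}. (borel :: real measure))"
  define Xp where "Xp \<omega> = (\<lambda>t\<in>{0..}. X t \<omega>)" for \<omega>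
  define Sp where "Sp \<omega> = (\<lambda>t\<in>{0..}. \<sigma> t \<omega>)" for \<omega>
  have ind: "indep_var Pi Xp Pi Sp" using indep by (simp add: independent_processes_def Pi_def Xp_def[abs_def] Sp_def[abs_def])
  have Xp_rv: "Xp \<in> measurable Q Pi" and Sp_rv: "Sp \<in> measurable Q Pi"
    using indep_var_rv1[OF ind] indep_var_rv2[OF ind] by auto
  define MX where "MX = vimage_algebra (space Q) Xp Pi"
  define MS where "MS = vimage_algebra (space Q) Sp Pi"
  have spaces: "space MX = space Q" "space MS = space Q" by (simp_all add: MX_def MS_def)
  have Xp_MX: "Xp \<in> measurable MX Pi" and Sp_MS: "Sp \<in> measurable MS Pi"
    unfolding MX_def MS_def using measurable_space[OF Xp_rv] measurable_space[OF Sp_rv]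
    by (auto intro!: measurable_vimage_algebra1)
  have id_MX: "(\<lambda>\<omega>. \<omega>) \<in> measurable Q MX" and id_MS: "(\<lambda>\<omega>. \<omega>) \<in> measurable Q MS"
    unfolding MX_def MS_def using Xp_rv Sp_rv by (auto intro!: measurable_vimage_algebra2)
  have ind': "indep_var MX (\<lambda>\<omega>. \<omega>) MS (\<lambda>\<omega>. \<omega>)"
  proof -
    have 1: "{(\<lambda>\<omega>. \<omega>) -` A \<inter> space Q |A. A \<in> sets MX} = {Xp -` A \<inter> space Q |A. A \<in> sets Pi}"
      unfolding MX_def using measurable_space[OF Xp_rv] by (subst sets_vimage_algebra2) auto
    have 2: "{(\<lambda>\<omega>. \<omega>) -` A \<inter> space Q |A. A \<in> sets MS} = {Sp -` A \<inter> space Q |A. A \<in> sets Pi}"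
      unfolding MS_def using measurable_space[OF Sp_rv] by (subst sets_vimage_algebra2) auto
    show ?thesis using ind id_MX id_MS unfolding indep_var_eq 1 2 by simp
  qed
  have X_MX: "X t \<in> borel_measurable MX" if "0 \<le> t" for t
  proof -
    have "(\<lambda>\<omega>. Xp \<omega> t) \<in> borel_measurable MX"
      using measurable_compose[OF Xp_MX, of "\<lambda>x. x t" borel] that by (simp add: Pi_def)
    with that show ?thesis by (simp add: Xp_def)
  qed
  have S_MS: "\<sigma> t \<in> borel_measurable MS" if "0 \<le> t" for t
  proof -
    have "(\<lambda>\<omega>. Sp \<omega> t) \<in> borel_measurable MS"
      using measurable_compose[OF Sp_MS, of "\<lambda>x. x t" borel] that by (simp add: Pi_def)
    with that show ?thesis by (simp add: Sp_def)
  qed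
  have T_MS [measurable]: "T1 \<in> borel_measurable MS" "T2 \<in> borel_measurable MS"
    using T[OF spaces(2) S_MS] by auto
  \<comment> \<open>independence of the paths, as a statement about the diagonal map\<close>
  have law: "distr Q MX (\<lambda>\<omega>. \<omega>) \<Otimes>\<^sub>M distr Q MS (\<lambda>\<omega>. \<omega>) = distr Q (MX \<Otimes>\<^sub>M MS) (\<lambda>\<omega>. (\<omega>, \<omega>))"
    using ind' unfolding indep_var_distribution_eq by simp
  define D1 where "D1 = distr Q MX (\<lambda>\<omega>. \<omega>)"
  define D2 where "D2 = distr Q MS (\<lambda>\<omega>. \<omega>)"
  interpret D1: prob_space D1 unfolding D1_def by (rule prob_space_distr[OF id_MX])
  interpret D2: prob_space D2 unfolding D2_def by (rule prob_space_distr[OF id_MS])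
  interpret D: pair_sigma_finite D1 D2 ..
  define G where "G \<omega> \<eta> = f (X (max 0 (T1 \<eta>)) \<omega>, X (max 0 (T2 \<eta>)) \<omega>)" for \<omega> \<eta>
  have XJ: "(\<lambda>(t, \<omega>). X (max 0 t) \<omega>) \<in> borel_measurable (borel \<Otimes>\<^sub>M MX)"
    by (rule cadlag_joint_measurable[OF X_MX]) (auto simp: spaces cadlag)
  have XJ' [measurable (raw)]: "(\<lambda>y. X (max 0 (u y)) (k y)) \<in> borel_measurable N"
    if "u \<in> borel_measurable N" "k \<in> measurable N MX" for u k and N :: "'n measure"
    using measurable_compose[OF measurable_Pair[OF that] XJ] by simp
  have G_meas: "case_prod G \<in> borel_measurable (MX \<Otimes>\<^sub>M MS)"
    unfolding G_def by measurable
  have DD: "measurable (D1 \<Otimes>\<^sub>M D2) N = measurable (MX \<Otimes>\<^sub>M MS) N" for N :: "'n measure"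
    by (intro measurable_cong_sets sets_pair_measure_cong) (auto simp: D1_def D2_def)
  have G_sec: "(\<lambda>\<omega>. G \<omega> p) \<in> borel_measurable MX" for p unfolding G_def by measurable
  have G_int: "integrable (D1 \<Otimes>\<^sub>M D2) (case_prod G)"
  proof (rule integrableI_bounded)
    show "case_prod G \<in> borel_measurable (D1 \<Otimes>\<^sub>M D2)" unfolding DD by (rule G_meas)
    have "(\<integral>\<^sup>+p. ennreal (norm (case_prod G p)) \<partial>(D1 \<Otimes>\<^sub>M D2)) = (\<integral>\<^sup>+p. (\<integral>\<^sup>+\<omega>. ennreal \<bar>G \<omega> p\<bar> \<partial>D1) \<partial>D2)"
      using G_meas by (subst D.nn_integral_snd[symmetric]) (auto simp: DD case_prod_beta')
    also have "\<dots> \<le> (\<integral>\<^sup>+p. ennreal C \<partial>D2)"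
    proof (rule nn_integral_mono)
      fix p
      have "(\<integral>\<^sup>+\<omega>. ennreal \<bar>G \<omega> p\<bar> \<partial>D1) = (\<integral>\<^sup>+\<omega>. ennreal \<bar>G \<omega> p\<bar> \<partial>Q)"
        unfolding D1_def using G_sec by (intro nn_integral_distr id_MX) simp
      also have "\<dots> = ennreal (\<integral>\<omega>. \<bar>G \<omega> p\<bar> \<partial>Q)"
        unfolding G_def by (intro nn_integral_eq_integral integrable_abs int) simp
      also have "\<dots> \<le> ennreal C" unfolding G_def by (intro ennreal_leI bd)
      finally show "(\<integral>\<^sup>+\<omega>. ennreal \<bar>G \<omega> p\<bar> \<partial>D1) \<le> ennreal C" .
    qed
    also have "\<dots> < \<infinity>" by (simp add: D2.emeasure_space_1)
    finally show "(\<integral>\<^sup>+p. ennreal (norm (case_prod G p)) \<partial>(D1 \<Otimes>\<^sub>M D2)) < \<infinity>" .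
  qed
  have idT: "(\<lambda>\<omega>. (\<omega>, \<omega>)) \<in> measurable Q (MX \<Otimes>\<^sub>M MS)"
    by (rule measurable_Pair[OF id_MX id_MS])
  have "(\<integral>\<omega>. f (X (max 0 (T1 \<omega>)) \<omega>, X (max 0 (T2 \<omega>)) \<omega>) \<partial>Q) = (\<integral>\<omega>. case_prod G (\<omega>, \<omega>) \<partial>Q)"
    by (simp add: G_def)
  also have "\<dots> = (\<integral>z. case_prod G z \<partial>(D1 \<Otimes>\<^sub>M D2))"
    unfolding D1_def D2_def law by (rule integral_distr[OF idT G_meas, symmetric])
  also have "\<dots> = (\<integral>p. (\<integral>\<omega>. G \<omega> p \<partial>D1) \<partial>D2)"
    by (rule D.integral_snd[OF G_int, symmetric])
  also have "\<dots> = (\<integral>p. (\<integral>\<omega>. G \<omega> p \<partial>Q) \<partial>D2)"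
    unfolding D1_def using G_sec by (subst integral_distr[OF id_MX]) auto
  also have "\<dots> = (\<integral>\<omega>. (\<integral>\<omega>'. G \<omega>' \<omega> \<partial>Q) \<partial>Q)"
  proof -
    have "(\<lambda>p. \<integral>\<omega>. G \<omega> p \<partial>D1) \<in> borel_measurable D2"
      by (rule borel_measurable_integrable[OF D.integrable_snd[OF G_int]])
    then have "(\<lambda>p. \<integral>\<omega>. G \<omega> p \<partial>Q) \<in> borel_measurable D2"
      unfolding D1_def using G_sec by (subst (asm) integral_distr[OF id_MX]) auto
    then show ?thesis unfolding D2_def by (intro integral_distr[OF id_MS]) simp
  qed
  finally show ?thesis by (simp add: G_def)
qed

context reverting_process
begin

text \<open>
  Independent time changes leave the first two moments untouched, because these do not depend on
  the time, and average the autocovariance.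
\<close>

lemma correlation_time_change:
  fixes \<sigma> :: "real \<Rightarrow> 'a \<Rightarrow> real"
  assumes indep: "independent_processes Q X \<sigma>" and var: "mu_square - mu_mean\<^sup>2 \<noteq> 0"
    and T: "\<And>N. space N = space Q \<Longrightarrow> (\<And>t. 0 \<le> t \<Longrightarrow> \<sigma> t \<in> borel_measurable N) \<Longrightarrow> T1 \<in> borel_measurable N \<and> T2 \<in> borel_measurable N"
    and nonneg: "\<And>\<omega>. 0 \<le> T1 \<omega>" "\<And>\<omega>. 0 \<le> T2 \<omega>"
  shows "correlation Q (\<lambda>\<omega>. X (T1 \<omega>) \<omega>) (\<lambda>\<omega>. X (T2 \<omega>) \<omega>) = (\<integral>\<omega>. exp (- \<beta> * \<bar>T1 \<omega> - T2 \<omega>\<bar>) \<partial>Q)"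
proof -
  interpret prob_space Q by (rule prob_Q)
  have cadlag: "cadlag (\<lambda>t. X t \<omega>)" if "\<omega> \<in> space Q" for \<omega>
    using that by (intro cadlag_paths) (simp add: space_Q)
  have [measurable]: "T1 \<in> borel_measurable Q" "T2 \<in> borel_measurable Q"
  proof -
    have "\<sigma> t \<in> borel_measurable Q" if "0 \<le> t" for t
    proof -
      have "(\<lambda>\<omega>. \<lambda>t\<in>{0..}. \<sigma> t \<omega>) \<in> measurable Q (\<Pi>\<^sub>M t\<in>{0..}. borel)"
        using indep unfolding independent_processes_def by (rule indep_var_rv2)
      from measurable_compose[OF this measurable_component_singleton[of t]] that show ?thesis by simp
    qed
    with T[OF refl] show "T1 \<in> borel_measurable Q" "T2 \<in> borel_measurable Q" by auto
  qed
  have first: "(\<integral>\<omega>. X (U \<omega>) \<omega> \<partial>Q) = mu_mean" and second: "(\<integral>\<omega>. (X (U \<omega>) \<omega>)\<^sup>2 \<partial>Q) = mu_square"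
    if U: "\<And>N. space N = space Q \<Longrightarrow> (\<And>t. 0 \<le> t \<Longrightarrow> \<sigma> t \<in> borel_measurable N) \<Longrightarrow> U \<in> borel_measurable N"
      "\<And>\<omega>. 0 \<le> U \<omega>" for U
  proof -
    have abs: "(\<integral>\<omega>. \<bar>X0 a \<omega>\<bar> \<partial>Q) \<le> 1 + mu_square" for a
    proof -
      have le: "\<bar>y\<bar> \<le> 1 + y\<^sup>2" for y :: real
        using zero_le_power2[of "\<bar>y\<bar> - 1"] by (simp add: power2_diff)
      have "(\<integral>\<omega>. \<bar>X0 a \<omega>\<bar> \<partial>Q) \<le> (\<integral>\<omega>. 1 + (X0 a \<omega>)\<^sup>2 \<partial>Q)"
        using square_integrable_Q[of a] le by (intro integral_mono) auto
      then show ?thesis using square_integrable_Q[of a] by (simp add: moments_Q prob_space)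
    qed
    have "(\<integral>\<omega>. X0 (U \<omega>) \<omega> \<partial>Q) = (\<integral>\<omega>. (\<integral>\<omega>'. X0 (U \<omega>) \<omega>' \<partial>Q) \<partial>Q)"
      using independent_time_change[OF prob_Q indep cadlag, of U U fst "1 + mu_square"] U(1) square_integrable_Q(1) abs
      by (simp add: X0_def[abs_def])
    also have "\<dots> = mu_mean" unfolding moments_Q by (simp add: prob_space)
    finally show "(\<integral>\<omega>. X (U \<omega>) \<omega> \<partial>Q) = mu_mean" by (simp add: U(2))
    have "(\<integral>\<omega>. (X0 (U \<omega>) \<omega>)\<^sup>2 \<partial>Q) = (\<integral>\<omega>. (\<integral>\<omega>'. (X0 (U \<omega>) \<omega>')\<^sup>2 \<partial>Q) \<partial>Q)"
      using independent_time_change[OF prob_Q indep cadlag, of U U "\<lambda>p. (fst p)\<^sup>2" mu_square] U(1) square_integrable_Q(2) moments_Q(2)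
      by (simp add: X0_def[abs_def])
    also have "\<dots> = mu_square" unfolding moments_Q by (simp add: prob_space)
    finally show "(\<integral>\<omega>. (X (U \<omega>) \<omega>)\<^sup>2 \<partial>Q) = mu_square" by (simp add: U(2))
  qed
  have "(\<integral>\<omega>. X0 (T1 \<omega>) \<omega> * X0 (T2 \<omega>) \<omega> \<partial>Q) = (\<integral>\<omega>. (\<integral>\<omega>'. X0 (T1 \<omega>) \<omega>' * X0 (T2 \<omega>) \<omega>' \<partial>Q) \<partial>Q)"
  proof -
    have "(\<integral>\<omega>. (\<lambda>p. fst p * snd p) (X (max 0 (T1 \<omega>)) \<omega>, X (max 0 (T2 \<omega>)) \<omega>) \<partial>Q)
        = (\<integral>\<omega>. (\<integral>\<omega>'. (\<lambda>p. fst p * snd p) (X (max 0 (T1 \<omega>)) \<omega>', X (max 0 (T2 \<omega>)) \<omega>') \<partial>Q) \<partial>Q)"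
    proof (rule independent_time_change[OF prob_Q indep cadlag T])
      show "(\<lambda>p. fst p * snd p) \<in> borel_measurable ((borel :: real measure) \<Otimes>\<^sub>M borel)" by measurable
      show "integrable Q (\<lambda>\<omega>. fst (X (max 0 a) \<omega>, X (max 0 b) \<omega>) * snd (X (max 0 a) \<omega>, X (max 0 b) \<omega>))" for a b
        using integrable_product_Q(1)[of a b] by (simp only: X0_def fst_conv snd_conv)
      show "(\<integral>\<omega>. \<bar>fst (X (max 0 a) \<omega>, X (max 0 b) \<omega>) * snd (X (max 0 a) \<omega>, X (max 0 b) \<omega>)\<bar> \<partial>Q) \<le> 2 * mu_square" for a b
        using integrable_product_Q(2)[of a b] by (simp only: X0_def fst_conv snd_conv)
    qed
    then show ?thesis by (simp only: X0_def fst_conv snd_conv)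
  qed
  also have "\<dots> = (\<integral>\<omega>. mu_mean\<^sup>2 + exp (- \<beta> * \<bar>T1 \<omega> - T2 \<omega>\<bar>) * (mu_square - mu_mean\<^sup>2) \<partial>Q)"
    by (intro Bochner_Integration.integral_cong refl product_moment nonneg)
  also have "\<dots> = mu_mean\<^sup>2 + (\<integral>\<omega>. exp (- \<beta> * \<bar>T1 \<omega> - T2 \<omega>\<bar>) \<partial>Q) * (mu_square - mu_mean\<^sup>2)"
  proof -
    have "integrable Q (\<lambda>\<omega>. exp (- \<beta> * \<bar>T1 \<omega> - T2 \<omega>\<bar>))"
      by (rule integrable_const_bound[where B = 1]) (use \<beta> in auto)
    then show ?thesis by (simp add: prob_space)
  qed
  finally have cross: "(\<integral>\<omega>. X (T1 \<omega>) \<omega> * X (T2 \<omega>) \<omega> \<partial>Q)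
      = mu_mean\<^sup>2 + (\<integral>\<omega>. exp (- \<beta> * \<bar>T1 \<omega> - T2 \<omega>\<bar>) \<partial>Q) * (mu_square - mu_mean\<^sup>2)"
    by (simp add: nonneg)
  have "0 \<le> (\<integral>\<omega>. (X0 0 \<omega> - mu_mean)\<^sup>2 \<partial>Q)" by simp
  also have "\<dots> = (\<integral>\<omega>. (X0 0 \<omega>)\<^sup>2 - 2 * mu_mean * X0 0 \<omega> + mu_mean\<^sup>2 \<partial>Q)"
    by (intro Bochner_Integration.integral_cong) (auto simp: power2_diff algebra_simps)
  also have "\<dots> = mu_square - mu_mean\<^sup>2"
    using square_integrable_Q[of 0] moments_Q[of 0] by (simp add: prob_space power2_eq_square del: X0_eq)
  finally have "0 < mu_square - mu_mean\<^sup>2" using var by simp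
  moreover have "(\<integral>\<omega>. X (T1 \<omega>) \<omega> \<partial>Q) = mu_mean"
    by (rule first[OF _ nonneg(1)], drule T, assumption) simp
  moreover have "(\<integral>\<omega>. (X (T1 \<omega>) \<omega>)\<^sup>2 \<partial>Q) = mu_square"
    by (rule second[OF _ nonneg(1)], drule T, assumption) simp
  moreover have "(\<integral>\<omega>. X (T2 \<omega>) \<omega> \<partial>Q) = mu_mean"
    by (rule first[OF _ nonneg(2)], drule T, assumption) simp
  moreover have "(\<integral>\<omega>. (X (T2 \<omega>) \<omega>)\<^sup>2 \<partial>Q) = mu_square"
    by (rule second[OF _ nonneg(2)], drule T, assumption) simp
  ultimately show ?thesis
    unfolding correlation_def cross by (simp add: power2_eq_square[of mu_mean])
qed

end

section \<open>Moments, exponential and Gamma integrals\<close>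

text \<open>
  On a bounded set the characteristic function is the sum of its Taylor series, whose
  coefficients are the moments.
\<close>

lemma moments_determine_distribution:
  fixes M N :: "real measure"
  assumes M: "real_distribution M" "AE x in M. \<bar>x\<bar> \<le> 1"
    and N: "real_distribution N" "AE x in N. \<bar>x\<bar> \<le> 1"
    and moments: "\<And>n. (\<integral>x. x ^ n \<partial>M) = (\<integral>x. x ^ n \<partial>N)"
  shows "M = N"
proof (rule Levy_uniqueness[OF M(1) N(1)], rule ext)
  fix t :: real
  have char_bound: "integrable D (\<lambda>x. x ^ n) \<and> (\<integral>x. \<bar>x\<bar> ^ n \<partial>D) \<le> 1"
    if D: "real_distribution D" "AE x in D. \<bar>x\<bar> \<le> 1" for D :: "real measure" and n
  proof -
    interpret D: real_distribution D by fact
    have 1: "AE x in D. \<bar>x\<bar> ^ n \<le> 1"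
      using D(2) by eventually_elim (simp add: power_le_one)
    have *: "integrable D (\<lambda>x. x ^ n)"
      by (rule D.integrable_const_bound[where B = 1]) (use 1 in \<open>auto simp: power_abs\<close>)
    moreover have "(\<integral>x. \<bar>x\<bar> ^ n \<partial>D) \<le> 1"
      using integrable_abs[OF *] 1 by (intro D.integral_le_const) (auto simp: power_abs)
    ultimately show ?thesis by simp
  qed
  define T where "T D n = (\<Sum>k\<le>n. (\<i> * t)^k / fact k * complex_of_real (\<integral>x. x ^ k \<partial>D))"
    for n and D :: "real measure"
  have approx: "cmod (char D t - T D n) \<le> 2 * \<bar>t\<bar> ^ n / fact n"
    if D: "real_distribution D" "AE x in D. \<bar>x\<bar> \<le> 1" for D :: "real measure" and n
  proof -
    interpret D: real_distribution D by fact
    have "cmod (char D t - T D n) \<le> (2 * \<bar>t\<bar> ^ n / fact n) * (\<integral>x. \<bar>x\<bar> ^ n \<partial>D)"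
      unfolding T_def using char_bound[OF D] by (intro D.char_approx1) auto
    also have "\<dots> \<le> (2 * \<bar>t\<bar> ^ n / fact n) * 1"
      using char_bound[OF D] by (intro mult_left_mono) auto
    finally show ?thesis by simp
  qed
  have "cmod (char M t - char N t) \<le> 4 * (\<bar>t\<bar> ^ n / fact n)" for n
  proof -
    have "T M n = T N n" by (simp add: T_def moments)
    then have "char M t - char N t = (char M t - T M n) - (char N t - T N n)" by simp
    then have "cmod (char M t - char N t) \<le> cmod (char M t - T M n) + cmod (char N t - T N n)"
      by (metis norm_triangle_ineq4)
    with approx[OF M, of n] approx[OF N, of n] show ?thesis by simp
  qed
  moreover have "(\<lambda>n. 4 * (\<bar>t\<bar> ^ n / fact n)) \<longlonglongrightarrow> 4 * 0"
    using summable_LIMSEQ_zero[OF summable_exp[of "\<bar>t\<bar>"]]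
    by (intro tendsto_mult_left) (simp add: divide_inverse mult.commute)
  ultimately have "cmod (char M t - char N t) \<le> 0"
    by (intro LIMSEQ_le_const) auto
  then show "char M t = char N t" by simp
qed

lemma nn_integral_exp_tail:
  assumes "l > 0"
  shows "(\<integral>\<^sup>+s. ennreal (l * exp (- l * s)) * indicator {c..} s \<partial>lborel) = ennreal (exp (- l * c))"
proof -
  have "filterlim (\<lambda>s. - l * s) at_bot at_top"
    by (rule filterlim_tendsto_neg_mult_at_bot[OF tendsto_const _ filterlim_ident]) (use assms in simp)
  then have "((\<lambda>s. - exp (- l * s)) \<longlongrightarrow> - 0) at_top"
    by (intro tendsto_minus filterlim_compose[OF exp_at_bot])
  then have "(\<integral>\<^sup>+s. ennreal (l * exp (- l * s)) * indicator {c..} s \<partial>lborel)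
      = ennreal (- 0 - (- exp (- l * c)))"
    using assms by (intro nn_integral_FTC_atLeast) (auto intro!: derivative_eq_intros)
  then show ?thesis by simp
qed

lemma nn_integral_Gamma_scaled:
  fixes a c :: real
  assumes a: "a > 0" and c: "c > 0"
  shows "(\<integral>\<^sup>+y. (if 0 < y then ennreal (exp (- c * y) * y powr (a - 1)) else 0) \<partial>lborel)
    = ennreal (Gamma a * c powr (- a))"
proof -
  let ?f = "\<lambda>t. ennreal (indicator {0..} t * t powr (a - 1) / exp t) :: ennreal"
  have "ennreal (Gamma a) = \<bar>c\<bar> * (\<integral>\<^sup>+y. ?f (0 + c * y) \<partial>lborel)"
    unfolding Gamma_conv_nn_integral_real[OF a] by (rule nn_integral_real_affine) (use c in auto)
  also have "(\<integral>\<^sup>+y. ?f (0 + c * y) \<partial>lborel)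
      = (\<integral>\<^sup>+y. ennreal (c powr (a - 1)) * (if 0 < y then ennreal (exp (- c * y) * y powr (a - 1)) else 0) \<partial>lborel)"
  proof (rule nn_integral_cong)
    fix y :: real
    show "?f (0 + c * y) = ennreal (c powr (a - 1)) * (if 0 < y then ennreal (exp (- c * y) * y powr (a - 1)) else 0)"
      using c by (cases "y < 0"; cases "y = 0")
        (auto simp: indicator_def powr_mult exp_minus field_simps ennreal_mult[symmetric] zero_le_mult_iff)
  qed
  also have "\<dots> = ennreal (c powr (a - 1)) * (\<integral>\<^sup>+y. (if 0 < y then ennreal (exp (- c * y) * y powr (a - 1)) else 0) \<partial>lborel)"
    by (rule nn_integral_cmult) measurable
  finally have "ennreal (Gamma a) = ennreal (c powr a) *
      (\<integral>\<^sup>+y. (if 0 < y then ennreal (exp (- c * y) * y powr (a - 1)) else 0) \<partial>lborel)"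
    using c by (simp add: mult.assoc[symmetric] ennreal_mult[symmetric] powr_diff)
  then have "ennreal (c powr (- a)) * ennreal (Gamma a) = ennreal (c powr (- a) * c powr a) *
      (\<integral>\<^sup>+y. (if 0 < y then ennreal (exp (- c * y) * y powr (a - 1)) else 0) \<partial>lborel)"
    by (simp add: ennreal_mult mult.assoc)
  also have "c powr (- a) * c powr a = 1" using c by (simp add: powr_minus)
  finally show ?thesis using a c by (simp add: ennreal_mult[symmetric] Gamma_real_nonneg less_imp_le mult.commute)
qed

text \<open>
  The Gamma integral restricted to [c, \<infinity>) shows Gamma (a * n + 1) \<ge> c powr (a * n)
  * exp (- c). With c powr a \<ge> 2 * x the quotient decays geometrically.
\<close>

lemma power_over_Gamma_tendsto_zero:
  fixes a x :: real
  assumes a: "a > 0" and x: "x \<ge> 0"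
  shows "(\<lambda>n. x ^ n / Gamma (a * real n + 1)) \<longlonglongrightarrow> 0"
proof -
  \<comment> \<open>c powr a = 2 * (x + 1), which also covers x = 0\<close>
  define c where "c = (2 * (x + 1)) powr (1 / a)"
  have c: "c > 0" "c powr a = 2 * (x + 1)" using x a by (auto simp: c_def powr_powr)
  have Gamma_ge: "c powr (a * real n) * exp (- c) \<le> Gamma (a * real n + 1)" for n
  proof -
    have an: "0 \<le> a * real n" using a by simp
    have "ennreal (c powr (a * real n) * exp (- c))
        = ennreal (c powr (a * real n)) * (\<integral>\<^sup>+s. ennreal (1 * exp (- 1 * s)) * indicator {c..} s \<partial>lborel)"
      by (subst nn_integral_exp_tail) (auto simp: ennreal_mult)
    also have "\<dots> = (\<integral>\<^sup>+s. ennreal (c powr (a * real n)) * (ennreal (1 * exp (- 1 * s)) * indicator {c..} s) \<partial>lborel)"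
      by (rule nn_integral_cmult[symmetric]) measurable
    also have "\<dots> \<le> (\<integral>\<^sup>+t. ennreal (indicator {0..} t * t powr (a * real n + 1 - 1) / exp t) \<partial>lborel)"
    proof (rule nn_integral_mono)
      fix s :: real
      show "ennreal (c powr (a * real n)) * (ennreal (1 * exp (- 1 * s)) * indicator {c..} s)
          \<le> ennreal (indicator {0..} s * s powr (a * real n + 1 - 1) / exp s)"
      proof (cases "c \<le> s")
        case True
        then have "c powr (a * real n) \<le> s powr (a * real n)" using c an by (intro powr_mono2) auto
        with True c show ?thesis
          by (simp add: exp_minus field_simps ennreal_mult[symmetric] divide_right_mono)
      qed simp
    qed
    also have "\<dots> = ennreal (Gamma (a * real n + 1))"
      using an by (intro Gamma_conv_nn_integral_real[symmetric]) simp
    finally show ?thesis using an by (simp add: ennreal_le_iff Gamma_real_nonneg)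
  qed
  have "x ^ n / Gamma (a * real n + 1) \<le> exp c * (1 / 2) ^ n" for n
  proof -
    have pos: "0 < c powr (a * real n) * exp (- c)" using c by simp
    have "x ^ n / Gamma (a * real n + 1) \<le> x ^ n / (c powr (a * real n) * exp (- c))"
      using Gamma_ge[of n] pos x by (intro divide_left_mono) auto
    also have "c powr (a * real n) = (2 * (x + 1)) ^ n"
      using x by (simp add: powr_powr[symmetric] c(2) powr_realpow)
    also have "x ^ n / ((2 * (x + 1)) ^ n * exp (- c)) = exp c * (x / (2 * (x + 1))) ^ n"
      by (simp add: exp_minus power_divide field_simps)
    also have "\<dots> \<le> exp c * (1 / 2) ^ n"
      using x by (intro mult_left_mono power_mono) (auto simp: field_simps)
    finally show ?thesis .
  qed
  moreover have "0 \<le> x ^ n / Gamma (a * real n + 1)" for n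
    using x a by (intro divide_nonneg_nonneg Gamma_real_nonneg add_nonneg_pos) auto
  moreover have "(\<lambda>n. exp c * (1 / 2 :: real) ^ n) \<longlonglongrightarrow> exp c * 0"
    by (intro tendsto_mult_left LIMSEQ_realpow_zero) auto
  ultimately show ?thesis
    by (rule_tac real_tendsto_sandwich[where f = "\<lambda>_. 0" and h = "\<lambda>n. exp c * (1 / 2) ^ n"]) simp_all
qed

section \<open>Fractional integrals and the Mittag-Leffler function\<close>

text \<open>
  The Riemann-Liouville fractional integral of order a, on the half-line and for nonnegative
  functions.
\<close>

definition frac_integral :: "real \<Rightarrow> (real \<Rightarrow> ennreal) \<Rightarrow> real \<Rightarrow> ennreal" where
  "frac_integral a f b =
     (\<integral>\<^sup>+y. (if 0 < y \<and> y \<le> b then f (b - y) * ennreal (y powr (a - 1) / Gamma a) else 0) \<partial>lborel)"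

lemma frac_integral_measurable [measurable]:
  assumes [measurable]: "f \<in> borel_measurable borel"
  shows "frac_integral a f \<in> borel_measurable borel"
  unfolding frac_integral_def[abs_def] by measurable

lemma frac_integral_cong:
  assumes "\<And>x. 0 \<le> x \<Longrightarrow> x < b \<Longrightarrow> f x = g x"
  shows "frac_integral a f b = frac_integral a g b"
  unfolding frac_integral_def using assms by (intro nn_integral_cong) auto

lemma frac_integral_add_cmult:
  assumes [measurable]: "f \<in> borel_measurable borel" "g \<in> borel_measurable borel"
  shows "frac_integral a (\<lambda>x. f x + c * g x) b = frac_integral a f b + c * frac_integral a g b"
proof -
  let ?k = "\<lambda>f y. if 0 < y \<and> y \<le> b then f (b - y) * ennreal (y powr (a - 1) / Gamma a) else 0"
  have "frac_integral a (\<lambda>x. f x + c * g x) b = (\<integral>\<^sup>+y. ?k f y + c * ?k g y \<partial>lborel)"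
    unfolding frac_integral_def by (intro nn_integral_cong) (simp add: distrib_right mult.assoc)
  also have "\<dots> = (\<integral>\<^sup>+y. ?k f y \<partial>lborel) + (\<integral>\<^sup>+y. c * ?k g y \<partial>lborel)"
    by (rule nn_integral_add) measurable
  also have "(\<integral>\<^sup>+y. c * ?k g y \<partial>lborel) = c * (\<integral>\<^sup>+y. ?k g y \<partial>lborel)"
    by (rule nn_integral_cmult) measurable
  finally show ?thesis by (simp add: frac_integral_def)
qed

text \<open>
  The Beta integral. The functions x powr (a * n) / Gamma (a * n + 1) are the iterated
  fractional integrals of the constant 1.
\<close>

lemma frac_integral_power:
  assumes a: "a > 0" and b: "b \<ge> 0"
  shows "frac_integral a (\<lambda>x. ennreal ((x powr a) ^ n / Gamma (a * real n + 1))) b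
      = ennreal ((b powr a) ^ Suc n / Gamma (a * real (Suc n) + 1))"
proof (cases "b = 0")
  case True
  have *: "(if 0 < y \<and> y \<le> 0 then f y else 0) = 0" for y :: real and f :: "real \<Rightarrow> ennreal" by auto
  show ?thesis unfolding True frac_integral_def by (subst *) simp
next
  case False
  with b have b: "b > 0" by simp
  define p where "p = a * real n + 1"
  have p: "p > 0" using a by (simp add: p_def add_nonneg_pos)
  have powr_pow: "(x powr a) ^ n = x powr (p - 1)" if "x > 0" for x :: real
    using that by (simp add: p_def powr_powr[symmetric] powr_realpow)
  let ?f = "\<lambda>y. if 0 < y \<and> y \<le> b
      then ennreal (((b - y) powr a) ^ n / Gamma p) * ennreal (y powr (a - 1) / Gamma a) else 0"
  let ?c = "b powr (a + p - 2) / (Gamma p * Gamma a)"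
  have c: "0 \<le> ?c" using a p by simp
  have "(\<integral>\<^sup>+y. ?f y \<partial>lborel) = ennreal \<bar>b\<bar> * (\<integral>\<^sup>+z. ?f (0 + b * z) \<partial>lborel)"
    using b by (intro nn_integral_real_affine) auto
  also have "(\<integral>\<^sup>+z. ?f (0 + b * z) \<partial>lborel) = (\<integral>\<^sup>+z. ennreal ?c *
      ennreal (indicator {0..1} z * (z powr (a - 1) * (1 - z) powr (p - 1))) \<partial>lborel)"
  proof (rule nn_integral_cong_AE, use AE_lborel_singleton[of 0] AE_lborel_singleton[of 1] in eventually_elim)
    fix z :: real assume z: "z \<noteq> 0" "z \<noteq> 1"
    show "?f (0 + b * z) = ennreal ?c *
      ennreal (indicator {0..1} z * (z powr (a - 1) * (1 - z) powr (p - 1)))"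
    proof (cases "0 < z \<and> z < 1")
      case True
      have bz: "b - b * z = b * (1 - z)" by (simp add: algebra_simps)
      have pos: "0 < b * (1 - z)" "0 < b * z" "b * z \<le> b" using True b by simp_all
      have 1: "((b * (1 - z)) powr a) ^ n = b powr (p - 1) * (1 - z) powr (p - 1)"
        using True b powr_pow[OF pos(1)] by (simp add: powr_mult)
      have 2: "(b * z) powr (a - 1) = b powr (a - 1) * z powr (a - 1)"
        using True b by (simp add: powr_mult)
      have 3: "b powr (a + p - 2) = b powr (p - 1) * b powr (a - 1)"
        by (simp add: powr_add[symmetric] add.commute)
      have "?f (0 + b * z) = ennreal (((b * (1 - z)) powr a) ^ n / Gamma p) * ennreal ((b * z) powr (a - 1) / Gamma a)"
        using pos by (simp add: bz)
      also have "\<dots> = ennreal (((b * (1 - z)) powr a) ^ n / Gamma p * ((b * z) powr (a - 1) / Gamma a))"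
        using a p by (intro ennreal_mult[symmetric]) auto
      also have "((b * (1 - z)) powr a) ^ n / Gamma p * ((b * z) powr (a - 1) / Gamma a)
          = ?c * (indicator {0..1} z * (z powr (a - 1) * (1 - z) powr (p - 1)))"
        unfolding 1 2 3 using True by simp
      also have "ennreal \<dots> = ennreal ?c * ennreal (indicator {0..1} z * (z powr (a - 1) * (1 - z) powr (p - 1)))"
        using c by (intro ennreal_mult) auto
      finally show ?thesis .
    next
      case False
      then have "z < 0 \<or> 1 < z" using z by linarith
      then show ?thesis using b by (auto simp: zero_less_mult_iff)
    qed
  qed
  also have "\<dots> = ennreal ?c *
      (\<integral>\<^sup>+z. ennreal (indicator {0..1} z * (z powr (a - 1) * (1 - z) powr (p - 1))) \<partial>lborel)"
    by (rule nn_integral_cmult) measurable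
  also have "(\<integral>\<^sup>+z. ennreal (indicator {0..1} z * (z powr (a - 1) * (1 - z) powr (p - 1))) \<partial>lborel)
      = ennreal (Beta a p)"
    by (rule nn_integral_has_integral_lebesgue) (use has_integral_Beta_real[OF a p] in auto)
  also have "ennreal \<bar>b\<bar> * (ennreal ?c * ennreal (Beta a p)) = ennreal (b * (?c * Beta a p))"
  proof -
    have "0 \<le> Beta a p" using a p by (simp add: Beta_def Gamma_real_nonneg)
    with b c show ?thesis by (simp only: ennreal_mult[symmetric] mult_nonneg_nonneg abs_of_pos less_imp_le)
  qed
  also have "b * (?c * Beta a p) = (b powr a) ^ Suc n / Gamma (a * real (Suc n) + 1)"
  proof -
    have "b * b powr (a + p - 2) = b powr (1 + (a + p - 2))" using b by (simp only: powr_add) simp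
    also have "1 + (a + p - 2) = a * real (Suc n)" by (simp add: p_def algebra_simps)
    also have "b powr (a * real (Suc n)) = (b powr a) ^ Suc n"
      using b by (simp only: powr_powr[symmetric] powr_realpow powr_gt_zero)
    finally have "b * b powr (a + p - 2) = (b powr a) ^ Suc n" .
    moreover have "a + p = a * real (Suc n) + 1" by (simp add: p_def algebra_simps)
    moreover have "Gamma a \<noteq> 0" "Gamma p \<noteq> 0" using Gamma_real_pos[OF a] Gamma_real_pos[OF p] by auto
    ultimately show ?thesis by (simp add: Beta_def del: power_Suc)
  qed
  finally show ?thesis by (simp only: frac_integral_def p_def)
qed

text \<open>
  With J the fractional integral, h + l * J h = 1 is solved by the Neumann series of 1 + l * J,
  which is the Mittag-Leffler series. Applying J repeatedly to the equation gives r n + l * r (n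
  + 1) = m n for the iterates r n of h, so the partial sums telescope, and nonnegativity bounds
  the remainder r n by the n-th term m n.
\<close>

lemma frac_equation_mittag_leffler:
  fixes a l :: real and h :: "real \<Rightarrow> ennreal"
  assumes a: "a > 0" and l: "l > 0" and h [measurable]: "h \<in> borel_measurable borel"
    and eq: "\<And>b. b \<ge> 0 \<Longrightarrow> h b + ennreal l * frac_integral a h b = 1"
    and b: "b \<ge> 0"
  shows "enn2real (h b) = mittag_leffler a (- l * b powr a)"
proof -
  define m where "m n x = (x powr a) ^ n / Gamma (a * real n + 1)" for n and x :: real
  define R where "R n = (frac_integral a ^^ n) h" for n
  have R_Suc: "R (Suc n) = frac_integral a (R n)" and R_0: "R 0 = h" for n by (auto simp: R_def)
  have R_meas [measurable]: "R n \<in> borel_measurable borel" for n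
    by (induction n) (auto simp: R_Suc R_0)
  have m_meas [measurable]: "m n \<in> borel_measurable borel" for n
    unfolding m_def by measurable
  have R_eq: "R n x + ennreal l * R (Suc n) x = ennreal (m n x)" if "x \<ge> 0" for n x
    using that
  proof (induction n arbitrary: x)
    case 0 then show ?case using eq[of x] by (simp add: R_Suc R_0 m_def)
  next
    case (Suc n)
    have "R (Suc n) x + ennreal l * R (Suc (Suc n)) x
        = frac_integral a (\<lambda>y. R n y + ennreal l * R (Suc n) y) x"
      by (subst frac_integral_add_cmult) (auto simp: R_Suc)
    also have "\<dots> = frac_integral a (\<lambda>y. ennreal (m n y)) x"
      by (rule frac_integral_cong) (rule Suc.IH)
    also have "\<dots> = ennreal (m (Suc n) x)"
      unfolding m_def by (rule frac_integral_power[OF a Suc.prems])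
    finally show ?case .
  qed
  define r where "r n = enn2real (R n b)" for n
  have m_nonneg: "0 \<le> m n b" for n
    unfolding m_def using a by (intro divide_nonneg_nonneg Gamma_real_nonneg add_nonneg_pos) auto
  have R_le: "R n b \<le> ennreal (m n b)" for n
    using R_eq[OF b, of n] by (metis add.commute le_iff_add add_increasing order_refl zero_le)
  have R_r: "R n b = ennreal (r n)" for n
    unfolding r_def using R_le[of n] by (metis ennreal_enn2real ennreal_less_top le_less_trans)
  have r_nonneg: "0 \<le> r n" for n by (simp add: r_def)
  have r_eq: "r n + l * r (Suc n) = m n b" for n
    using R_eq[OF b, of n] r_nonneg[of n] r_nonneg[of "Suc n"] l m_nonneg[of n]
    by (simp add: R_r ennreal_mult[symmetric] ennreal_plus[symmetric] del: ennreal_plus)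
  have r_le: "r n \<le> m n b" for n
  proof -
    have "0 \<le> l * r (Suc n)" using r_nonneg l by simp
    with r_eq[of n] show ?thesis by linarith
  qed
  have lim: "(\<lambda>n. (- l) ^ n * r n) \<longlonglongrightarrow> 0"
  proof (rule tendsto_norm_zero_cancel, rule real_tendsto_sandwich[where f = "\<lambda>_. 0"])
    show "(\<lambda>n. (l * b powr a) ^ n / Gamma (a * real n + 1)) \<longlonglongrightarrow> 0"
      using a l by (intro power_over_Gamma_tendsto_zero) auto
    have "norm ((- l) ^ n * r n) \<le> (l * b powr a) ^ n / Gamma (a * real n + 1)" for n
    proof -
      have "norm ((- l) ^ n * r n) = l ^ n * r n" using l r_nonneg by (simp add: abs_mult power_abs)
      also have "\<dots> \<le> l ^ n * m n b" using r_le l by (intro mult_left_mono) auto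
      finally show ?thesis by (simp add: m_def power_mult_distrib)
    qed
    then show "\<forall>\<^sub>F n in sequentially. norm ((- l) ^ n * r n) \<le> (l * b powr a) ^ n / Gamma (a * real n + 1)"
      by simp
  qed auto
  have "(\<lambda>n. (- l * b powr a) ^ n / Gamma (a * real n + 1))
      = (\<lambda>n. (- l) ^ n * r n - (- l) ^ Suc n * r (Suc n))"
  proof
    fix n
    have "(- l * b powr a) ^ n / Gamma (a * real n + 1) = (- l) ^ n * m n b"
      by (simp only: m_def power_mult_distrib times_divide_eq_right)
    also have "\<dots> = (- l) ^ n * r n - (- l) ^ Suc n * r (Suc n)"
      by (simp add: r_eq[symmetric] algebra_simps)
    finally show "(- l * b powr a) ^ n / Gamma (a * real n + 1)
      = (- l) ^ n * r n - (- l) ^ Suc n * r (Suc n)" .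
  qed
  then have "(\<lambda>n. (- l * b powr a) ^ n / Gamma (a * real n + 1)) sums ((- l) ^ 0 * r 0 - 0)"
    using telescope_sums'[OF lim] by simp
  then show ?thesis
    by (simp add: mittag_leffler_def r_def R_0 sums_iff)
qed

section \<open>The inverse of a stable subordinator\<close>

lemma inverse_process_nonneg: "0 \<le> inverse_process \<sigma> t \<omega>"
  unfolding inverse_process_def by (auto intro!: cInf_greatest)

text \<open>
  For monotone paths the first passage time is the length of the set of times spent below the
  level. If the path never passes the level, this length is infinite, and enn2real turns it into
  0, the default value of the inverse process.
\<close>

lemma inverse_process_eq_measure:
  assumes mono: "mono_on {0..} (\<lambda>t. \<sigma> t \<omega>)"
  shows "inverse_process \<sigma> b \<omega>
    = enn2real (\<integral>\<^sup>+s. (if 0 < s \<and> \<sigma> (max 0 s) \<omega> \<le> b then 1 else 0) \<partial>lborel)"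
proof (cases "{s. s > 0 \<and> \<sigma> s \<omega> > b} = {}")
  case True
  then have "\<And>s. 0 < s \<Longrightarrow> \<sigma> s \<omega> \<le> b" by (metis (mono_tags, lifting) empty_iff mem_Collect_eq not_less)
  then have "(\<integral>\<^sup>+s. (if 0 < s \<and> \<sigma> (max 0 s) \<omega> \<le> b then 1 else 0) \<partial>lborel)
      = (\<integral>\<^sup>+s. indicator {0::real<..} s \<partial>lborel)"
    by (intro nn_integral_cong) (auto simp: indicator_def)
  also have "\<dots> = \<infinity>"
  proof (simp, rule ccontr)
    assume *: "emeasure lborel {0::real<..} \<noteq> \<top>"
    have "ennreal x \<le> emeasure lborel {0::real<..}" if "0 \<le> x" for x
    proof -
      have "emeasure lborel {0<..<x} \<le> emeasure lborel {0::real<..}" by (rule emeasure_mono) auto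
      with that show ?thesis by simp
    qed
    from this[of "enn2real (emeasure lborel {0::real<..}) + 1"] * show False
      by (cases "emeasure lborel {0::real<..}") (auto simp: ennreal_plus[symmetric] simp del: ennreal_plus)
  qed
  finally show ?thesis using True by (simp add: inverse_process_def)
next
  case False
  define I where "I = Inf {s. s > 0 \<and> \<sigma> s \<omega> > b}"
  have bdd: "bdd_below {s. s > 0 \<and> \<sigma> s \<omega> > b}" by (rule bdd_belowI[of _ 0]) auto
  have I: "0 \<le> I" unfolding I_def using False by (intro cInf_greatest) auto
  have 1: "\<sigma> s \<omega> \<le> b" if "0 < s" "s < I" for s
  proof (rule ccontr)
    assume "\<not> \<sigma> s \<omega> \<le> b"
    with that have "I \<le> s" unfolding I_def by (intro cInf_lower bdd) auto
    with that show False by simp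
  qed
  have 2: "s \<le> I" if "0 < s" "\<sigma> s \<omega> \<le> b" for s
    unfolding I_def
  proof (rule cInf_greatest[OF False])
    fix r assume r: "r \<in> {s. s > 0 \<and> \<sigma> s \<omega> > b}"
    show "s \<le> r"
    proof (rule ccontr)
      assume "\<not> s \<le> r"
      with r that have "\<sigma> r \<omega> \<le> \<sigma> s \<omega>" by (intro mono_onD[OF mono]) auto
      with r that show False by auto
    qed
  qed
  have "(\<integral>\<^sup>+s. (if 0 < s \<and> \<sigma> (max 0 s) \<omega> \<le> b then 1 else 0) \<partial>lborel)
      = (\<integral>\<^sup>+s. indicator {0<..<I} s \<partial>lborel)"
  proof (rule nn_integral_cong_AE, use AE_lborel_singleton[of I] AE_lborel_singleton[of 0] in eventually_elim)
    fix s :: real assume "s \<noteq> I" "s \<noteq> 0"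
    then show "(if 0 < s \<and> \<sigma> (max 0 s) \<omega> \<le> b then 1 else 0) = indicator {0<..<I} s"
      using 1[of s] 2[of s] by (cases "0 < s"; cases "\<sigma> s \<omega> \<le> b") (auto simp: indicator_def)
  qed
  also have "\<dots> = ennreal I" using I by simp
  finally show ?thesis using False I by (auto simp: inverse_process_def I_def[symmetric])
qed

text \<open>
  Stated for an arbitrary measurable space N, so that it also applies to the sigma-algebra
  generated by \<sigma>.
\<close>

lemma inverse_process_measurable:
  assumes "\<And>t. t \<ge> 0 \<Longrightarrow> \<sigma> t \<in> borel_measurable N"
    and "\<And>\<omega>. \<omega> \<in> space N \<Longrightarrow> cadlag (\<lambda>t. \<sigma> t \<omega>)"
    and mono: "\<And>\<omega>. \<omega> \<in> space N \<Longrightarrow> mono_on {0..} (\<lambda>t. \<sigma> t \<omega>)"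
  shows "inverse_process \<sigma> b \<in> borel_measurable N"
proof -
  have [measurable]: "(\<lambda>p. \<sigma> (max 0 (fst p)) (snd p)) \<in> borel_measurable (borel \<Otimes>\<^sub>M N)"
    using cadlag_joint_measurable[of \<sigma> N] assms by (simp add: case_prod_beta')
  have [measurable]: "(\<lambda>p. \<sigma> (max 0 (snd p)) (fst p)) \<in> borel_measurable (N \<Otimes>\<^sub>M borel)"
    using measurable_compose[OF measurable_pair_swap' \<open>(\<lambda>p. \<sigma> (max 0 (fst p)) (snd p)) \<in> _\<close>]
    by (simp add: case_prod_beta')
  have [measurable]: "(\<lambda>\<omega>. \<integral>\<^sup>+s. (if 0 < s \<and> \<sigma> (max 0 s) \<omega> \<le> b then 1 else 0) \<partial>lborel) \<in> borel_measurable N"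
    by measurable
  have "(\<lambda>\<omega>. enn2real (\<integral>\<^sup>+s. (if 0 < s \<and> \<sigma> (max 0 s) \<omega> \<le> b then 1 else 0) \<partial>lborel)) \<in> borel_measurable N"
    by measurable
  then show ?thesis
    by (rule measurable_cong[THEN iffD1, rotated]) (rule inverse_process_eq_measure[OF mono, symmetric])
qed

locale inverse_stable_subordinator = prob_space Q for Q :: "'a measure" +
  fixes \<alpha> :: real and \<sigma> :: "real \<Rightarrow> 'a \<Rightarrow> real"
  assumes alpha: "0 < \<alpha>" "\<alpha> < 1"
    and subordinator: "stable_subordinator Q \<alpha> \<sigma>"
begin

abbreviation L :: "real \<Rightarrow> 'a \<Rightarrow> real" where "L \<equiv> inverse_process \<sigma>"

text \<open>
  The subordinator, with its value at time 0 also at negative times.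
\<close>

definition \<tau> :: "real \<Rightarrow> 'a \<Rightarrow> real" where "\<tau> r \<omega> = \<sigma> (max 0 r) \<omega>"

lemma levy: "levy_process Q \<sigma>" using subordinator by (simp add: stable_subordinator_def)

lemma mono: "\<omega> \<in> space Q \<Longrightarrow> mono_on {0..} (\<lambda>t. \<sigma> t \<omega>)"
  using subordinator by (simp add: stable_subordinator_def)

lemma mono_tau: "\<omega> \<in> space Q \<Longrightarrow> r \<le> s \<Longrightarrow> \<tau> r \<omega> \<le> \<tau> s \<omega>"
  unfolding \<tau>_def by (rule mono_onD[OF mono]) auto

lemma measurable_sigma: "t \<ge> 0 \<Longrightarrow> \<sigma> t \<in> borel_measurable Q"
  using levy by (simp add: levy_process_def)

lemma cadlag_sigma: "\<omega> \<in> space Q \<Longrightarrow> cadlag (\<lambda>t. \<sigma> t \<omega>)"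
  using levy by (simp add: levy_process_def)

lemma measurable_tau_pair: "(\<lambda>p. \<tau> (fst p) (snd p)) \<in> borel_measurable (borel \<Otimes>\<^sub>M Q)"
  using cadlag_joint_measurable[of \<sigma> Q, OF measurable_sigma cadlag_sigma]
  by (simp add: case_prod_beta' \<tau>_def)

lemma measurable_tau [measurable (raw)]:
  assumes "f \<in> borel_measurable N" "g \<in> measurable N Q"
  shows "(\<lambda>x. \<tau> (f x) (g x)) \<in> borel_measurable N"
  using measurable_compose[OF measurable_Pair[OF assms] measurable_tau_pair] by simp

lemma measurable_inverse [measurable]: "L b \<in> borel_measurable Q"
  by (rule inverse_process_measurable) (auto intro: measurable_sigma cadlag_sigma mono)

lemma AE_sigma_0: "AE \<omega> in Q. \<sigma> 0 \<omega> = 0" using levy by (simp add: levy_process_def)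

lemma AE_tau_nonneg: "AE \<omega> in Q. \<forall>r. 0 \<le> \<tau> r \<omega>"
  using AE_sigma_0 AE_space
proof eventually_elim
  case (elim \<omega>)
  have "\<tau> 0 \<omega> \<le> \<tau> (max 0 r) \<omega>" for r by (rule mono_tau[OF elim(2)]) simp
  with elim(1) show ?case by (simp add: \<tau>_def)
qed

lemma laplace_exponent:
  assumes "r > 0" "\<theta> > 0"
  shows "(\<integral>\<^sup>+\<omega>. ennreal (exp (- \<theta> * \<tau> r \<omega>)) \<partial>Q) = ennreal (exp (- r * \<theta> powr \<alpha>))"
proof -
  have "(\<integral>\<omega>. exp (- \<theta> * \<tau> r \<omega>) \<partial>Q) = exp (- r * \<theta> powr \<alpha>)"
    using subordinator assms by (simp add: stable_subordinator_def \<tau>_def)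
  moreover have "integrable Q (\<lambda>\<omega>. exp (- \<theta> * \<tau> r \<omega>))"
    by (rule integrable_const_bound[where B = 1])
       (use AE_tau_nonneg assms in \<open>auto elim!: eventually_mono\<close>)
  ultimately show ?thesis by (subst nn_integral_eq_integral) auto
qed

text \<open>
  The series of exp (- \<sigma> n) has finite mean, a geometric series, so its terms tend to
  zero almost surely.
\<close>

lemma AE_unbounded: "AE \<omega> in Q. \<forall>b. \<exists>s>0. b < \<sigma> s \<omega>"
proof -
  have "(\<integral>\<^sup>+\<omega>. (\<Sum>n. ennreal (exp (- \<tau> (real (Suc n)) \<omega>))) \<partial>Q)
      = (\<Sum>n. \<integral>\<^sup>+\<omega>. ennreal (exp (- \<tau> (real (Suc n)) \<omega>)) \<partial>Q)"
    by (rule nn_integral_suminf) measurable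
  also have "\<dots> = (\<Sum>n. ennreal (exp (- 1) ^ Suc n))"
  proof (rule suminf_cong)
    fix n
    have "exp (- real (Suc n)) = exp (real (Suc n) * (- 1))" by simp
    also have "\<dots> = exp (- 1) ^ Suc n" by (rule exp_of_nat_mult)
    finally show "(\<integral>\<^sup>+\<omega>. ennreal (exp (- \<tau> (real (Suc n)) \<omega>)) \<partial>Q) = ennreal (exp (- 1) ^ Suc n)"
      using laplace_exponent[of "real (Suc n)" 1] by (simp del: power_Suc of_nat_Suc)
  qed
  also have "\<dots> \<noteq> \<infinity>"
    unfolding infinity_ennreal_def
    by (rule ennreal_suminf_neq_top) (auto simp: summable_mult summable_geometric)
  finally have "AE \<omega> in Q. (\<Sum>n. ennreal (exp (- \<tau> (real (Suc n)) \<omega>))) \<noteq> \<infinity>"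
    by (intro nn_integral_PInf_AE) (simp_all del: of_nat_Suc)
  then show ?thesis
  proof eventually_elim
    case (elim \<omega>)
    have "(\<lambda>n. exp (- \<tau> (real (Suc n)) \<omega>)) \<longlonglongrightarrow> 0"
      using elim by (intro summable_LIMSEQ_zero summable_suminf_not_top) auto
    show ?case
    proof
      fix b
      have "eventually (\<lambda>n. exp (- \<tau> (real (Suc n)) \<omega>) < exp (- b)) sequentially"
        using \<open>_ \<longlonglongrightarrow> 0\<close> by (rule order_tendstoD) simp
      then obtain n where "exp (- \<tau> (real (Suc n)) \<omega>) < exp (- b)"
        by (auto simp: eventually_sequentially)
      then show "\<exists>s>0. b < \<sigma> s \<omega>"
        by (intro exI[of _ "real (Suc n)"]) (simp add: \<tau>_def)
    qed
  qed
qed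

definition regular :: "'a \<Rightarrow> bool" where
  "regular \<omega> \<longleftrightarrow> \<omega> \<in> space Q \<and> (\<forall>b. \<exists>s>0. b < \<sigma> s \<omega>)"

lemma AE_regular: "AE \<omega> in Q. regular \<omega>"
  unfolding regular_def using AE_unbounded AE_space by eventually_elim auto

lemma inverse_eq_Inf: "regular \<omega> \<Longrightarrow> L b \<omega> = Inf {s. s > 0 \<and> \<sigma> s \<omega> > b}"
  unfolding inverse_process_def regular_def by auto

lemma le_inverse:
  assumes "regular \<omega>" "\<And>s. s > 0 \<Longrightarrow> \<sigma> s \<omega> > b \<Longrightarrow> r \<le> s"
  shows "r \<le> L b \<omega>"
  unfolding inverse_eq_Inf[OF assms(1)] using assms by (intro cInf_greatest) (auto simp: regular_def)

lemma inverse_le: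
  assumes "regular \<omega>" "r > 0" "\<sigma> r \<omega> > b"
  shows "L b \<omega> \<le> r"
  unfolding inverse_eq_Inf[OF assms(1)]
  using assms by (intro cInf_lower) (auto intro!: bdd_belowI[of _ 0])

lemma inverse_nonneg: "regular \<omega> \<Longrightarrow> 0 \<le> L b \<omega>"
  by (rule le_inverse) auto

lemma inverse_mono: "regular \<omega> \<Longrightarrow> a \<le> b \<Longrightarrow> L a \<omega> \<le> L b \<omega>"
  by (rule le_inverse) (auto intro: inverse_le)

text \<open>
  The inverse relation between the subordinator and its first passage times. The single time r =
  L b, where it may fail, is negligible in all integrals over r.
\<close>

lemma tau_le_iff:
  assumes "regular \<omega>" "0 < r" "r \<noteq> L b \<omega>"
  shows "\<tau> r \<omega> \<le> b \<longleftrightarrow> r < L b \<omega>"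
proof
  assume *: "\<tau> r \<omega> \<le> b"
  have "r \<le> L b \<omega>"
  proof (rule le_inverse[OF assms(1)])
    fix s assume s: "s > 0" "\<sigma> s \<omega> > b"
    show "r \<le> s"
      using s * mono_tau[of \<omega> s r] assms by (cases "s \<le> r") (auto simp: \<tau>_def regular_def)
  qed
  with assms show "r < L b \<omega>" by simp
next
  assume "r < L b \<omega>"
  with inverse_le[OF assms(1,2), of b] assms show "\<tau> r \<omega> \<le> b" by (auto simp: \<tau>_def not_less[symmetric])
qed

text \<open>
  Here exp (- l * (L b - r)) is the probability that an independent exponential time exceeds L b
  - r, and L b - r \<le> s means, up to a single value of s, that \<sigma> has passed b at time
  r + s.
\<close>

lemma exp_inverse_as_integral:
  assumes \<omega>: "regular \<omega>" and l: "l > 0" and r: "0 \<le> r" "r \<le> L b \<omega>"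
  shows "ennreal (exp (- l * (L b \<omega> - r)))
    = (\<integral>\<^sup>+s. (if 0 < s \<and> b < \<tau> (r + s) \<omega> then ennreal (l * exp (- l * s)) else 0) \<partial>lborel)"
proof -
  have "(\<integral>\<^sup>+s. (if 0 < s \<and> b < \<tau> (r + s) \<omega> then ennreal (l * exp (- l * s)) else 0) \<partial>lborel)
      = (\<integral>\<^sup>+s. ennreal (l * exp (- l * s)) * indicator {L b \<omega> - r..} s \<partial>lborel)"
  proof (rule nn_integral_cong_AE, use AE_lborel_singleton[of 0] AE_lborel_singleton[of "L b \<omega> - r"] in eventually_elim)
    fix s :: real assume s: "s \<noteq> 0" "s \<noteq> L b \<omega> - r"
    show "(if 0 < s \<and> b < \<tau> (r + s) \<omega> then ennreal (l * exp (- l * s)) else 0)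
      = ennreal (l * exp (- l * s)) * indicator {L b \<omega> - r..} s"
    proof (cases "0 < s")
      case True
      then have "\<tau> (r + s) \<omega> \<le> b \<longleftrightarrow> r + s < L b \<omega>"
        using \<omega> r s by (intro tau_le_iff) auto
      with True s show ?thesis by (auto simp: indicator_def not_le)
    next
      case False
      with s r show ?thesis by (auto simp: indicator_def)
    qed
  qed
  with nn_integral_exp_tail[OF l, of "L b \<omega> - r"] show ?thesis by simp
qed

text \<open>
  The fundamental theorem of calculus for exp (- l * (L b - r)) as a function of r on [0, L a];
  up to its end points this interval is the set of times r > 0 with \<tau> r \<le> a.
\<close>

lemma exp_inverse_increment_split:
  assumes \<omega>: "regular \<omega>" and l: "l > 0" and ab: "a \<le> b"
  shows "ennreal (exp (- l * (L b \<omega> - L a \<omega>))) = ennreal (exp (- l * L b \<omega>))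
    + (\<integral>\<^sup>+r. (if 0 < r \<and> \<tau> r \<omega> \<le> a then ennreal (l * exp (- l * (L b \<omega> - r))) else 0) \<partial>lborel)"
proof -
  have La: "0 \<le> L a \<omega>" by (rule inverse_nonneg[OF \<omega>])
  have "(\<integral>\<^sup>+r. (if 0 < r \<and> \<tau> r \<omega> \<le> a then ennreal (l * exp (- l * (L b \<omega> - r))) else 0) \<partial>lborel)
      = (\<integral>\<^sup>+r. ennreal (l * exp (- l * (L b \<omega> - r))) * indicator {0..L a \<omega>} r \<partial>lborel)"
  proof (rule nn_integral_cong_AE, use AE_lborel_singleton[of 0] AE_lborel_singleton[of "L a \<omega>"] in eventually_elim)
    fix r :: real assume "r \<noteq> 0" "r \<noteq> L a \<omega>"
    then show "(if 0 < r \<and> \<tau> r \<omega> \<le> a then ennreal (l * exp (- l * (L b \<omega> - r))) else 0)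
      = ennreal (l * exp (- l * (L b \<omega> - r))) * indicator {0..L a \<omega>} r"
      using tau_le_iff[OF \<omega>, of r a] by (cases "0 < r") (auto simp: indicator_def)
  qed
  also have "\<dots> = ennreal (exp (- l * (L b \<omega> - L a \<omega>)) - exp (- l * (L b \<omega> - 0)))"
    using l La by (intro nn_integral_FTC_Icc) (auto intro!: derivative_eq_intros)
  also have "ennreal (exp (- l * L b \<omega>)) + \<dots> = ennreal (exp (- l * (L b \<omega> - L a \<omega>)))"
    using l La inverse_mono[OF \<omega> ab] by (subst ennreal_plus[symmetric]) auto
  finally show ?thesis by simp
qed

definition survival :: "real \<Rightarrow> real \<Rightarrow> ennreal" where
  "survival s y = (\<integral>\<^sup>+\<omega>. (if y < \<tau> s \<omega> then 1 else 0) \<partial>Q)"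

text \<open>
  The Laplace transform of L y at l, as a mixture over an exponential time s. This form is also
  what appears when \<sigma> is restarted at time r, with the remaining level b - \<tau> r in
  place of y.
\<close>

definition inverse_laplace :: "real \<Rightarrow> real \<Rightarrow> ennreal" where
  "inverse_laplace l y = (\<integral>\<^sup>+s. (if 0 < s then ennreal (l * exp (- l * s)) * survival s y else 0) \<partial>lborel)"

lemma survival_measurable [measurable (raw)]:
  assumes [measurable]: "f \<in> borel_measurable N" "g \<in> borel_measurable N"
  shows "(\<lambda>x. survival (f x) (g x)) \<in> borel_measurable N"
  unfolding survival_def by measurable

lemma inverse_laplace_measurable [measurable]: "inverse_laplace l \<in> borel_measurable borel"
  unfolding inverse_laplace_def[abs_def] by measurable

lemma inverse_laplace_eq:
  assumes l: "l > 0"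
  shows "inverse_laplace l b = (\<integral>\<^sup>+\<omega>. ennreal (exp (- l * L b \<omega>)) \<partial>Q)"
proof -
  interpret lQ: pair_sigma_finite lborel Q ..
  have "(\<integral>\<^sup>+\<omega>. ennreal (exp (- l * L b \<omega>)) \<partial>Q)
    = (\<integral>\<^sup>+\<omega>. (\<integral>\<^sup>+s. (if 0 < s \<and> b < \<tau> s \<omega> then ennreal (l * exp (- l * s)) else 0) \<partial>lborel) \<partial>Q)"
    by (intro nn_integral_cong_AE, use AE_regular in eventually_elim)
       (use exp_inverse_as_integral[OF _ l, of _ 0 b] inverse_nonneg in auto)
  also have "\<dots> = (\<integral>\<^sup>+s. (\<integral>\<^sup>+\<omega>. (if 0 < s \<and> b < \<tau> s \<omega> then ennreal (l * exp (- l * s)) else 0) \<partial>Q) \<partial>lborel)"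
    by (rule lQ.Fubini') measurable
  also have "\<dots> = inverse_laplace l b"
    unfolding inverse_laplace_def
  proof (rule nn_integral_cong)
    fix s :: real
    have "(\<integral>\<^sup>+\<omega>. (if 0 < s \<and> b < \<tau> s \<omega> then ennreal (l * exp (- l * s)) else 0) \<partial>Q)
      = (\<integral>\<^sup>+\<omega>. (if 0 < s then ennreal (l * exp (- l * s)) else 0) * (if b < \<tau> s \<omega> then 1 else 0) \<partial>Q)"
      by (rule nn_integral_cong) auto
    also have "\<dots> = (if 0 < s then ennreal (l * exp (- l * s)) else 0) * survival s b"
      unfolding survival_def by (rule nn_integral_cmult) measurable
    finally show "(\<integral>\<^sup>+\<omega>. (if 0 < s \<and> b < \<tau> s \<omega> then ennreal (l * exp (- l * s)) else 0) \<partial>Q)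
      = (if 0 < s then ennreal (l * exp (- l * s)) * survival s b else 0)" by simp
  qed
  finally show ?thesis ..
qed

text \<open>
  Independence and stationarity of the increments: after time r the subordinator restarts as an
  independent copy.
\<close>

lemma nn_integral_increments:
  assumes r: "0 \<le> r" and s: "0 \<le> s" and f [measurable]: "f \<in> borel_measurable (borel \<Otimes>\<^sub>M borel)"
  shows "(\<integral>\<^sup>+\<omega>. f (\<tau> r \<omega>, \<tau> (r + s) \<omega> - \<tau> r \<omega>) \<partial>Q)
    = (\<integral>\<^sup>+\<omega>. (\<integral>\<^sup>+\<omega>'. f (\<tau> r \<omega>, \<tau> s \<omega>') \<partial>Q) \<partial>Q)"
proof -
  define T :: "nat \<Rightarrow> real" where "T i = (if i = 0 then 0 else if i = 1 then r else r + s)" for i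
  define D where "D i \<omega> = \<sigma> (T (Suc i)) \<omega> - \<sigma> (T i) \<omega>" for i \<omega>
  have "incseq T" "0 \<le> T 0" using r s by (auto simp: T_def incseq_def)
  then have "indep_vars (\<lambda>_. borel) D {..<2}"
    using levy unfolding levy_process_def D_def by blast
  then have "indep_var (PiM {0} (\<lambda>_. borel)) (\<lambda>\<omega>. restrict (\<lambda>i. D i \<omega>) {0})
      (PiM {1} (\<lambda>_. borel)) (\<lambda>\<omega>. restrict (\<lambda>i. D i \<omega>) {1})"
    by (rule indep_var_restrict) auto
  then have "indep_var borel ((\<lambda>x. x 0) \<circ> (\<lambda>\<omega>. restrict (\<lambda>i. D i \<omega>) {0}))
      borel ((\<lambda>x. x 1) \<circ> (\<lambda>\<omega>. restrict (\<lambda>i. D i \<omega>) {1}))"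
    by (rule indep_var_compose) auto
  then have ind: "indep_var borel (D 0) borel (D 1)" by (simp add: comp_def)
  have [measurable]: "D 0 \<in> borel_measurable Q" "D 1 \<in> borel_measurable Q"
    using indep_var_rv1[OF ind] indep_var_rv2[OF ind] by auto
  have D0: "AE \<omega> in Q. D 0 \<omega> = \<tau> r \<omega>"
    using AE_sigma_0 by eventually_elim (use r in \<open>simp add: D_def T_def \<tau>_def\<close>)
  have D1: "D 1 \<omega> = \<tau> (r + s) \<omega> - \<tau> r \<omega>" for \<omega>
    using r s by (simp add: D_def T_def \<tau>_def numeral_2_eq_2)
  have law0: "distr Q borel (D 0) = distr Q borel (\<tau> r)"
    using D0 by (intro distr_cong_AE) auto
  have tau_eq: "\<tau> s = \<sigma> s" using s by (auto simp: \<tau>_def)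
  have law1: "distr Q borel (D 1) = distr Q borel (\<tau> s)"
  proof -
    have "distr Q borel (D 1) = distr Q borel (\<lambda>\<omega>. \<sigma> (r + s) \<omega> - \<sigma> r \<omega>)"
      by (intro distr_cong) (use r s in \<open>simp_all add: D1[unfolded One_nat_def] \<tau>_def\<close>)
    also have "\<dots> = distr Q borel (\<sigma> (r + s - r))"
      using levy r s unfolding levy_process_def by (metis le_add_same_cancel1)
    finally show ?thesis by (simp add: tau_eq)
  qed
  interpret Ds: prob_space "distr Q borel (\<tau> s)" by (rule prob_space_distr) measurable
  have "(\<integral>\<^sup>+\<omega>. f (\<tau> r \<omega>, \<tau> (r + s) \<omega> - \<tau> r \<omega>) \<partial>Q) = (\<integral>\<^sup>+\<omega>. f (D 0 \<omega>, D 1 \<omega>) \<partial>Q)"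
    by (intro nn_integral_cong_AE, use D0 in eventually_elim) (simp add: D1[unfolded One_nat_def])
  also have "\<dots> = (\<integral>\<^sup>+p. f p \<partial>distr Q (borel \<Otimes>\<^sub>M borel) (\<lambda>\<omega>. (D 0 \<omega>, D 1 \<omega>)))"
    by (subst nn_integral_distr) measurable
  also have "distr Q (borel \<Otimes>\<^sub>M borel) (\<lambda>\<omega>. (D 0 \<omega>, D 1 \<omega>))
      = distr Q borel (\<tau> r) \<Otimes>\<^sub>M distr Q borel (\<tau> s)"
    using ind unfolding indep_var_distribution_eq law0 law1 by simp
  also have "(\<integral>\<^sup>+p. f p \<partial>(distr Q borel (\<tau> r) \<Otimes>\<^sub>M distr Q borel (\<tau> s)))
      = (\<integral>\<^sup>+x. (\<integral>\<^sup>+y. f (x, y) \<partial>distr Q borel (\<tau> s)) \<partial>distr Q borel (\<tau> r))"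
    by (rule Ds.nn_integral_fst[symmetric]) simp
  also have "\<dots> = (\<integral>\<^sup>+\<omega>. (\<integral>\<^sup>+\<omega>'. f (\<tau> r \<omega>, \<tau> s \<omega>') \<partial>Q) \<partial>Q)"
    by (subst nn_integral_distr, measurable)+
  finally show ?thesis .
qed

text \<open>
  Given \<tau> r \<le> a, the passage of the level b after time r is the passage of the level b
  - \<tau> r by the restarted subordinator. The outer integral over r is an integral against the
  potential measure of \<sigma>.
\<close>

lemma laplace_inverse_increment_potential:
  assumes l: "l > 0" and ab: "a \<le> b"
  shows "(\<integral>\<^sup>+\<omega>. ennreal (exp (- l * (L b \<omega> - L a \<omega>))) \<partial>Q) = inverse_laplace l b
    + ennreal l * (\<integral>\<^sup>+r. (if 0 < r then \<integral>\<^sup>+\<omega>. (if \<tau> r \<omega> \<le> a then inverse_laplace l (b - \<tau> r \<omega>) else 0) \<partial>Q else 0) \<partial>lborel)"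
proof -
  interpret lQ: pair_sigma_finite lborel Q ..
  define I where "I r s \<omega> = (if 0 < r \<and> 0 < s \<and> \<tau> r \<omega> \<le> a \<and> b < \<tau> (r + s) \<omega>
      then ennreal (l * exp (- l * s)) else 0)" for r s \<omega>
  have I_meas [measurable (raw)]: "(\<lambda>x. I (f x) (g x) (k x)) \<in> borel_measurable N"
    if [measurable]: "f \<in> borel_measurable N" "g \<in> borel_measurable N" "k \<in> measurable N Q" for f g k and N :: "'n measure"
    unfolding I_def by measurable
  have split: "AE \<omega> in Q. ennreal (exp (- l * (L b \<omega> - L a \<omega>)))
      = ennreal (exp (- l * L b \<omega>)) + ennreal l * (\<integral>\<^sup>+r. (\<integral>\<^sup>+s. I r s \<omega> \<partial>lborel) \<partial>lborel)"
    using AE_regular AE_space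
  proof eventually_elim
    case (elim \<omega>)
    note [measurable] = elim(2)
    have "(\<integral>\<^sup>+r. (if 0 < r \<and> \<tau> r \<omega> \<le> a then ennreal (l * exp (- l * (L b \<omega> - r))) else 0) \<partial>lborel)
        = (\<integral>\<^sup>+r. ennreal l * (\<integral>\<^sup>+s. I r s \<omega> \<partial>lborel) \<partial>lborel)"
    proof (rule nn_integral_cong_AE, use AE_lborel_singleton[of "L a \<omega>"] in eventually_elim)
      fix r :: real assume r: "r \<noteq> L a \<omega>"
      show "(if 0 < r \<and> \<tau> r \<omega> \<le> a then ennreal (l * exp (- l * (L b \<omega> - r))) else 0)
        = ennreal l * (\<integral>\<^sup>+s. I r s \<omega> \<partial>lborel)"
      proof (cases "0 < r \<and> \<tau> r \<omega> \<le> a")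
        case True
        then have "r \<le> L b \<omega>"
          using tau_le_iff[OF elim(1) _ r] inverse_mono[OF elim(1) ab] by auto
        then have "ennreal (exp (- l * (L b \<omega> - r))) = (\<integral>\<^sup>+s. I r s \<omega> \<partial>lborel)"
          using True by (subst exp_inverse_as_integral[OF elim(1) l]) (auto simp: I_def)
        with True l show ?thesis by (simp add: ennreal_mult)
      qed (auto simp: I_def)
    qed
    also have "\<dots> = ennreal l * (\<integral>\<^sup>+r. (\<integral>\<^sup>+s. I r s \<omega> \<partial>lborel) \<partial>lborel)"
      by (rule nn_integral_cmult) measurable
    finally show ?case using exp_inverse_increment_split[OF elim(1) l ab] by simp
  qed
  have "(\<integral>\<^sup>+\<omega>. ennreal (exp (- l * (L b \<omega> - L a \<omega>))) \<partial>Q)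
      = (\<integral>\<^sup>+\<omega>. ennreal (exp (- l * L b \<omega>)) + ennreal l * (\<integral>\<^sup>+r. (\<integral>\<^sup>+s. I r s \<omega> \<partial>lborel) \<partial>lborel) \<partial>Q)"
    by (rule nn_integral_cong_AE[OF split])
  also have "\<dots> = inverse_laplace l b + (\<integral>\<^sup>+\<omega>. ennreal l * (\<integral>\<^sup>+r. (\<integral>\<^sup>+s. I r s \<omega> \<partial>lborel) \<partial>lborel) \<partial>Q)"
    unfolding inverse_laplace_eq[OF l] by (rule nn_integral_add) measurable
  also have "(\<integral>\<^sup>+\<omega>. ennreal l * (\<integral>\<^sup>+r. (\<integral>\<^sup>+s. I r s \<omega> \<partial>lborel) \<partial>lborel) \<partial>Q)
      = ennreal l * (\<integral>\<^sup>+\<omega>. (\<integral>\<^sup>+r. (\<integral>\<^sup>+s. I r s \<omega> \<partial>lborel) \<partial>lborel) \<partial>Q)"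
    by (rule nn_integral_cmult) measurable
  also have "(\<integral>\<^sup>+\<omega>. (\<integral>\<^sup>+r. (\<integral>\<^sup>+s. I r s \<omega> \<partial>lborel) \<partial>lborel) \<partial>Q)
      = (\<integral>\<^sup>+r. (\<integral>\<^sup>+\<omega>. (\<integral>\<^sup>+s. I r s \<omega> \<partial>lborel) \<partial>Q) \<partial>lborel)"
    by (rule lQ.Fubini') measurable
  also have "\<dots> = (\<integral>\<^sup>+r. (\<integral>\<^sup>+s. (\<integral>\<^sup>+\<omega>. I r s \<omega> \<partial>Q) \<partial>lborel) \<partial>lborel)"
    by (intro nn_integral_cong lQ.Fubini') measurable
  also have "\<dots> = (\<integral>\<^sup>+r. (if 0 < r then \<integral>\<^sup>+\<omega>. (if \<tau> r \<omega> \<le> a then inverse_laplace l (b - \<tau> r \<omega>) else 0) \<partial>Q else 0) \<partial>lborel)"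
  proof (rule nn_integral_cong)
    fix r :: real
    show "(\<integral>\<^sup>+s. (\<integral>\<^sup>+\<omega>. I r s \<omega> \<partial>Q) \<partial>lborel)
      = (if 0 < r then \<integral>\<^sup>+\<omega>. (if \<tau> r \<omega> \<le> a then inverse_laplace l (b - \<tau> r \<omega>) else 0) \<partial>Q else 0)"
    proof (cases "0 < r")
      case True
      define J where "J s \<omega> = (if \<tau> r \<omega> \<le> a \<and> 0 < s
          then ennreal (l * exp (- l * s)) * survival s (b - \<tau> r \<omega>) else 0)" for s \<omega>
      have "(\<integral>\<^sup>+\<omega>. I r s \<omega> \<partial>Q) = (\<integral>\<^sup>+\<omega>. J s \<omega> \<partial>Q)" for s
      proof (cases "0 < s")
        case s: True
        define f where "f p = (if fst p \<le> a \<and> b - fst p < snd p then ennreal (l * exp (- l * s)) else 0)"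
          for p :: "real \<times> real"
        have f [measurable]: "f \<in> borel_measurable (borel \<Otimes>\<^sub>M borel)" unfolding f_def[abs_def] by measurable
        have "(\<integral>\<^sup>+\<omega>. I r s \<omega> \<partial>Q) = (\<integral>\<^sup>+\<omega>. f (\<tau> r \<omega>, \<tau> (r + s) \<omega> - \<tau> r \<omega>) \<partial>Q)"
          using True s by (intro nn_integral_cong) (auto simp: I_def f_def)
        also have "\<dots> = (\<integral>\<^sup>+\<omega>. (\<integral>\<^sup>+\<omega>'. f (\<tau> r \<omega>, \<tau> s \<omega>') \<partial>Q) \<partial>Q)"
          using True s by (intro nn_integral_increments f) auto
        also have "\<dots> = (\<integral>\<^sup>+\<omega>. J s \<omega> \<partial>Q)"
        proof (rule nn_integral_cong)
          fix \<omega> assume \<omega>: "\<omega> \<in> space Q"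
          have "(\<integral>\<^sup>+\<omega>'. f (\<tau> r \<omega>, \<tau> s \<omega>') \<partial>Q) = (\<integral>\<^sup>+\<omega>'. (if \<tau> r \<omega> \<le> a then ennreal (l * exp (- l * s)) else 0)
              * (if b - \<tau> r \<omega> < \<tau> s \<omega>' then 1 else 0) \<partial>Q)"
            by (rule nn_integral_cong) (auto simp: f_def)
          also have "\<dots> = (if \<tau> r \<omega> \<le> a then ennreal (l * exp (- l * s)) else 0) * survival s (b - \<tau> r \<omega>)"
            unfolding survival_def by (rule nn_integral_cmult) measurable
          finally show "(\<integral>\<^sup>+\<omega>'. f (\<tau> r \<omega>, \<tau> s \<omega>') \<partial>Q) = J s \<omega>" using s by (simp add: J_def)
        qed
        finally show ?thesis .
      qed (simp add: I_def J_def)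
      then have "(\<integral>\<^sup>+s. (\<integral>\<^sup>+\<omega>. I r s \<omega> \<partial>Q) \<partial>lborel) = (\<integral>\<^sup>+s. (\<integral>\<^sup>+\<omega>. J s \<omega> \<partial>Q) \<partial>lborel)" by simp
      also have "\<dots> = (\<integral>\<^sup>+\<omega>. (\<integral>\<^sup>+s. J s \<omega> \<partial>lborel) \<partial>Q)"
        unfolding J_def by (rule lQ.Fubini'[symmetric]) measurable
      also have "\<dots> = (\<integral>\<^sup>+\<omega>. (if \<tau> r \<omega> \<le> a then inverse_laplace l (b - \<tau> r \<omega>) else 0) \<partial>Q)"
        by (intro nn_integral_cong) (auto simp: J_def inverse_laplace_def)
      finally show ?thesis using True by simp
    qed (simp add: I_def)
  qed
  finally show ?thesis .
qed

text \<open>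
  The potential measure of \<sigma> has the Laplace transform \<integral> exp (- r * \<theta>
  powr \<alpha>) dr = \<theta> powr (- \<alpha>), which is that of the density y powr (\<alpha>
  - 1) / Gamma \<alpha>. To conclude equality of the measures from this, both are weighted by
  exp (- y) and transported to [0, 1] by y \<mapsto> exp (- y). They become probability measures
  N1 and N2 whose n-th moments are the Laplace transforms at \<theta> = n + 1.
\<close>

lemma potential_density:
  assumes \<phi> [measurable]: "\<phi> \<in> borel_measurable borel"
  shows "(\<integral>\<^sup>+r. (if 0 < r then \<integral>\<^sup>+\<omega>. \<phi> (\<tau> r \<omega>) \<partial>Q else 0) \<partial>lborel)
    = (\<integral>\<^sup>+y. (if 0 < y then \<phi> y * ennreal (y powr (\<alpha> - 1) / Gamma \<alpha>) else 0) \<partial>lborel)"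
proof -
  interpret lQ: pair_sigma_finite lborel Q ..
  define N1 where "N1 = distr (density (lborel \<Otimes>\<^sub>M Q)
      (\<lambda>p. if 0 < fst p then ennreal (exp (- \<tau> (fst p) (snd p))) else 0)) borel (\<lambda>p. exp (- \<tau> (fst p) (snd p)))"
  define N2 where "N2 = distr (density lborel
      (\<lambda>y. if 0 < y then ennreal (exp (- 1 * y) * y powr (\<alpha> - 1)) * ennreal (1 / Gamma \<alpha>) else 0)) borel (\<lambda>y. exp (- y))"
  have G: "Gamma \<alpha> > 0" using alpha by simp
  have N1_int: "(\<integral>\<^sup>+x. g x \<partial>N1)
      = (\<integral>\<^sup>+r. (if 0 < r then \<integral>\<^sup>+\<omega>. ennreal (exp (- \<tau> r \<omega>)) * g (exp (- \<tau> r \<omega>)) \<partial>Q else 0) \<partial>lborel)"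
    if [measurable]: "g \<in> borel_measurable borel" for g
  proof -
    have "(\<integral>\<^sup>+x. g x \<partial>N1) = (\<integral>\<^sup>+p. (if 0 < fst p then ennreal (exp (- \<tau> (fst p) (snd p))) else 0)
        * g (exp (- \<tau> (fst p) (snd p))) \<partial>(lborel \<Otimes>\<^sub>M Q))"
      unfolding N1_def by (subst nn_integral_distr, measurable, subst nn_integral_density, measurable)
    also have "\<dots> = (\<integral>\<^sup>+r. (\<integral>\<^sup>+\<omega>. (if 0 < r then ennreal (exp (- \<tau> r \<omega>)) else 0)
        * g (exp (- \<tau> r \<omega>)) \<partial>Q) \<partial>lborel)"
      by (subst nn_integral_fst[symmetric]) (measurable, simp cong: if_cong)
    also have "\<dots> = (\<integral>\<^sup>+r. (if 0 < r then \<integral>\<^sup>+\<omega>. ennreal (exp (- \<tau> r \<omega>)) * g (exp (- \<tau> r \<omega>)) \<partial>Q else 0) \<partial>lborel)"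
      by (intro nn_integral_cong) auto
    finally show ?thesis .
  qed
  have N2_int: "(\<integral>\<^sup>+x. g x \<partial>N2)
      = (\<integral>\<^sup>+y. (if 0 < y then ennreal (exp (- 1 * y) * y powr (\<alpha> - 1)) * ennreal (1 / Gamma \<alpha>) * g (exp (- y)) else 0) \<partial>lborel)"
    if [measurable]: "g \<in> borel_measurable borel" for g
  proof -
    have "(\<integral>\<^sup>+x. g x \<partial>N2) = (\<integral>\<^sup>+y. (if 0 < y then ennreal (exp (- 1 * y) * y powr (\<alpha> - 1)) * ennreal (1 / Gamma \<alpha>) else 0)
        * g (exp (- y)) \<partial>lborel)"
      unfolding N2_def by (subst nn_integral_distr, measurable, subst nn_integral_density, measurable)
    also have "\<dots> = (\<integral>\<^sup>+y. (if 0 < y then ennreal (exp (- 1 * y) * y powr (\<alpha> - 1)) * ennreal (1 / Gamma \<alpha>) * g (exp (- y)) else 0) \<partial>lborel)"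
      by (intro nn_integral_cong) auto
    finally show ?thesis .
  qed
  have exp_pow: "exp (- x) * exp (- x) ^ n = exp (- real (Suc n) * x)" for x :: real and n
    by (simp add: exp_of_nat_mult[symmetric] exp_add[symmetric] algebra_simps)
  have mom1: "(\<integral>\<^sup>+x. ennreal (x ^ n) \<partial>N1) = ennreal (real (Suc n) powr (- \<alpha>))" for n
  proof -
    have "(\<integral>\<^sup>+x. ennreal (x ^ n) \<partial>N1)
        = (\<integral>\<^sup>+r. (if 0 < r then ennreal (exp (- (real (Suc n) powr \<alpha>) * r) * r powr (1 - 1)) else 0) \<partial>lborel)"
    proof (subst N1_int, measurable, rule nn_integral_cong)
      fix r :: real
      have "(\<integral>\<^sup>+\<omega>. ennreal (exp (- \<tau> r \<omega>)) * ennreal (exp (- \<tau> r \<omega>) ^ n) \<partial>Q)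
          = ennreal (exp (- r * real (Suc n) powr \<alpha>))" if "r > 0"
        unfolding ennreal_mult[symmetric, OF exp_ge_zero zero_le_power[OF exp_ge_zero]] exp_pow
        by (rule laplace_exponent[OF that]) simp
      then show "(if 0 < r then \<integral>\<^sup>+\<omega>. ennreal (exp (- \<tau> r \<omega>)) * ennreal (exp (- \<tau> r \<omega>) ^ n) \<partial>Q else 0)
          = (if 0 < r then ennreal (exp (- (real (Suc n) powr \<alpha>) * r) * r powr (1 - 1)) else 0)"
        by (simp add: mult.commute del: of_nat_Suc)
    qed
    also have "\<dots> = ennreal (Gamma 1 * (real (Suc n) powr \<alpha>) powr (- 1))"
      by (rule nn_integral_Gamma_scaled) auto
    finally show ?thesis by (simp add: powr_powr powr_minus_divide del: of_nat_Suc)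
  qed
  have mom2: "(\<integral>\<^sup>+x. ennreal (x ^ n) \<partial>N2) = ennreal (real (Suc n) powr (- \<alpha>))" for n
  proof -
    have "(\<integral>\<^sup>+x. ennreal (x ^ n) \<partial>N2)
        = (\<integral>\<^sup>+y. ennreal (1 / Gamma \<alpha>) * (if 0 < y then ennreal (exp (- real (Suc n) * y) * y powr (\<alpha> - 1)) else 0) \<partial>lborel)"
    proof (subst N2_int, measurable, rule nn_integral_cong)
      fix y :: real
      have "exp (- 1 * y) * y powr (\<alpha> - 1) * (1 / Gamma \<alpha>) * exp (- y) ^ n
          = 1 / Gamma \<alpha> * (exp (- real (Suc n) * y) * y powr (\<alpha> - 1))"
        unfolding exp_pow[symmetric] by simp
      then show "(if 0 < y then ennreal (exp (- 1 * y) * y powr (\<alpha> - 1)) * ennreal (1 / Gamma \<alpha>) * ennreal (exp (- y) ^ n) else 0)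
          = ennreal (1 / Gamma \<alpha>) * (if 0 < y then ennreal (exp (- real (Suc n) * y) * y powr (\<alpha> - 1)) else 0)"
        using G by (auto simp del: of_nat_Suc simp: ennreal_mult[symmetric] mult.assoc)
    qed
    also have "\<dots> = ennreal (1 / Gamma \<alpha>) * ennreal (Gamma \<alpha> * real (Suc n) powr (- \<alpha>))"
      by (subst nn_integral_cmult, measurable, subst nn_integral_Gamma_scaled) (use alpha in auto)
    finally show ?thesis using G by (simp add: ennreal_mult[symmetric] del: of_nat_Suc)
  qed
  have sets: "sets N1 = sets borel" "sets N2 = sets borel" by (simp_all add: N1_def N2_def)
  have space: "space N1 = UNIV" "space N2 = UNIV" by (simp_all add: N1_def N2_def)
  have dist: "real_distribution N1" "real_distribution N2"
    using mom1[of 0] mom2[of 0] sets space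
    by (auto intro!: real_distribution.intro prob_spaceI simp: real_distribution_axioms_def)
  have bounded: "AE x in N1. 0 \<le> x \<and> x \<le> 1" "AE x in N2. 0 \<le> x \<and> x \<le> 1"
  proof -
    have unit [simp]: "{x :: real. 0 \<le> x \<and> x \<le> 1} \<in> sets borel" by measurable
    have "(\<integral>\<^sup>+x. indicator {x. \<not> (0 \<le> x \<and> x \<le> 1)} x \<partial>N1) = 0"
    proof (subst N1_int)
      have "(\<integral>\<^sup>+\<omega>. ennreal (exp (- \<tau> r \<omega>)) * indicator {x. \<not> (0 \<le> x \<and> x \<le> 1)} (exp (- \<tau> r \<omega>)) \<partial>Q) = 0" for r
        using AE_tau_nonneg by (subst nn_integral_0_iff_AE) (auto elim!: eventually_mono)
      then show "(\<integral>\<^sup>+r. (if 0 < r then \<integral>\<^sup>+\<omega>. ennreal (exp (- \<tau> r \<omega>)) * indicator {x. \<not> (0 \<le> x \<and> x \<le> 1)} (exp (- \<tau> r \<omega>)) \<partial>Q else 0) \<partial>lborel) = 0"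
        by (simp cong: if_cong)
    qed measurable
    then show "AE x in N1. 0 \<le> x \<and> x \<le> 1"
      by (subst AE_iff_nn_integral) (auto simp: sets space)
    have "(\<integral>\<^sup>+x. indicator {x. \<not> (0 \<le> x \<and> x \<le> 1)} x \<partial>N2) = (\<integral>\<^sup>+y. 0 \<partial>(lborel :: real measure))"
    proof (subst N2_int)
      show "(\<integral>\<^sup>+y. (if 0 < y then ennreal (exp (- 1 * y) * y powr (\<alpha> - 1)) * ennreal (1 / Gamma \<alpha>)
          * indicator {x. \<not> (0 \<le> x \<and> x \<le> 1)} (exp (- y)) else 0) \<partial>lborel) = (\<integral>\<^sup>+y. 0 \<partial>(lborel :: real measure))"
        by (rule nn_integral_cong) simp
    qed measurable
    then show "AE x in N2. 0 \<le> x \<and> x \<le> 1"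
      by (subst AE_iff_nn_integral) (auto simp: sets space)
  qed
  have "N1 = N2"
  proof (rule moments_determine_distribution[OF dist(1) _ dist(2)])
    show "AE x in N1. \<bar>x\<bar> \<le> 1" using bounded(1) by eventually_elim auto
    show "AE x in N2. \<bar>x\<bar> \<le> 1" using bounded(2) by eventually_elim auto
    fix n :: nat
    have nonneg: "AE x in N1. 0 \<le> x ^ n" using bounded(1) by eventually_elim simp
    have nonneg': "AE x in N2. 0 \<le> x ^ n" using bounded(2) by eventually_elim simp
    have "(\<integral>x. x ^ n \<partial>N1) = enn2real (\<integral>\<^sup>+x. ennreal (x ^ n) \<partial>N1)"
      by (rule integral_eq_nn_integral) (use nonneg nonneg' sets in auto)
    also have "\<dots> = enn2real (\<integral>\<^sup>+x. ennreal (x ^ n) \<partial>N2)" unfolding mom1 mom2 ..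
    also have "\<dots> = (\<integral>x. x ^ n \<partial>N2)"
      by (rule integral_eq_nn_integral[symmetric]) (use nonneg nonneg' sets in auto)
    finally show "(\<integral>x. x ^ n \<partial>N1) = (\<integral>x. x ^ n \<partial>N2)" .
  qed
  \<comment> \<open>undoes the weight and the transport\<close>
  define \<psi> where "\<psi> x = \<phi> (- ln x) * ennreal (1 / x)" for x
  have \<psi> [measurable]: "\<psi> \<in> borel_measurable borel" unfolding \<psi>_def[abs_def] by measurable
  have \<psi>_exp: "ennreal (exp (- x)) * \<psi> (exp (- x)) = \<phi> x" for x
  proof -
    have "ennreal (exp (- x)) * \<psi> (exp (- x)) = \<phi> x * (ennreal (exp (- x)) * ennreal (1 / exp (- x)))"
      by (simp add: \<psi>_def mult_ac)
    also have "ennreal (exp (- x)) * ennreal (1 / exp (- x)) = 1"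
      by (simp add: ennreal_mult[symmetric])
    finally show ?thesis by simp
  qed
  have "(\<integral>\<^sup>+r. (if 0 < r then \<integral>\<^sup>+\<omega>. \<phi> (\<tau> r \<omega>) \<partial>Q else 0) \<partial>lborel) = (\<integral>\<^sup>+x. \<psi> x \<partial>N1)"
    by (subst N1_int[OF \<psi>]) (simp only: \<psi>_exp)
  also have "\<dots> = (\<integral>\<^sup>+x. \<psi> x \<partial>N2)" by (simp add: \<open>N1 = N2\<close>)
  also have "\<dots> = (\<integral>\<^sup>+y. (if 0 < y then \<phi> y * ennreal (y powr (\<alpha> - 1) / Gamma \<alpha>) else 0) \<partial>lborel)"
  proof (subst N2_int[OF \<psi>], rule nn_integral_cong)
    fix y :: real
    have "ennreal (exp (- 1 * y) * y powr (\<alpha> - 1)) * ennreal (1 / Gamma \<alpha>) * \<psi> (exp (- y))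
        = ennreal (y powr (\<alpha> - 1)) * ennreal (1 / Gamma \<alpha>) * (ennreal (exp (- y)) * \<psi> (exp (- y)))"
      by (simp add: ennreal_mult mult_ac)
    also have "\<dots> = \<phi> y * ennreal (y powr (\<alpha> - 1) / Gamma \<alpha>)"
      unfolding \<psi>_exp using G by (simp add: ennreal_mult[symmetric] mult.commute)
    finally show "(if 0 < y then ennreal (exp (- 1 * y) * y powr (\<alpha> - 1)) * ennreal (1 / Gamma \<alpha>) * \<psi> (exp (- y)) else 0)
        = (if 0 < y then \<phi> y * ennreal (y powr (\<alpha> - 1) / Gamma \<alpha>) else 0)" by simp
  qed
  finally show ?thesis .
qed

lemma laplace_inverse_increment_nn:
  assumes l: "l > 0" and ab: "a \<le> b"
  shows "(\<integral>\<^sup>+\<omega>. ennreal (exp (- l * (L b \<omega> - L a \<omega>))) \<partial>Q) = inverse_laplace l b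
    + ennreal l * (\<integral>\<^sup>+y. (if 0 < y \<and> y \<le> a then inverse_laplace l (b - y) * ennreal (y powr (\<alpha> - 1) / Gamma \<alpha>) else 0) \<partial>lborel)"
proof -
  have "(\<integral>\<^sup>+r. (if 0 < r then \<integral>\<^sup>+\<omega>. (if \<tau> r \<omega> \<le> a then inverse_laplace l (b - \<tau> r \<omega>) else 0) \<partial>Q else 0) \<partial>lborel)
      = (\<integral>\<^sup>+y. (if 0 < y then (if y \<le> a then inverse_laplace l (b - y) else 0) * ennreal (y powr (\<alpha> - 1) / Gamma \<alpha>) else 0) \<partial>lborel)"
    by (rule potential_density) measurable
  also have "\<dots> = (\<integral>\<^sup>+y. (if 0 < y \<and> y \<le> a then inverse_laplace l (b - y) * ennreal (y powr (\<alpha> - 1) / Gamma \<alpha>) else 0) \<partial>lborel)"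
    by (intro nn_integral_cong) auto
  finally show ?thesis unfolding laplace_inverse_increment_potential[OF l ab] by simp
qed

text \<open>
  For a = b the left-hand side of the preceding identity is 1, and the identity becomes the
  fractional integral equation of the Mittag-Leffler function.
\<close>

lemma inverse_laplace_mittag_leffler:
  assumes l: "l > 0" and b: "b \<ge> 0"
  shows "enn2real (inverse_laplace l b) = mittag_leffler \<alpha> (- l * b powr \<alpha>)"
proof (rule frac_equation_mittag_leffler[OF alpha(1) l _ _ b])
  show "inverse_laplace l x + ennreal l * frac_integral \<alpha> (inverse_laplace l) x = 1" for x
    using laplace_inverse_increment_nn[OF l order_refl, of x] by (simp add: frac_integral_def emeasure_space_1)
qed measurable

lemma inverse_laplace_le_1: "l > 0 \<Longrightarrow> inverse_laplace l b \<le> 1"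
proof -
  assume l: "l > 0"
  have "inverse_laplace l b \<le> (\<integral>\<^sup>+\<omega>. 1 \<partial>Q)"
    unfolding inverse_laplace_eq[OF l]
    by (intro nn_integral_mono_AE, use AE_regular in eventually_elim) (use l inverse_nonneg in auto)
  then show ?thesis by (simp add: emeasure_space_1)
qed

text \<open>
  The substitution y = b * z turns the integral against the potential density into the one over
  [0, a / b].
\<close>

theorem laplace_inverse_increment:
  assumes l: "l > 0" and a: "0 \<le> a" and ab: "a \<le> b"
  shows "(\<integral>\<omega>. exp (- l * (L b \<omega> - L a \<omega>)) \<partial>Q)
    = \<alpha> * l * b powr \<alpha> / Gamma (1 + \<alpha>) *
        (LINT z:{0..a / b}|lborel. mittag_leffler \<alpha> (- l * b powr \<alpha> * (1 - z) powr \<alpha>) / z powr (1 - \<alpha>))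
      + mittag_leffler \<alpha> (- l * b powr \<alpha>)"
proof -
  define e where "e y = enn2real (inverse_laplace l y)" for y
  have e: "inverse_laplace l y = ennreal (e y)" "0 \<le> e y" for y
    using inverse_laplace_le_1[OF l, of y] unfolding e_def
    by (simp_all add: ennreal_enn2real_if) (metis ennreal_one_less_top infinity_ennreal_def leD)
  have e_meas [measurable]: "e \<in> borel_measurable borel" unfolding e_def[abs_def] by measurable
  define K where "K = (\<integral>\<^sup>+y. (if 0 < y \<and> y \<le> a then inverse_laplace l (b - y) * ennreal (y powr (\<alpha> - 1) / Gamma \<alpha>) else 0) \<partial>lborel)"
  have "\<alpha> \<notin> \<int>\<^sub>\<le>\<^sub>0" using alpha nonpos_Ints_nonpos[of \<alpha>] by auto
  then have G: "Gamma \<alpha> > 0" "\<alpha> / Gamma (1 + \<alpha>) = 1 / Gamma \<alpha>"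
    using alpha Gamma_plus1[of \<alpha>] by (auto simp: add.commute)
  have le1: "ennreal (e b) + ennreal l * K \<le> 1"
  proof -
    have "ennreal (e b) + ennreal l * K = (\<integral>\<^sup>+\<omega>. ennreal (exp (- l * (L b \<omega> - L a \<omega>))) \<partial>Q)"
      using laplace_inverse_increment_nn[OF l ab] by (simp add: K_def e)
    also have "\<dots> \<le> (\<integral>\<^sup>+\<omega>. 1 \<partial>Q)"
      by (intro nn_integral_mono_AE, use AE_regular in eventually_elim) (use l inverse_mono[OF _ ab] in auto)
    finally show ?thesis by (simp add: emeasure_space_1)
  qed
  then have fin: "ennreal l * K \<noteq> \<top>"
    by (metis add.commute ennreal_add_eq_top ennreal_one_neq_top top.extremum_unique)
  have "(\<integral>\<omega>. exp (- l * (L b \<omega> - L a \<omega>)) \<partial>Q) = enn2real (\<integral>\<^sup>+\<omega>. ennreal (exp (- l * (L b \<omega> - L a \<omega>))) \<partial>Q)"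
    by (rule integral_eq_nn_integral) auto
  also have "\<dots> = enn2real (ennreal (e b) + ennreal l * K)"
    using laplace_inverse_increment_nn[OF l ab] by (simp add: K_def e)
  also have "\<dots> = e b + l * enn2real K"
    using fin l e by (subst enn2real_plus) (auto simp: enn2real_mult less_top[symmetric])
  also have "e b = mittag_leffler \<alpha> (- l * b powr \<alpha>)"
    unfolding e_def using a ab by (intro inverse_laplace_mittag_leffler l) simp
  also have "l * enn2real K = \<alpha> * l * b powr \<alpha> / Gamma (1 + \<alpha>) *
        (LINT z:{0..a / b}|lborel. mittag_leffler \<alpha> (- l * b powr \<alpha> * (1 - z) powr \<alpha>) / z powr (1 - \<alpha>))"
  \<comment> \<open>for b = 0 also a = 0, and both integrals run over a null set\<close>
  proof (cases "b = 0")
    case True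
    with a ab have "K = (\<integral>\<^sup>+y. 0 \<partial>(lborel :: real measure))" unfolding K_def by (intro nn_integral_cong) auto
    with True show ?thesis by simp
  next
    case False
    with a ab have b: "b > 0" by simp
    define g where "g z = indicator {0..a / b} z * (e (b - b * z) * z powr (\<alpha> - 1))" for z
    have g_meas [measurable]: "g \<in> borel_measurable borel" unfolding g_def[abs_def] by measurable
    have g_nonneg: "0 \<le> g z" for z unfolding g_def using e by simp
    have "(LINT z:{0..a / b}|lborel. mittag_leffler \<alpha> (- l * b powr \<alpha> * (1 - z) powr \<alpha>) / z powr (1 - \<alpha>))
        = (LINT z|lborel. g z)"
      unfolding set_lebesgue_integral_def
    proof (rule Bochner_Integration.integral_cong)
      fix z :: real
      show "indicator {0..a / b} z *\<^sub>R (mittag_leffler \<alpha> (- l * b powr \<alpha> * (1 - z) powr \<alpha>) / z powr (1 - \<alpha>)) = g z"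
      proof (cases "z \<in> {0..a / b}")
        case True
        then have z: "0 \<le> z" "z \<le> 1" using b ab by (auto intro: order_trans)
        have "b - b * z = b * (1 - z)" by (simp add: algebra_simps)
        then have "e (b - b * z) = mittag_leffler \<alpha> (- l * (b * (1 - z)) powr \<alpha>)"
          unfolding e_def using b z by (subst inverse_laplace_mittag_leffler[OF l]) auto
        then have "e (b - b * z) = mittag_leffler \<alpha> (- l * b powr \<alpha> * (1 - z) powr \<alpha>)"
          using b z by (simp add: powr_mult mult.assoc)
        moreover have "z powr (\<alpha> - 1) = 1 / z powr (1 - \<alpha>)"
          using powr_minus_divide[of z "1 - \<alpha>"] by simp
        ultimately show ?thesis using True by (simp add: g_def)
      qed (simp add: g_def)
    qed simp
    also have "\<dots> = enn2real (\<integral>\<^sup>+z. ennreal (g z) \<partial>lborel)"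
      by (rule integral_eq_nn_integral) (auto simp: g_nonneg)
    finally have LINT: "(LINT z:{0..a / b}|lborel. mittag_leffler \<alpha> (- l * b powr \<alpha> * (1 - z) powr \<alpha>) / z powr (1 - \<alpha>))
        = enn2real (\<integral>\<^sup>+z. ennreal (g z) \<partial>lborel)" .
    let ?k = "\<lambda>y. if 0 < y \<and> y \<le> a then inverse_laplace l (b - y) * ennreal (y powr (\<alpha> - 1) / Gamma \<alpha>) else 0"
    have "K = ennreal \<bar>b\<bar> * (\<integral>\<^sup>+z. ?k (0 + b * z) \<partial>lborel)"
      unfolding K_def by (rule nn_integral_real_affine) (use b in auto)
    also have "\<dots> = (\<integral>\<^sup>+z. ennreal \<bar>b\<bar> * ?k (0 + b * z) \<partial>lborel)"
      by (rule nn_integral_cmult[symmetric]) measurable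
    also have "\<dots> = (\<integral>\<^sup>+z. ennreal (b powr \<alpha> / Gamma \<alpha>) * ennreal (g z) \<partial>lborel)"
    proof (rule nn_integral_cong)
      fix z :: real
      show "ennreal \<bar>b\<bar> * ?k (0 + b * z) = ennreal (b powr \<alpha> / Gamma \<alpha>) * ennreal (g z)"
      proof (cases "0 < z \<and> b * z \<le> a")
        case True
        then have *: "0 < b * z" "z \<in> {0..a / b}" using b by (auto simp: field_simps)
        have mult: "ennreal b * (ennreal u * ennreal v) = ennreal (b * (u * v))" if "0 \<le> u" "0 \<le> v" for u v
          using that b by (simp add: ennreal_mult)
        have "ennreal \<bar>b\<bar> * ?k (0 + b * z)
            = ennreal b * (ennreal (e (b - b * z)) * ennreal ((b * z) powr (\<alpha> - 1) / Gamma \<alpha>))"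
          using True * b by (simp add: e)
        also have "\<dots> = ennreal (b * (e (b - b * z) * ((b * z) powr (\<alpha> - 1) / Gamma \<alpha>)))"
          using G e by (intro mult) auto
        also have "b * (e (b - b * z) * ((b * z) powr (\<alpha> - 1) / Gamma \<alpha>))
            = (b * b powr (\<alpha> - 1)) / Gamma \<alpha> * (e (b - b * z) * z powr (\<alpha> - 1))"
          using True b by (simp add: powr_mult)
        also have "b * b powr (\<alpha> - 1) = b powr \<alpha>"
          using b by (simp add: powr_diff)
        also have "ennreal (b powr \<alpha> / Gamma \<alpha> * (e (b - b * z) * z powr (\<alpha> - 1))) = ennreal (b powr \<alpha> / Gamma \<alpha>) * ennreal (g z)"
          using * G e by (subst ennreal_mult) (auto simp: g_def)
        finally show ?thesis .
      next
        case False
        then have "g z = 0" "\<not> (0 < b * z \<and> b * z \<le> a)"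
          using b by (auto simp: g_def indicator_def field_simps zero_less_mult_iff)
        moreover from this(2) have "?k (0 + b * z) = 0" by (simp only: add_0_left if_False)
        ultimately show ?thesis by (simp only: mult_zero_right ennreal_0)
      qed
    qed
    also have "\<dots> = ennreal (b powr \<alpha> / Gamma \<alpha>) * (\<integral>\<^sup>+z. ennreal (g z) \<partial>lborel)"
      by (rule nn_integral_cmult) measurable
    finally have "enn2real K = b powr \<alpha> / Gamma \<alpha> * enn2real (\<integral>\<^sup>+z. ennreal (g z) \<partial>lborel)"
      using G by (simp add: enn2real_mult)
    then have "l * enn2real K = (1 / Gamma \<alpha>) * l * b powr \<alpha> * enn2real (\<integral>\<^sup>+z. ennreal (g z) \<partial>lborel)"
      by simp
    then show ?thesis unfolding LINT G(2)[symmetric] by simp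
  qed
  finally show ?thesis by simp
qed

end

section \<open>The correlation of the time-changed process\<close>

theorem corollary25:
  fixes \<alpha> \<beta> s t :: real
    and S :: "real set"
    and M :: "'a measure"
    and F P :: "real \<Rightarrow> 'a measure"
    and X \<sigma> :: "real \<Rightarrow> 'a \<Rightarrow> real"
    and \<G> :: "(real \<Rightarrow> real) \<Rightarrow> (real \<Rightarrow> real)"
    and \<mu> :: "real measure"
    and B1 B2 :: "nat \<Rightarrow> real \<Rightarrow> real"
    and A1 A2 :: "real mat"
  defines "P\<mu> \<equiv> initial_law P \<mu>"
    and "L \<equiv> inverse_process \<sigma>"
  assumes alpha: "0 < \<alpha>" "\<alpha> < 1"
    and S: "closed S" "interior S \<noteq> {}"
    and X: "markov_process M F S P X"
    and G: "extended_generator S F P X \<G>"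
    and poly: "polynomial_process 2 S F P X \<G>"
    and mu: "limiting 2 S P X \<mu>"
    and var: "(\<integral>y. y\<^sup>2 \<partial>\<mu>) - (\<integral>y. y \<partial>\<mu>)\<^sup>2 \<noteq> 0"
    and sigma: "stable_subordinator P\<mu> \<alpha> \<sigma>"
    and indep: "independent_processes P\<mu> X \<sigma>"
    and A2: "generator_matrix S \<G> 2 B2 A2" "zero_stable A2"
    and A1: "generator_matrix S \<G> 1 B1 A1" "complex_spectrum A1 = {0, complex_of_real (- \<beta>)}"
    and beta: "- \<beta> < 0"
    and st: "s \<ge> 0" "t \<ge> 0"
  shows "correlation P\<mu> (\<lambda>\<omega>. X (L (t + s) \<omega>) \<omega>) (\<lambda>\<omega>. X (L t \<omega>) \<omega>)
           = increment_laplace P\<mu> L s t \<beta> \<and>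
         increment_laplace P\<mu> L s t \<beta>
           = \<alpha> * \<beta> * (t + s) powr \<alpha> / Gamma (1 + \<alpha>) *
               (LINT z:{0..t / (t + s)}|lborel.
                  mittag_leffler \<alpha> (- \<beta> * (t + s) powr \<alpha> * (1 - z) powr \<alpha>) / z powr (1 - \<alpha>))
             + mittag_leffler \<alpha> (- \<beta> * (t + s) powr \<alpha>)"
proof -
  interpret reverting_process M F S P X \<G> \<mu> \<beta> B1 B2 A1 A2
    by (intro reverting_process.intro quadratic_process.intro quadratic_process_axioms.intro
        reverting_process_axioms.intro X G poly S mu A1(1) A2(1)) (use A1(2) beta in auto)
  have P\<mu>: "P\<mu> = Q" by (simp add: P\<mu>_def Q_def)
  interpret sub: inverse_stable_subordinator Q \<alpha> \<sigma>
    by (intro inverse_stable_subordinator.intro inverse_stable_subordinator_axioms.intro prob_Q alpha sigma[unfolded P\<mu>])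
  have "correlation Q (\<lambda>\<omega>. X (L (t + s) \<omega>) \<omega>) (\<lambda>\<omega>. X (L t \<omega>) \<omega>)
      = (\<integral>\<omega>. exp (- \<beta> * \<bar>L (t + s) \<omega> - L t \<omega>\<bar>) \<partial>Q)"
  proof (rule correlation_time_change[OF indep[unfolded P\<mu>]])
    show "mu_square - mu_mean\<^sup>2 \<noteq> 0" using var by (simp add: mu_mean_def mu_square_def)
    show "L (t + s) \<in> borel_measurable N \<and> L t \<in> borel_measurable N"
      if "space N = space Q" "\<And>t. 0 \<le> t \<Longrightarrow> \<sigma> t \<in> borel_measurable N" for N
      unfolding L_def using that by (intro conjI inverse_process_measurable sub.cadlag_sigma sub.mono) auto
  qed (auto simp: L_def inverse_process_nonneg)
  also have "\<dots> = increment_laplace Q L s t \<beta>"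
    unfolding increment_laplace_def L_def
    by (rule integral_cong_AE, measurable, use sub.AE_regular in eventually_elim)
       (use sub.inverse_mono[of _ t "t + s"] st in simp)
  finally have "correlation Q (\<lambda>\<omega>. X (L (t + s) \<omega>) \<omega>) (\<lambda>\<omega>. X (L t \<omega>) \<omega>) = increment_laplace Q L s t \<beta>" .
  moreover have "increment_laplace Q L s t \<beta>
      = \<alpha> * \<beta> * (t + s) powr \<alpha> / Gamma (1 + \<alpha>) *
          (LINT z:{0..t / (t + s)}|lborel.
             mittag_leffler \<alpha> (- \<beta> * (t + s) powr \<alpha> * (1 - z) powr \<alpha>) / z powr (1 - \<alpha>))
        + mittag_leffler \<alpha> (- \<beta> * (t + s) powr \<alpha>)"
    unfolding increment_laplace_def L_def
    by (rule sub.laplace_inverse_increment) (use beta st in auto)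
  ultimately show ?thesis unfolding P\<mu> ..
qed

end
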